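(* Let $n\ge 2$ and let $F\subset S^{n-1}$ be a non-empty closed subset of the following form: if $n\ge 3$, $F$ is the closure of some open subset of $S^{n-1}$ with $C^{1,1}$-boundary; if $n=2$, $F$ is a finite union of non-trivial intervals (arcs) of the unit circle. Define $V_F:\mathbb{R}^n\to\mathbb{R}$ by $V_F(x)=\sup_{\lambda\in F}x\cdot\lambda$. Let $k_1>k_2$ be two positive constants. Then there exist two functions $\underline u\le\overline u$ from $\mathbb{R}^n$ to $\mathbb{R}$ such that $\underline u$ is convex and is the (pointwise) supremum of a family of strictly convex, strictly spacelike functions $u:\mathbb{R}^n\to\mathbb{R}$ satisfying $K[u]=k_1$ (so $\underline u$ is a subsolution to the equation of prescribed Gauss curvature $k_1$), and $\overline u$ is the (pointwise) infimum of a family of strictly convex, strictly spacelike functions $u:\mathbb{R}^n\to\mathbb{R}$ satisfying $K[u]=k_2$ (so $\overline u$ is a supersolution to the equation of prescribed Gauss curvature $k_2$), and such that the following hold: (i) $|\underline u(x)-V_F(x)|+|\overline u(x)-V_F(x)|\to 0$ as $|x|\to\infty$. (ii) For every compact subset $C\subset\mathbb{R}^n$ there exists a constant $\theta>0$ such that for all $x,y\in C$: $|\underline u(x)-\underline u(y)|\le(1-\theta)|x-y|$ and $|\overline u(x)-\overline u(y)|\le(1-\theta)|x-y|$. (iii) For every compact subset $C\subset\mathbb{R}^n$ there exists a constant $\delta>0$ such that for all $x\in C$: $V_F(x)+\delta\le\underline u(x)\le\overline u(x)-\delta$.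
   Context: $S^{n-1}$ is the unit sphere in $\mathbb{R}^n$ (viewed as the ideal boundary of hyperbolic space in the Klein model $B_1(0)$). A $C^2$ function $u:\mathbb{R}^n\to\mathbb{R}$ is strictly convex if its Hessian $D^2u$ is positive definite everywhere, and strictly spacelike if $|Du|<1$ everywhere. For such $u$, $$K[u]=\frac{\det D^2u}{(1-|Du|^2)^{\frac{n+2}{2}}}$$ is the Gauss curvature of $\operatorname{graph}u$ in Minkowski space $\mathbb{L}^{n+1}$ (metric $\operatorname{diag}(1,\dots,1,-1)$). A supremum of solutions of $K[u]=k_1$ is regarded as a (viscosity) subsolution, an infimum of solutions of $K[u]=k_2$ as a (viscosity) supersolution. *)

theory Defs
  imports "HOL-Analysis.Analysis"
begin

text \<open>
  \<open>\<real>\<^sup>n\<close> is \<open>real ^ 'n\<close> with \<open>n = CARD('n)\<close>.  Junk values of \<open>frechet_derivative\<close> are harmless: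
  \<open>gradient\<close> and \<open>hessian\<close> are only used together with the corresponding differentiability.
\<close>

definition gradient :: "(real ^ 'n \<Rightarrow> real) \<Rightarrow> real ^ 'n \<Rightarrow> real ^ 'n" where
  "gradient u x = (\<chi> i. frechet_derivative u (at x) (axis i 1))"

definition hessian :: "(real ^ 'n \<Rightarrow> real) \<Rightarrow> real ^ 'n \<Rightarrow> real ^ 'n ^ 'n" where
  "hessian u x = matrix (frechet_derivative (gradient u) (at x))"

definition C2 :: "(real ^ 'n \<Rightarrow> real) \<Rightarrow> bool" where
  "C2 u \<longleftrightarrow> u differentiable_on UNIV \<and> gradient u differentiable_on UNIV \<and>
     continuous_on UNIV (hessian u)"

definition C11 :: "(real ^ 'n \<Rightarrow> real) \<Rightarrow> bool" where
  "C11 f \<longleftrightarrow> f differentiable_on UNIV \<and>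
     (\<forall>C. compact C \<longrightarrow> (\<exists>L. L-lipschitz_on C (gradient f)))"

definition strictly_convex :: "(real ^ 'n \<Rightarrow> real) \<Rightarrow> bool" where
  "strictly_convex u \<longleftrightarrow> C2 u \<and> (\<forall>x h. h \<noteq> 0 \<longrightarrow> h \<bullet> (hessian u x *v h) > 0)"

definition strictly_spacelike :: "(real ^ 'n \<Rightarrow> real) \<Rightarrow> bool" where
  "strictly_spacelike u \<longleftrightarrow> C2 u \<and> (\<forall>x. norm (gradient u x) < 1)"

definition gauss_curvature :: "(real ^ 'n \<Rightarrow> real) \<Rightarrow> real ^ 'n \<Rightarrow> real" where
  "gauss_curvature u x =
     det (hessian u x) / (1 - (norm (gradient u x))\<^sup>2) powr ((real CARD('n) + 2) / 2)"

definition curvature_solutions :: "real \<Rightarrow> (real ^ 'n \<Rightarrow> real) set" where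
  "curvature_solutions k =
     {u. strictly_convex u \<and> strictly_spacelike u \<and> (\<forall>x. gauss_curvature u x = k)}"

text \<open>
  The families are non-empty and pointwise bounded, so that the real-valued \<open>SUP\<close> and \<open>INF\<close> are
  genuine suprema and infima.
\<close>

definition sup_of_solutions :: "real \<Rightarrow> (real ^ 'n \<Rightarrow> real) \<Rightarrow> bool" where
  "sup_of_solutions k w \<longleftrightarrow> (\<exists>\<U>. \<U> \<noteq> {} \<and> \<U> \<subseteq> curvature_solutions k \<and>
     (\<forall>x. bdd_above ((\<lambda>u. u x) ` \<U>) \<and> w x = (SUP u\<in>\<U>. u x)))"

definition inf_of_solutions :: "real \<Rightarrow> (real ^ 'n \<Rightarrow> real) \<Rightarrow> bool" where
  "inf_of_solutions k w \<longleftrightarrow> (\<exists>\<U>. \<U> \<noteq> {} \<and> \<U> \<subseteq> curvature_solutions k \<and>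
     (\<forall>x. bdd_below ((\<lambda>u. u x) ` \<U>) \<and> w x = (INF u\<in>\<U>. u x)))"

definition support_fun :: "(real ^ 'n) set \<Rightarrow> real ^ 'n \<Rightarrow> real" where
  "support_fun F x = (SUP l\<in>F. x \<bullet> l)"

text \<open>
  A relatively open set \<open>U\<close> of the sphere has \<open>C\<^sup>1\<^sup>,\<^sup>1\<close> boundary if, near each boundary point \<open>p\<close>,
  it is the strict subgraph of a \<open>C\<^sup>1\<^sup>,\<^sup>1\<close> function in the coordinates of the sphere given by
  orthogonal projection to the tangent space at \<open>p\<close>.  Here \<open>\<nu>\<close> is the (unit, tangential) vertical
  direction of the graph, and \<open>x - (x \<bullet> p) *\<^sub>R p - (x \<bullet> \<nu>) *\<^sub>R \<nu>\<close> is the projection of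
  \<open>x\<close> to the horizontal \<open>(n-2)\<close>-dimensional space orthogonal to \<open>p\<close> and \<open>\<nu>\<close>; only the
  restriction of \<open>f\<close> to a neighbourhood of \<open>0\<close> in that space matters, so taking \<open>f\<close> to be defined
  on all of \<open>\<real>\<^sup>n\<close> is no restriction (compose with the projection and multiply by a cut-off).
\<close>

definition C11_boundary_in_sphere :: "(real ^ 'n) set \<Rightarrow> bool" where
  "C11_boundary_in_sphere U \<longleftrightarrow>
     (\<forall>p \<in> (top_of_set (sphere 0 1)) frontier_of U.
        \<exists>\<nu> r f. norm \<nu> = 1 \<and> \<nu> \<bullet> p = 0 \<and> 0 < r \<and> C11 f \<and>
          U \<inter> ball p r = {x \<in> sphere 0 1 \<inter> ball p r.
             x \<bullet> \<nu> < f (x - (x \<bullet> p) *\<^sub>R p - (x \<bullet> \<nu>) *\<^sub>R \<nu>)})"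

text \<open>
  Non-trivial closed arcs of the unit circle, for \<open>CARD('n) = 2\<close>; the full circle is a union of
  two of them.
\<close>

definition circle_arc :: "(real ^ 'n) set \<Rightarrow> bool" where
  "circle_arc A \<longleftrightarrow> (\<exists>e1 e2 a b. norm e1 = 1 \<and> norm e2 = 1 \<and> e1 \<bullet> e2 = 0 \<and>
     a < b \<and> b < a + 2 * pi \<and> A = (\<lambda>t. cos t *\<^sub>R e1 + sin t *\<^sub>R e2) ` {a..b})"

definition admissible_set :: "(real ^ 'n) set \<Rightarrow> bool" where
  "admissible_set F \<longleftrightarrow> F \<noteq> {} \<and> closed F \<and> F \<subseteq> sphere 0 1 \<and>
     (CARD('n) \<ge> 3 \<longrightarrow> (\<exists>U. openin (top_of_set (sphere 0 1)) U \<and>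
        C11_boundary_in_sphere U \<and> F = closure U)) \<and>
     (CARD('n) = 2 \<longrightarrow> (\<exists>\<A>. finite \<A> \<and> (\<forall>A\<in>\<A>. circle_arc A) \<and> F = \<Union>\<A>))"

end

theory Submission
  imports Defs
begin

text \<open>
  The families consist of explicit entire hypersurfaces of constant Gauss curvature. In Minkowski
  space rotate a curve \<open>y \<mapsto> f y\<close>, the \<^emph>\<open>profile\<close>, about a spacelike line: \<open>K = k\<close> becomes the
  equation \<open>f'' = k f\<^sup>n\<^sup>-\<^sup>1 (1 - f'\<^sup>2)\<^sup>(\<^sup>n\<^sup>+\<^sup>2\<^sup>)\<^sup>/\<^sup>2\<close>, and the solution asymptotic to \<open>max y 0\<close> at both ends gives a
  semitrough, whose boundary values at infinity are those of a half sphere. Its Lorentz boosts are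
  the graphs belonging to all spherical caps.

  The lower barrier is the supremum of the semitroughs of curvature \<open>k1\<close> over caps of a fixed radius inside
  \<open>F\<close>, the upper one the infimum of those of curvature \<open>k2\<close> over caps containing \<open>F\<close> with radius bounded
  away from \<open>0\<close> and \<open>pi\<close>. Two semitroughs over nested caps can be compared directly, without a
  maximum principle. Regularity of the boundary of \<open>F\<close> enters through uniform interior and exterior
  touching caps; then the estimates follow because the parameters range over a compact set.
  When \<open>F\<close> is the whole sphere, hyperboloids do the job.
\<close>

section \<open>Profile curves\<close>

text \<open>The boosts form a noncompact family: when a cap shrinks to a point or swells to the
  whole sphere, its parameter \<open>S\<close> (the hyperbolic sine of the boost, and minus the
  cotangent of the angular radius) runs off to infinity, and no estimate is uniform any more. The
  geometry of \<open>F\<close> therefore enters through one number \<open>S0\<close> only: at each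
  boundary point of \<open>F\<close> a cap of parameter \<open>- S0\<close> fits inside
  \<open>F\<close> and a cap of parameter \<open>S0\<close> contains \<open>F\<close>. Two facts
  follow. Every point of \<open>F\<close> lies in an inscribed cap of parameter \<open>- S0\<close>;
  this lifts the lower barrier above the support function. For every \<open>x\<close> some
  containing cap with \<open>\<bar>S\<bar> \<le> S0\<close> has at \<open>x\<close> a support
  function no larger than that of \<open>F\<close>; this brings the upper barrier down to the
  support function at infinity. Nested caps are compared through a causal inequality between their
  Minkowski normals. It is a closed condition on the parameters, so it survives compactness
  arguments, and it is what the pointwise comparison consumes.\<close>

text \<open>With \<open>y\<close> measured along the axis and \<open>rho\<close> the distance from
  it, the surface is \<open>height = sqrt ((f y)^2 + rho^2)\<close>. Its Gauss curvature turns out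
  to be \<open>f'' / (f^(n-1) (1 - f'^2)^((n+2)/2))\<close>, and \<open>ode\<close> sets this equal
  to \<open>k\<close>. Here \<open>n\<close> is an independent number; it is identified with the
  dimension when the curvature is evaluated.\<close>

locale curvature_profile =
  fixes n :: nat and k :: real and f f' f'' :: "real \<Rightarrow> real"
  assumes k_pos: "0 < k"
    and f_pos: "0 < f y"
    and f_deriv: "(f has_real_derivative f' y) (at y)"
    and f'_deriv: "(f' has_real_derivative f'' y) (at y)"
    and f''_cont: "continuous_on UNIV f''"
    and f'_bound: "\<bar>f' y\<bar> < 1"
    and ode: "f'' y = k * f y ^ (n - 1) * (1 - (f' y)\<^sup>2) powr ((real n + 2) / 2)"
begin

lemma f'_sq_less: "(f' y)\<^sup>2 < 1"
  using f'_bound[of y] by (simp add: abs_square_less_1)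

lemma f''_pos: "0 < f'' y"
  unfolding ode using k_pos f_pos[of y] f'_sq_less[of y] by simp

lemma f_cont: "continuous_on A f"
  by (meson DERIV_isCont f_deriv continuous_at_imp_continuous_on)

lemma f'_cont: "continuous_on A f'"
  by (meson DERIV_isCont f'_deriv continuous_at_imp_continuous_on)

lemma f_lipschitz: "\<bar>f y - f z\<bar> \<le> \<bar>y - z\<bar>"
proof -
  have "norm (f y - f z) \<le> 1 * norm (y - z)"
  proof (rule field_differentiable_bound[of UNIV f f'])
    fix z show "(f has_field_derivative f' z) (at z within UNIV)" using f_deriv by simp
  next
    fix z show "norm (f' z) \<le> 1" using f'_bound[of z] by simp
  qed auto
  then show ?thesis by simp
qed

end

text \<open>\<open>f_gt\<close> puts the surface strictly above the support function of a half
  sphere, and the two limits make it asymptotic to it. \<open>gamma_pos\<close> is about half the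
  derivative of \<open>f^2 - y^2\<close>: on the surface this quantity equals the Lorentz invariant
  \<open>t^2 - |x|^2\<close>, and its monotonicity decides the comparison of two
  semitroughs.\<close>

locale semitrough_profile = curvature_profile +
  assumes f_gt: "max y 0 < f y"
    and f_top: "((\<lambda>y. f y - y) \<longlongrightarrow> 0) at_top"
    and f_bot: "(f \<longlongrightarrow> 0) at_bot"
    and f'_pos: "0 < f' y"
    and gamma_pos: "0 < f y * f' y - y"
begin

lemma f_sq_minus_sq_strict_mono:
  assumes "y < z" shows "(f y)\<^sup>2 - y\<^sup>2 < (f z)\<^sup>2 - z\<^sup>2"
proof (rule DERIV_pos_imp_increasing[OF assms])
  fix x
  have "((\<lambda>x. (f x)\<^sup>2 - x\<^sup>2) has_real_derivative 2 * (f x * f' x - x)) (at x)"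
    by (auto intro!: derivative_eq_intros f_deriv simp: algebra_simps)
  then show "\<exists>d. ((\<lambda>x. (f x)\<^sup>2 - x\<^sup>2) has_real_derivative d) (at x) \<and> 0 < d"
    using gamma_pos[of x] by auto
qed

end

text \<open>Rotation gives \<open>sqrt (|x|^2 + \<kappa>)\<close>, a hyperboloid of curvature
  \<open>\<kappa> powr (- n / 2)\<close>; this explains the choice of \<open>\<kappa>\<close>. The
  profile grows at both ends, so it is no semitrough and instantiates the weaker locale
  only.\<close>

lemma hyperboloid_profile:
  assumes "0 < k" "n \<ge> 1"
  defines "\<kappa> \<equiv> k powr (- 2 / real n)"
  shows "curvature_profile n k (\<lambda>y. sqrt (y\<^sup>2 + \<kappa>)) (\<lambda>y. y / sqrt (y\<^sup>2 + \<kappa>))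
    (\<lambda>y. \<kappa> / (sqrt (y\<^sup>2 + \<kappa>)) ^ 3)"
proof
  have \<kappa>: "\<kappa> > 0" unfolding \<kappa>_def using assms by simp
  have pos: "y\<^sup>2 + \<kappa> > 0" for y :: real using \<kappa> by (simp add: add_nonneg_pos)
  have spos: "sqrt (y\<^sup>2 + \<kappa>) > 0" for y using pos by simp
  fix y
  show "0 < k" by fact
  show "0 < sqrt (y\<^sup>2 + \<kappa>)" using pos by simp
  show "((\<lambda>y. sqrt (y\<^sup>2 + \<kappa>)) has_real_derivative y / sqrt (y\<^sup>2 + \<kappa>)) (at y)"
    using pos[of y] by (auto intro!: derivative_eq_intros simp: field_simps)
  have sq: "(sqrt (y\<^sup>2 + \<kappa>))\<^sup>2 = y\<^sup>2 + \<kappa>" using pos[of y] by simp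
  show "((\<lambda>y. y / sqrt (y\<^sup>2 + \<kappa>)) has_real_derivative \<kappa> / (sqrt (y\<^sup>2 + \<kappa>)) ^ 3) (at y)"
  proof -
    have "((\<lambda>y. y / sqrt (y\<^sup>2 + \<kappa>)) has_real_derivative
      (sqrt (y\<^sup>2 + \<kappa>) - y * (y / sqrt (y\<^sup>2 + \<kappa>))) / (sqrt (y\<^sup>2 + \<kappa>))\<^sup>2) (at y)"
      using pos[of y] spos[of y] by (auto intro!: derivative_eq_intros simp: field_simps power2_eq_square)
    also have "(sqrt (y\<^sup>2 + \<kappa>) - y * (y / sqrt (y\<^sup>2 + \<kappa>))) = \<kappa> / sqrt (y\<^sup>2 + \<kappa>)"
      using sq spos[of y] by (simp add: field_simps power2_eq_square)
    finally show ?thesis by (simp add: power2_eq_square power3_eq_cube mult.commute)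
  qed
  show "continuous_on UNIV (\<lambda>y. \<kappa> / (sqrt (y\<^sup>2 + \<kappa>)) ^ 3)"
    by (intro continuous_intros) (use spos in \<open>auto simp: less_imp_neq[symmetric]\<close>)
  have "y\<^sup>2 < y\<^sup>2 + \<kappa>" using \<kappa> by simp
  then have "\<bar>y\<bar> < sqrt (y\<^sup>2 + \<kappa>)" using real_less_rsqrt power2_abs by metis
  then show "\<bar>y / sqrt (y\<^sup>2 + \<kappa>)\<bar> < 1" using spos[of y] by (simp add: field_simps)
  define s where "s = sqrt (y\<^sup>2 + \<kappa>)"
  have s: "s > 0" "s\<^sup>2 = y\<^sup>2 + \<kappa>" using spos sq by (auto simp: s_def)
  have "1 - (y / s)\<^sup>2 = (s\<^sup>2 - y\<^sup>2) / s\<^sup>2" using s(1) by (simp add: field_simps)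
  then have "1 - (y / s)\<^sup>2 = \<kappa> / s\<^sup>2" using s(2) by simp
  then have "(1 - (y / s)\<^sup>2) powr ((real n + 2) / 2) = \<kappa> powr ((real n + 2) / 2) / (s\<^sup>2) powr ((real n + 2) / 2)"
    using \<kappa> s(1) by (simp add: powr_divide)
  also have "(s\<^sup>2) powr ((real n + 2) / 2) = s ^ (n + 2)"
  proof -
    have "s\<^sup>2 = s powr 2" using s(1) by (simp add: powr_numeral)
    then have "(s\<^sup>2) powr ((real n + 2) / 2) = s powr (real (n + 2))"
      by (simp add: powr_powr add_divide_distrib add.commute)
    also have "\<dots> = s ^ (n + 2)" using s(1) by (rule powr_realpow)
    finally show ?thesis .
  qed
  also have "\<kappa> powr ((real n + 2) / 2) = \<kappa> / k"
  proof -
    have "(-2 / real n) * ((real n + 2) / 2) = - 2 / real n - 1" using assms(2) by (simp add: field_simps)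
    then show ?thesis unfolding \<kappa>_def using assms(1) by (simp add: powr_powr powr_diff)
  qed
  finally have "k * s ^ (n - 1) * (1 - (y / s)\<^sup>2) powr ((real n + 2) / 2) = s ^ (n - 1) * \<kappa> / s ^ (n + 2)"
    using assms(1) by simp
  also have "s ^ (n + 2) = s ^ (n - 1) * s ^ 3" using assms(2) by (simp flip: power_add)
  finally show "\<kappa> / s ^ 3 = k * s ^ (n - 1) * (1 - (y / s)\<^sup>2) powr ((real n + 2) / 2)"
    using s by simp
qed

lemma semitrough_profile_1:
  assumes n: "n \<ge> 2"
  obtains f f' f'' where "semitrough_profile n 1 f f' f''"
proof -
  txt \<open>The equation has the first integral \<open>1 - f'\<^sup>2 = E(f)\<close>, i.e. \<open>f' = h(f)\<close>. Hence \<open>f\<close> is the inverse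
    of a primitive \<open>T\<close> of \<open>1 / h\<close>, normalised by \<open>T(v) - v \<rightarrow> 0\<close> at infinity.\<close>
  define E where "E v = (1 + v ^ n) powr (- 2 / real n)" for v :: real
  define h where "h v = sqrt (1 - E v)" for v
  have E_pos: "0 < E v" if "v > 0" for v
    using that unfolding E_def by (smt (verit) powr_gt_zero zero_less_power)
  have E_less: "E v < 1" if "v > 0" for v
    proof -
    have "1 + v ^ n > 1" using that by simp
    then have "(1 + v ^ n) powr (- 2 / real n) < (1 + v ^ n) powr 0"
      using n by (intro powr_less_mono) (auto simp: divide_neg_pos)
    then show ?thesis unfolding E_def using \<open>1 + v ^ n > 1\<close> by simp
  qed
  have E_le: "E v \<le> 1 / v\<^sup>2" if "v > 0" for v
  proof -
    have "E v \<le> (v ^ n) powr (- 2 / real n)"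
      unfolding E_def using that n by (intro powr_mono2') auto
    also have "\<dots> = v powr (-2)" using that n by (simp add: powr_powr flip: powr_realpow)
    also have "\<dots> = 1 / v\<^sup>2" using that by (simp add: powr_minus_divide)
    finally show ?thesis .
  qed
  have h_pos: "0 < h v" and h_less: "h v < 1" and h_sq: "(h v)\<^sup>2 = 1 - E v" if "v > 0" for v
    using E_pos[OF that] E_less[OF that] unfolding h_def by auto
  \<comment> \<open>Quadratic decay of \<open>1 - h\<close> makes \<open>1 / h - 1\<close>
    integrable at infinity, so that \<open>T v - v\<close> can be normalised to tend to 0.\<close>
  have one_h: "1 - h v \<le> 1 / v\<^sup>2" if "v > 0" for v
  proof -
    have "(1 - h v) * (1 + h v) = E v" using h_sq[OF that] by (simp add: algebra_simps power2_eq_square)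
    moreover have "(1 - h v) * 1 \<le> (1 - h v) * (1 + h v)"
      using h_pos[OF that] h_less[OF that] by (intro mult_left_mono) auto
    ultimately show ?thesis using E_le[OF that] by simp
  qed
  \<comment> \<open>Near 0 the integrand \<open>1 / h\<close> dominates \<open>1 / v\<close>. Hence
    \<open>T\<close> tends to minus infinity there, and its inverse \<open>f\<close> is defined on
    the whole line. This uses \<open>n \<ge> 2\<close>.\<close>
  have h_le: "h v \<le> v" if "v > 0" "v \<le> 1" for v
  proof -
    have "- (2 / real n) * ln (1 + v ^ n) \<ge> - 1 * v ^ n"
    proof -
      have "(2 / real n) * ln (1 + v ^ n) \<le> 1 * v ^ n"
        using n that by (intro mult_mono ln_add_one_self_le_self) (auto simp: field_simps)
      then show ?thesis by simp
    qed
    moreover have "E v = exp (- (2 / real n) * ln (1 + v ^ n))"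
      unfolding E_def powr_def using that by (smt (verit) minus_divide_left zero_less_power)
    ultimately have "E v \<ge> 1 - v ^ n"
      using exp_ge_add_one_self[of "- (2 / real n) * ln (1 + v ^ n)"] by linarith
    moreover have "v ^ n \<le> v ^ 2" using that n by (intro power_decreasing) auto
    ultimately show ?thesis unfolding h_def using that by (intro real_le_lsqrt) auto
  qed
  have h_deriv: "(h has_real_derivative (v ^ (n - 1) * (1 + v ^ n) powr (- 2 / real n - 1) / h v)) (at v)"
    if "v > 0" for v
  proof -
    have p: "1 + v ^ n > 0" using that by (simp add: add_pos_pos)
    have "(E has_real_derivative (1 + v ^ n) powr (- 2 / real n - 1) * (- 2 / real n) * (real n * v ^ (n - 1))) (at v)"
      unfolding E_def using p that by (auto intro!: derivative_eq_intros simp: powr_diff field_simps)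
    also have "(1 + v ^ n) powr (- 2 / real n - 1) * (- 2 / real n) * (real n * v ^ (n - 1))
       = - 2 * (v ^ (n - 1) * (1 + v ^ n) powr (- 2 / real n - 1))"
      using n by simp
    finally have E': "(E has_real_derivative - 2 * (v ^ (n - 1) * (1 + v ^ n) powr (- 2 / real n - 1))) (at v)" .
    have "h = (\<lambda>v. sqrt (1 - E v))" by (auto simp: h_def)
    then show ?thesis using E_less[OF that]
      by (auto intro!: derivative_eq_intros E' simp: field_simps)
  qed
  have h_cont: "isCont h v" if "v > 0" for v using h_deriv[OF that] DERIV_isCont by blast
  obtain T0 where T0: "(T0 has_real_derivative 1 / h v) (at v)" if "v > 0" for v
  proof -
    have "\<exists>F. \<forall>x :: real. 0 < ereal x \<longrightarrow> ereal x < \<infinity> \<longrightarrow> (F has_vector_derivative (1 / h x)) (at x)"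
      by (rule einterval_antiderivative) (use h_pos in \<open>auto intro!: continuous_intros h_cont simp: less_imp_neq[symmetric]\<close>)
    then show ?thesis using that unfolding has_real_derivative_iff_has_vector_derivative by auto
  qed
  have T0v: "((\<lambda>v. T0 v - v) has_real_derivative 1 / h v - 1) (at v)" if "v > 0" for v
    by (auto intro!: derivative_eq_intros T0 that)
  have mono0: "T0 v - v < T0 w - w" if "0 < v" "v < w" for v w
  proof (rule DERIV_pos_imp_increasing[OF that(2)])
    fix x assume "v \<le> x" then have "x > 0" using that by simp
    then show "\<exists>y. ((\<lambda>v. T0 v - v) has_real_derivative y) (at x) \<and> 0 < y"
      using T0v h_pos h_less by (intro exI[of _ "1 / h x - 1"]) (auto simp: field_simps)
  qed
  have bound0: "T0 v - v \<le> T0 2 - 2 + 1" if "v \<ge> 2" for v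
  proof -
    \<comment> \<open>For \<open>x \<ge> 2\<close> the derivative of \<open>T0 v - v\<close> is at
      most \<open>2 / x^2\<close>, which the added \<open>2 / v\<close> cancels.\<close>
    have "T0 v - v + 2 / v \<le> T0 2 - 2 + 2 / 2"
    proof (rule DERIV_nonpos_imp_nonincreasing[OF that])
      fix x :: real assume x: "2 \<le> x"
      have d: "((\<lambda>v. T0 v - v + 2 / v) has_real_derivative 1 / h x - 1 - 2 / x\<^sup>2) (at x)"
        using x by (auto intro!: derivative_eq_intros T0 simp: power2_eq_square)
      have hx: "1 - h x \<le> 1 / x\<^sup>2" using one_h x by simp
      moreover have "1 / x\<^sup>2 \<le> 1 / 2\<^sup>2" using x by (intro divide_left_mono power_mono) auto
      ultimately have h2: "h x \<ge> 1 / 2" by (simp add: power2_eq_square)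
      have "1 / h x - 1 = (1 - h x) / h x" using h2 by (simp add: field_simps)
      also have "\<dots> \<le> (1 / x\<^sup>2) / (1 / 2)" using hx h2 by (intro frac_le) auto
      finally show "\<exists>y. ((\<lambda>v. T0 v - v + 2 / v) has_real_derivative y) (at x) \<and> y \<le> 0"
        using d by (intro exI[of _ "1 / h x - 1 - 2 / x\<^sup>2"]) auto
    qed
    moreover have "2 / v > 0" using that by simp
    ultimately show ?thesis by linarith
  qed
  \<comment> \<open>\<open>T0 v - v\<close> increases and is bounded, so \<open>L\<close> is its
    limit at infinity; subtracting it gives \<open>T v - v\<close>, and with it
    \<open>f y - y\<close>, the limit 0.\<close>
  define L where "L = (SUP v\<in>{0<..}. T0 v - v)"
  have bdd: "bdd_above ((\<lambda>v. T0 v - v) ` {0<..})"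
  proof (intro bdd_aboveI2)
    fix v :: real assume "v \<in> {0<..}"
    then show "T0 v - v \<le> T0 2 - 2 + 1"
      using bound0[of v] mono0[of v 2] by (cases "v \<ge> 2") auto
  qed
  define T where "T v = T0 v - L" for v
  have T_deriv: "(T has_real_derivative 1 / h v) (at v)" if "v > 0" for v
    unfolding T_def by (auto intro!: derivative_eq_intros T0 that)
  have T_less: "T v < v" if "v > 0" for v
  proof -
    have "T0 v - v < T0 (v + 1) - (v + 1)" using mono0 that by simp
    also have "\<dots> \<le> L" unfolding L_def by (rule cSUP_upper[OF _ bdd]) (use that in auto)
    finally show ?thesis by (simp add: T_def)
  qed
  have T_strict: "T v < T w" if "0 < v" "v < w" for v w
    using mono0[OF that] that by (simp add: T_def)
  have T_iso: "isCont T v" if "v > 0" for v using T_deriv[OF that] DERIV_isCont by blast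
  have T_lim: "\<exists>v0>0. \<forall>v\<ge>v0. T v - v > - e" if "e > 0" for e
  proof -
    have "\<exists>v0\<in>{0<..}. L - e < T0 v0 - v0"
      using that less_cSUP_iff[of "{0<..}" "\<lambda>v. T0 v - v" "L - e"] bdd unfolding L_def by auto
    then obtain v0 where v0: "v0 > 0" "L - e < T0 v0 - v0" by auto
    have "T v - v > - e" if "v \<ge> v0" for v
      using mono0[of v0 v] v0 that by (cases "v = v0") (auto simp: T_def)
    then show ?thesis using v0 by blast
  qed
  have T_low: "T v \<le> T 1 + ln v" if "0 < v" "v \<le> 1" for v
  proof -
    have "T v - ln v \<le> T 1 - ln 1"
    proof (rule DERIV_nonneg_imp_nondecreasing[OF that(2)])
      fix x assume x: "v \<le> x" "x \<le> 1"
      then have x0: "x > 0" using that by simp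
      have "((\<lambda>v. T v - ln v) has_real_derivative 1 / h x - 1 / x) (at x)"
        using x0 by (auto intro!: derivative_eq_intros T_deriv simp: field_simps)
      moreover have "1 / x \<le> 1 / h x" using h_le[OF x0 x(2)] h_pos[OF x0] by (intro frac_le) auto
      ultimately show "\<exists>y. ((\<lambda>v. T v - ln v) has_real_derivative y) (at x) \<and> 0 \<le> y"
        by (intro exI[of _ "1 / h x - 1 / x"]) auto
    qed
    then show ?thesis by simp
  qed
  have T_surj: "\<exists>v>0. T v = y" for y
  proof -
    define a where "a = min 1 (exp (y - T 1))"
    have a: "a > 0" "a \<le> 1" "T a \<le> y"
    proof -
      show "a > 0" "a \<le> 1" by (auto simp: a_def)
      then have "T a \<le> T 1 + ln a" using T_low by auto
      also have "ln a \<le> ln (exp (y - T 1))" using \<open>a > 0\<close> by (subst ln_le_cancel_iff) (auto simp: a_def)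
      finally show "T a \<le> y" by simp
    qed
    obtain v0 where v0: "v0 > 0" "\<And>v. v \<ge> v0 \<Longrightarrow> T v - v > - 1" using T_lim[of 1] by auto
    define b where "b = max (max v0 1) (y + 1)"
    have "T b \<ge> y" using v0(2)[of b] unfolding b_def by linarith
    then have "\<exists>x\<ge>a. x \<le> b \<and> T x = y"
      using a by (intro IVT) (auto simp: b_def intro!: T_iso)
    then show ?thesis using a(1) less_le_trans by blast
  qed
  define f where "f y = (THE v. v > 0 \<and> T v = y)" for y
  have T_inj: "v = w" if "v > 0" "w > 0" "T v = T w" for v w
    using that T_strict[of v w] T_strict[of w v] by (cases v w rule: linorder_cases) auto
  have f_pos: "f y > 0" and Tf: "T (f y) = y" for y
  proof -
    have "\<exists>!v. v > 0 \<and> T v = y" using T_surj[of y] T_inj by metis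
    from theI'[OF this] show "f y > 0" "T (f y) = y" by (auto simp: f_def)
  qed
  have fT: "f (T v) = v" if "v > 0" for v using T_inj[OF f_pos that] Tf by simp
  have f_cont: "isCont f y" for y
  proof -
    have "isCont f (T (f y))"
      by (rule isCont_inverse_function2[of "f y / 2" "f y" "2 * f y"])
        (use f_pos[of y] in \<open>auto intro!: fT T_iso\<close>)
    then show ?thesis by (simp add: Tf)
  qed
  have f_deriv: "(f has_real_derivative h (f y)) (at y)" for y
  proof -
    have "(f has_real_derivative inverse (1 / h (f y))) (at y)"
      by (rule DERIV_inverse_function[of T _ _ _ "y - 1" "y + 1"])
        (use T_deriv f_pos Tf f_cont h_pos in \<open>auto simp: less_imp_neq[symmetric]\<close>)
    then show ?thesis by simp
  qed
  define f' where "f' y = h (f y)" for y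
  define f'' where "f'' y = f y ^ (n - 1) * (1 + f y ^ n) powr (- 2 / real n - 1)" for y
  have f'_deriv: "(f' has_real_derivative f'' y) (at y)" for y
  proof -
    have "((\<lambda>y. h (f y)) has_real_derivative
       (f y ^ (n - 1) * (1 + f y ^ n) powr (- 2 / real n - 1) / h (f y)) * h (f y)) (at y)"
      by (rule DERIV_chain2[OF h_deriv[OF f_pos] f_deriv])
    moreover have "f' = (\<lambda>y. h (f y))" by (auto simp: f'_def)
    ultimately show ?thesis using h_pos[OF f_pos[of y]] unfolding f''_def by (metis less_irrefl nonzero_eq_divide_eq)
  qed
  have f_gt_y: "f y > y" for y using T_less[OF f_pos[of y]] by (simp add: Tf)
  have f_strict: "f y < f z" if "y < z" for y z
    using T_strict[of "f z" "f y"] f_pos Tf that by (metis less_asym' linorder_neqE_linordered_idom)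
  have f_top: "((\<lambda>y. f y - y) \<longlongrightarrow> 0) at_top"
  proof (rule tendstoI)
    fix e :: real assume "e > 0"
    then obtain v0 where v0: "v0 > 0" "\<And>v. v \<ge> v0 \<Longrightarrow> T v - v > - e" using T_lim by blast
    have "dist (f y - y) 0 < e" if "y \<ge> v0" for y
      using v0(2)[of "f y"] f_gt_y[of y] that by (simp add: Tf)
    then show "\<forall>\<^sub>F y in at_top. dist (f y - y) 0 < e"
      unfolding eventually_at_top_linorder by blast
  qed
  have f_bot: "(f \<longlongrightarrow> 0) at_bot"
  proof (rule tendstoI)
    fix e :: real assume "e > 0"
    have "dist (f y) 0 < e" if "y \<le> T (e / 2)" for y
    proof -
      have "f y \<le> f (T (e / 2))" using f_strict[of y "T (e / 2)"] that by (cases "y = T (e/2)") auto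
      then show ?thesis using fT[of "e / 2"] \<open>e > 0\<close> f_pos[of y] by simp
    qed
    then show "\<forall>\<^sub>F y in at_bot. dist (f y) 0 < e"
      unfolding eventually_at_bot_linorder by blast
  qed
  have gamma_deriv: "((\<lambda>y. f y * f' y - y) has_real_derivative (f' y)\<^sup>2 + f y * f'' y - 1) (at y)" for y
  proof -
    have "(f has_real_derivative f' y) (at y)" using f_deriv by (simp add: f'_def)
    then show ?thesis by (auto intro!: derivative_eq_intros f'_deriv simp: power2_eq_square)
  qed
  \<comment> \<open>The first integral gives \<open>f'^2 = 1 - E\<close>, and
    \<open>f f'' = v^n E / (1 + v^n)\<close> is less than \<open>E\<close>. So
    \<open>f f' - y\<close> decreases strictly, and it is positive because its limit at infinity is
    0.\<close>
  have gamma_neg: "(f' y)\<^sup>2 + f y * f'' y - 1 < 0" for y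
  proof -
    define v where "v = f y"
    have v: "v > 0" using f_pos by (simp add: v_def)
    have p: "1 + v ^ n > 0" using v by (simp add: add_pos_pos)
    have "v * v ^ (n - 1) = v ^ n" using n by (cases n) auto
    then have "f y * f'' y = v ^ n * (E v / (1 + v ^ n))"
      using p by (simp add: f''_def E_def powr_diff flip: v_def)
    also have "\<dots> < E v" using E_pos[OF v] p by (simp add: field_simps)
    finally show ?thesis using h_sq[OF v] by (simp add: f'_def flip: v_def)
  qed
  have gamma_dec: "f z * f' z - z < f y * f' y - y" if "y < z" for y z
    by (rule DERIV_neg_imp_decreasing[OF that]) (use gamma_deriv gamma_neg in blast)
  have gamma_lim: "((\<lambda>y. f y * f' y - y) \<longlongrightarrow> 0) at_top"
  proof -
    have ev: "\<forall>\<^sub>F y in at_top. (0::real) < y" by (rule eventually_gt_at_top)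
    have inv: "((\<lambda>y. 1 / y) \<longlongrightarrow> (0::real)) at_top"
      using tendsto_inverse_0_at_top[OF filterlim_ident] by (simp add: inverse_eq_divide)
    have "((\<lambda>y. f y * (1 - f' y)) \<longlongrightarrow> 0) at_top"
    proof (rule tendsto_sandwich[OF _ _ tendsto_const inv])
      show "\<forall>\<^sub>F y in at_top. 0 \<le> f y * (1 - f' y)"
        using f_pos h_less[OF f_pos] by (intro always_eventually) (auto simp: f'_def less_imp_le)
      show "\<forall>\<^sub>F y in at_top. f y * (1 - f' y) \<le> 1 / y"
        using ev
      proof eventually_elim
        case (elim y)
        have "f y * (1 - f' y) \<le> f y * (1 / (f y)\<^sup>2)"
          unfolding f'_def using f_pos[of y] by (intro mult_left_mono one_h) (auto simp: less_imp_le)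
        also have "\<dots> = 1 / f y" using f_pos[of y] by (simp add: power2_eq_square)
        also have "\<dots> \<le> 1 / y" using f_gt_y[of y] elim by (intro frac_le) auto
        finally show ?case .
      qed
    qed
    \<comment> \<open>\<open>f f' - y\<close> is the difference of \<open>f - y\<close> and
      \<open>f (1 - f')\<close>.\<close>
    from tendsto_diff[OF f_top this] show ?thesis by (simp add: algebra_simps)
  qed
  have gamma_pos: "0 < f y * f' y - y" for y
  proof -
    have "f (y + 1) * f' (y + 1) - (y + 1) \<ge> 0"
    proof (rule tendsto_upperbound[OF gamma_lim])
      show "\<forall>\<^sub>F z in at_top. f z * f' z - z \<le> f (y + 1) * f' (y + 1) - (y + 1)"
        using eventually_gt_at_top[of "y + 1"] by eventually_elim (use gamma_dec less_imp_le in blast)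
    qed auto
    then show ?thesis using gamma_dec[of y "y + 1"] by simp
  qed
  have "semitrough_profile n 1 f f' f''"
  proof
    fix y
    show "0 < f y" "(f has_real_derivative f' y) (at y)" "(f' has_real_derivative f'' y) (at y)"
      using f_pos f_deriv f'_deriv by (auto simp: f'_def)
    have fc: "continuous_on UNIV f" using f_cont continuous_at_imp_continuous_on by blast
    have "1 + f y ^ n \<noteq> 0" for y using f_pos[of y] by (smt (verit) zero_less_power)
    then show "continuous_on UNIV f''" unfolding f''_def by (intro continuous_intros fc) auto
    show "\<bar>f' y\<bar> < 1" using h_pos[OF f_pos, of y] h_less[OF f_pos, of y] by (simp add: f'_def)
    have "1 + f y ^ n > 0" using f_pos[of y] by (simp add: add_pos_pos)
    moreover have "- 2 / real n * ((real n + 2) / 2) = - 2 / real n - 1" using n by (simp add: field_simps)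
    ultimately show "f'' y = 1 * f y ^ (n - 1) * (1 - (f' y)\<^sup>2) powr ((real n + 2) / 2)"
      using h_sq[OF f_pos] by (simp add: f'_def f''_def E_def powr_powr)
    show "max y 0 < f y" using f_gt_y f_pos by simp
    show "0 < f' y" using h_pos[OF f_pos] by (simp add: f'_def)
  qed (use f_top f_bot gamma_pos in auto)
  then show thesis using that by blast
qed

text \<open>Scaling space-time by \<open>1 / c\<close> multiplies the Gauss curvature by
  \<open>c ^ n\<close>, so the profile for curvature 1 serves every \<open>k\<close>. The derivative
  in the scale has the sign of \<open>z g' - g\<close> at \<open>z = c y\<close>; it is negative
  because the tangents of \<open>g\<close> meet the vertical axis above 0.\<close>

theorem semitrough_profiles:
  assumes n: "n \<ge> 2"
  obtains f f' f'' :: "real \<Rightarrow> real \<Rightarrow> real"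
  where "\<And>k. 0 < k \<Longrightarrow> semitrough_profile n k (f k) (f' k) (f'' k)"
    and "\<And>k1 k2 y. 0 < k2 \<Longrightarrow> k2 < k1 \<Longrightarrow> f k1 y < f k2 y"
proof -
  obtain g g' g'' where "semitrough_profile n 1 g g' g''" using semitrough_profile_1[OF n] .
  then interpret g: semitrough_profile n 1 g g' g'' .
  define c where "c k = k powr (1 / real n)" for k :: real
  have c_pos: "c k > 0" if "k > 0" for k using that by (simp add: c_def)
  have c_pow: "c k ^ n = k" if "k > 0" for k
    using that n by (simp add: c_def powr_powr flip: powr_realpow)
  show thesis
  proof (rule that[of "\<lambda>k y. g (c k * y) / c k" "\<lambda>k y. g' (c k * y)" "\<lambda>k y. c k * g'' (c k * y)"])
    fix k :: real assume k: "0 < k"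
    note c = c_pos[OF k]
    show "semitrough_profile n k (\<lambda>y. g (c k * y) / c k) (\<lambda>y. g' (c k * y)) (\<lambda>y. c k * g'' (c k * y))"
    proof
      fix y
      show "0 < k" by fact
      show "0 < g (c k * y) / c k" using c g.f_pos by simp
      show "((\<lambda>y. g (c k * y) / c k) has_real_derivative g' (c k * y)) (at y)"
        using c by (auto intro!: derivative_eq_intros DERIV_chain2[OF g.f_deriv])
      show "((\<lambda>y. g' (c k * y)) has_real_derivative c k * g'' (c k * y)) (at y)"
      proof -
        have "((\<lambda>y. c k * y) has_real_derivative c k) (at y)" by (rule DERIV_cmult_Id)
        from DERIV_chain2[OF g.f'_deriv this] show ?thesis by (simp add: mult.commute[of "c k"])
      qed
      show "continuous_on UNIV (\<lambda>y. c k * g'' (c k * y))"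
        by (intro continuous_intros continuous_on_compose2[OF g.f''_cont]) auto
      show "\<bar>g' (c k * y)\<bar> < 1" by (rule g.f'_bound)
      have "c k * g (c k * y) ^ (n - 1) = k * (g (c k * y) / c k) ^ (n - 1)"
      proof -
        have "k = c k * c k ^ (n - 1)" using c_pow[OF k] n by (cases n) auto
        then show ?thesis using c by (metis (no_types, lifting) less_numeral_extra(3) mult.assoc nonzero_mult_div_cancel_left power_divide power_not_zero times_divide_eq_right)
      qed
      then show "c k * g'' (c k * y) = k * (g (c k * y) / c k) ^ (n - 1) * (1 - (g' (c k * y))\<^sup>2) powr ((real n + 2) / 2)"
        by (simp add: g.ode flip: mult.assoc)
      show "0 < g' (c k * y)" by (rule g.f'_pos)
      show "max y 0 < g (c k * y) / c k"
        using g.f_gt[of "c k * y"] c by (auto simp: field_simps)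
      have lim: "filterlim (\<lambda>y. c k * y) at_top at_top"
        using c by (intro filterlim_tendsto_pos_mult_at_top[OF tendsto_const _ filterlim_ident])
      have limb: "filterlim (\<lambda>y. c k * y) at_bot at_bot"
        using c by (intro filterlim_tendsto_pos_mult_at_bot[OF tendsto_const _ filterlim_ident])
      have "((\<lambda>y. (g (c k * y) - c k * y) / c k) \<longlongrightarrow> 0 / c k) at_top"
        using c by (intro tendsto_divide tendsto_const filterlim_compose[OF g.f_top lim]) auto
      then show "((\<lambda>y. g (c k * y) / c k - y) \<longlongrightarrow> 0) at_top"
        using c by (simp add: diff_divide_distrib)
      have "((\<lambda>y. g (c k * y) / c k) \<longlongrightarrow> 0 / c k) at_bot"
        using c by (intro tendsto_divide tendsto_const filterlim_compose[OF g.f_bot limb]) auto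
      then show "((\<lambda>y. g (c k * y) / c k) \<longlongrightarrow> 0) at_bot" by simp
      have "0 < (g (c k * y) * g' (c k * y) - c k * y) / c k" using g.gamma_pos c by simp
      then show "0 < g (c k * y) / c k * g' (c k * y) - y" using c by (simp add: field_simps)
    qed
  next
    fix k1 k2 y :: real assume k: "0 < k2" "k2 < k1"
    have "c k2 < c k1" unfolding c_def using k n by (intro powr_less_mono2) auto
    then show "g (c k1 * y) / c k1 < g (c k2 * y) / c k2"
    proof (rule DERIV_neg_imp_decreasing)
      fix x assume "c k2 \<le> x" then have x: "x > 0" using c_pos[OF k(1)] by simp
      have "((\<lambda>x. g (x * y) / x) has_real_derivative (g' (x * y) * y * x - g (x * y)) / x\<^sup>2) (at x)"
        using x by (auto intro!: derivative_eq_intros DERIV_chain2[OF g.f_deriv] simp: field_simps power2_eq_square)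
      moreover have "g' (x * y) * (x * y) - g (x * y) < 0"
      proof (cases "y \<ge> 0")
        case True
        then have "g' (x * y) * (x * y) \<le> 1 * (x * y)"
          using g.f'_bound[of "x * y"] x by (intro mult_right_mono) auto
        then show ?thesis using g.f_gt[of "x * y"] by simp
      next
        case False
        then have "g' (x * y) * (x * y) < 0"
          using g.f'_pos[of "x * y"] x by (simp add: mult_pos_neg)
        then show ?thesis using g.f_pos[of "x * y"] by simp
      qed
      then have "(g' (x * y) * y * x - g (x * y)) / x\<^sup>2 < 0" using x by (simp add: field_simps)
      ultimately show "\<exists>d. ((\<lambda>x. g (x * y) / x) has_real_derivative d) (at x) \<and> d < 0" by blast
    qed
  qed
qed

section \<open>Linear algebra and implicit differentiation\<close>

definition outer :: "real ^ 'n \<Rightarrow> real ^ 'n \<Rightarrow> real ^ 'n ^ 'n" where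
  "outer v w = (\<chi> i j. v $ i * w $ j)"

lemma outer_mult: "outer v w *v h = (w \<bullet> h) *\<^sub>R v"
  by (simp add: outer_def vec_eq_iff matrix_vector_mult_def inner_vec_def sum_distrib_left
      mult.commute mult.left_commute)

text \<open>An orthogonal change of basis makes \<open>w\<close> a multiple of a coordinate vector.
  The update then alters a single column of the identity, and \<open>cramer_lemma\<close> evaluates
  the determinant.\<close>

lemma det_mat_plus_outer:
  fixes v w :: "real ^ 'n"
  shows "det (mat 1 + outer v w) = 1 + v \<bullet> w"
proof (cases "w = 0")
  case True
  then have "outer v w = 0" by (simp add: outer_def vec_eq_iff)
  with True show ?thesis by simp
next
  case False
  \<comment> \<open>This only names an arbitrary index \<open>k\<close>.\<close>
  obtain k :: 'n where True by simp
  have "norm (w /\<^sub>R norm w) = 1" using False by simp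
  then obtain Q where Q: "orthogonal_matrix Q" "Q *v axis k 1 = w /\<^sub>R norm w"
    using orthogonal_matrix_exists_basis by blast
  have w: "w = norm w *\<^sub>R (Q *v axis k 1)" using Q(2) False by simp
  define z where "z = norm w *\<^sub>R (transpose Q *v v)"
  have QQ: "transpose Q ** Q = mat 1" using Q(1) by (simp add: orthogonal_matrix_def)
  have tQ: "(transpose Q *v x) \<bullet> y = x \<bullet> (Q *v y)" for x y
    by (metis dot_lmul_matrix vector_transpose_matrix transpose_transpose)
  have "transpose Q *v (norm w *\<^sub>R (Q *v axis k 1)) = norm w *\<^sub>R axis k 1"
    by (simp add: matrix_vector_mult_scaleR matrix_vector_mul_assoc QQ)
  then have tQw: "transpose Q *v w = norm w *\<^sub>R axis k 1" using w by simp
  have "transpose Q ** (mat 1 + outer v w) ** Q = mat 1 + outer z (axis k 1)"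
  proof (subst matrix_eq, intro allI)
    fix x
    have "transpose Q ** (mat 1 + outer v w) ** Q *v x
       = transpose Q *v (Q *v x + (w \<bullet> (Q *v x)) *\<^sub>R v)"
      by (simp add: matrix_vector_mult_add_rdistrib outer_mult flip: matrix_vector_mul_assoc)
    also have "\<dots> = x + (w \<bullet> (Q *v x)) *\<^sub>R (transpose Q *v v)"
      by (simp add: matrix_vector_right_distrib matrix_vector_mul_assoc QQ matrix_vector_mult_scaleR)
    also have "w \<bullet> (Q *v x) = norm w * (axis k 1 \<bullet> x)"
      using tQ[of w x] tQw by simp
    finally show "transpose Q ** (mat 1 + outer v w) ** Q *v x = (mat 1 + outer z (axis k 1)) *v x"
      by (simp add: matrix_vector_mult_add_rdistrib outer_mult z_def mult.commute)
  qed
  moreover have "det (transpose Q ** (mat 1 + outer v w) ** Q) = det (mat 1 + outer v w)"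
    using det_orthogonal_matrix[OF Q(1)] by (auto simp: det_mul)
  moreover have "mat 1 + outer z (axis k 1) =
    (\<chi> i j. if j = k then (mat 1 *v (axis k 1 + z)) $ i else mat 1 $ i $ j)"
    unfolding matrix_vector_mul_lid by (simp add: vec_eq_iff outer_def axis_def mat_def)
  moreover have "det (\<chi> i j. if j = k then (mat 1 *v (axis k 1 + z)) $ i else mat 1 $ i $ j) = (axis k 1 + z) $ k * det (mat 1 :: real ^ 'n ^ 'n)"
    by (rule cramer_lemma)
  moreover have "z $ k = v \<bullet> w"
  proof -
    have "z $ k = z \<bullet> axis k 1" by (simp add: inner_axis)
    also have "\<dots> = v \<bullet> (norm w *\<^sub>R (Q *v axis k 1))"
      unfolding z_def inner_scaleR_left inner_scaleR_right tQ ..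
    also have "\<dots> = v \<bullet> w" using w by simp
    finally show ?thesis .
  qed
  ultimately show ?thesis by (simp add: axis_def)
qed

text \<open>Sherman-Morrison: \<open>w'\<close> is \<open>w\<close> multiplied by the inverse of
  \<open>I - p p^T\<close>. For a graph with gradient \<open>p\<close> that matrix is the induced
  metric, so \<open>w \<bullet> w'\<close> is the squared length of the covector
  \<open>w\<close>.\<close>

lemma mat_minus_outer_dual:
  fixes p w :: "real ^ 'n"
  assumes "p \<bullet> p < 1"
  defines "w' \<equiv> w + (p \<bullet> w / (1 - p \<bullet> p)) *\<^sub>R p"
  shows "w' - (p \<bullet> w') *\<^sub>R p = w"
    and "w \<bullet> w' = w \<bullet> w + (p \<bullet> w)\<^sup>2 / (1 - p \<bullet> p)"
proof -
  define c where "c = p \<bullet> w / (1 - p \<bullet> p)"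
  have "c * (1 - p \<bullet> p) = p \<bullet> w" using assms(1) by (simp add: c_def)
  then have "c = p \<bullet> w + c * (p \<bullet> p)" by (simp add: algebra_simps)
  then have "p \<bullet> w' = c" by (simp add: w'_def inner_add_right flip: c_def)
  then show "w' - (p \<bullet> w') *\<^sub>R p = w" by (simp add: w'_def flip: c_def)
  show "w \<bullet> w' = w \<bullet> w + (p \<bullet> w)\<^sup>2 / (1 - p \<bullet> p)"
    by (simp add: w'_def inner_add_right inner_commute power2_eq_square)
qed

text \<open>With the dual vector \<open>w'\<close> the matrix factors into two rank-one updates of
  the identity.\<close>

lemma det_rank_two_update:
  fixes p w :: "real ^ 'n"
  assumes "p \<bullet> p < 1"
  shows "det (mat 1 - outer p p + c *\<^sub>R outer w w)
    = (1 - p \<bullet> p) * (1 + c * (w \<bullet> w + (p \<bullet> w)\<^sup>2 / (1 - p \<bullet> p)))"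
proof -
  define w' where "w' = w + (p \<bullet> w / (1 - p \<bullet> p)) *\<^sub>R p"
  note w' = mat_minus_outer_dual[OF assms, of w, folded w'_def]
  have "mat 1 - outer p p + c *\<^sub>R outer w w = (mat 1 + outer (- p) p) ** (mat 1 + outer (c *\<^sub>R w') w)"
  proof (subst matrix_eq, intro allI)
    fix x
    have "(mat 1 + outer (- p) p) ** (mat 1 + outer (c *\<^sub>R w') w) *v x
      = x - (p \<bullet> x) *\<^sub>R p + (c * (w \<bullet> x)) *\<^sub>R (w' - (p \<bullet> w') *\<^sub>R p)"
      by (simp add: matrix_vector_mult_add_rdistrib outer_mult inner_add_right algebra_simps
          flip: matrix_vector_mul_assoc)
    also have "\<dots> = (mat 1 - outer p p + c *\<^sub>R outer w w) *v x"
      by (simp add: w'(1) matrix_vector_mult_add_rdistrib matrix_vector_mult_diff_rdistrib outer_mult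
          scaleR_matrix_vector_assoc[symmetric])
    finally show "(mat 1 - outer p p + c *\<^sub>R outer w w) *v x
      = (mat 1 + outer (- p) p) ** (mat 1 + outer (c *\<^sub>R w') w) *v x" by simp
  qed
  then show ?thesis
    using w'(2) by (simp add: det_mul det_mat_plus_outer inner_commute)
qed

text \<open>The form \<open>q\<close> of the matrix \<open>I - p p^T\<close> is positive definite,
  and Cauchy-Schwarz for \<open>q\<close> bounds \<open>(w \<bullet> h)^2\<close> by the dual norm
  of \<open>w\<close> times \<open>q h h\<close>. So a negative \<open>c\<close> does no harm as
  long as the determinant factor stays positive.\<close>

lemma rank_two_update_pos:
  fixes p w h :: "real ^ 'n"
  assumes p: "p \<bullet> p < 1" and h: "h \<noteq> 0"
    and c: "0 < 1 + c * (w \<bullet> w + (p \<bullet> w)\<^sup>2 / (1 - p \<bullet> p))"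
  shows "0 < h \<bullet> h - (p \<bullet> h)\<^sup>2 + c * (w \<bullet> h)\<^sup>2"
proof -
  define w' where "w' = w + (p \<bullet> w / (1 - p \<bullet> p)) *\<^sub>R p"
  note w' = mat_minus_outer_dual[OF p, of w, folded w'_def]
  define q where "q x y = x \<bullet> y - (p \<bullet> x) * (p \<bullet> y)" for x y
  have q_pos: "q x x > 0" if "x \<noteq> 0" for x
  proof -
    have "(p \<bullet> x) * (p \<bullet> x) \<le> (p \<bullet> p) * (x \<bullet> x)"
      using Cauchy_Schwarz_ineq[of p x] by (simp add: power2_eq_square)
    also have "\<dots> < 1 * (x \<bullet> x)" using p that by (intro mult_strict_right_mono) auto
    finally show ?thesis by (simp add: q_def)
  qed
  have qw: "q w' x = w \<bullet> x" for x
    using w'(1) unfolding q_def by (metis inner_diff_left inner_scaleR_left)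
  define W where "W = w \<bullet> w + (p \<bullet> w)\<^sup>2 / (1 - p \<bullet> p)"
  have W: "q w' w' = W" using qw[of w'] w'(2) by (simp add: W_def)
  have W_nonneg: "W \<ge> 0" using p by (simp add: W_def)
  have qh: "q h h > 0" using q_pos h by simp
  have CS: "(w \<bullet> h)\<^sup>2 \<le> W * q h h"
  proof (cases "W = 0")
    case True
    then have "w' = 0" using q_pos[of w'] W by auto
    then have "w = 0" using w'(1) by simp
    then show ?thesis using True by simp
  next
    case False
    \<comment> \<open>Coefficient of the \<open>q\<close>-orthogonal projection of \<open>h\<close>
      onto \<open>w'\<close>.\<close>
    define s where "s = (w \<bullet> h) / W"
    define x where "x = h - s *\<^sub>R w'"
    have "0 \<le> q x x" by (cases "x = 0") (auto simp: q_def[of 0] q_pos less_imp_le)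
    also have "q x x = q h h - 2 * s * q w' h + s\<^sup>2 * q w' w'"
      by (simp add: q_def x_def algebra_simps power2_eq_square inner_commute)
    also have "\<dots> = q h h - (w \<bullet> h)\<^sup>2 / W"
      using False by (simp add: qw[of h] W s_def power2_eq_square)
    finally show ?thesis using False W_nonneg by (simp add: field_simps)
  qed
  have "0 < q h h + c * (w \<bullet> h)\<^sup>2"
  proof (cases "c \<ge> 0")
    case False
    have "0 < (1 + c * W) * q h h" using c qh by (simp add: W_def)
    also have "\<dots> = q h h + c * (W * q h h)" by (simp add: algebra_simps)
    also have "\<dots> \<le> q h h + c * (w \<bullet> h)\<^sup>2"
      using CS False by (intro add_left_mono mult_left_mono_neg) auto
    finally show ?thesis .
  qed (use qh in \<open>auto intro: add_pos_nonneg\<close>)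
  then show ?thesis by (simp add: q_def power2_eq_square)
qed

text \<open>Since \<open>u\<close> is already known to be continuous and to solve the equation
  everywhere, differentiability of \<open>F\<close> at the single point suffices; no implicit
  function theorem is involved.\<close>

lemma has_derivative_implicit:
  fixes u :: "'a::real_normed_vector \<Rightarrow> real"
  assumes cont: "isCont u x" and zero: "\<And>y. F (y, u y) = (0::real)"
    and A: "bounded_linear A" and N: "N \<noteq> 0"
    and der: "(F has_derivative (\<lambda>z. A (fst z) + N * snd z)) (at (x, u x))"
  shows "(u has_derivative (\<lambda>h. - A h / N)) (at x)"
  unfolding has_derivative_at_alt
proof (intro conjI allI impI)
  show "bounded_linear (\<lambda>h. - A h / N)"
    using bounded_linear_compose[OF bounded_linear_mult_right[of "- 1 / N"] A] by simp
  have aux: "X \<le> P + 2 * R" if "X \<le> (P + X) / 2 + R" for X P R :: real using that by argo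
  fix e :: real assume e: "e > 0"
  obtain K where K: "K > 0" "\<And>h. \<bar>A h\<bar> \<le> norm h * K"
    using bounded_linear.pos_bounded[OF A] by auto
  \<comment> \<open>The first bound lets \<open>\<bar>N\<bar> * \<bar>D\<bar> / 2\<close> be
    absorbed on the left, giving a linear bound on the increment \<open>D\<close>; the second turns
    the remaining error into \<open>e * norm h\<close>.\<close>
  define e1 where "e1 = min (\<bar>N\<bar> / 2) (e * \<bar>N\<bar> / (2 + 2 * K / \<bar>N\<bar>))"
  have Kp: "2 + 2 * K / \<bar>N\<bar> > 0" using K N by (simp add: add_pos_pos)
  have e1: "e1 > 0" "e1 \<le> \<bar>N\<bar> / 2" "e1 * (2 + 2 * K / \<bar>N\<bar>) \<le> e * \<bar>N\<bar>"
  proof -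
    show "e1 > 0" using N e Kp by (auto simp: e1_def)
    show "e1 \<le> \<bar>N\<bar> / 2" unfolding e1_def by (rule min.cobounded1)
    have "e1 \<le> e * \<bar>N\<bar> / (2 + 2 * K / \<bar>N\<bar>)" by (simp add: e1_def)
    then show "e1 * (2 + 2 * K / \<bar>N\<bar>) \<le> e * \<bar>N\<bar>" using Kp pos_le_divide_eq by blast
  qed
  obtain d where d: "d > 0" "\<And>z. norm (z - (x, u x)) < d \<Longrightarrow>
      norm (F z - F (x, u x) - (A (fst (z - (x, u x))) + N * snd (z - (x, u x)))) \<le> e1 * norm (z - (x, u x))"
    using der e1(1) unfolding has_derivative_at_alt by metis
  have "d / 2 > 0" using d by simp
  then obtain d' where d': "d' > 0" "\<And>y. norm (y - x) < d' \<Longrightarrow> \<bar>u y - u x\<bar> < d / 2"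
    using cont unfolding continuous_at_eps_delta dist_norm real_norm_def by metis
  show "\<exists>d>0. \<forall>y. norm (y - x) < d \<longrightarrow> norm (u y - u x - - A (y - x) / N) \<le> e * norm (y - x)"
  proof (intro exI[of _ "min d' (d / 2)"] conjI allI impI)
    fix y assume y: "norm (y - x) < min d' (d / 2)"
    define h where "h = y - x"
    define D where "D = u y - u x"
    have nle: "norm (h, D) \<le> norm h + \<bar>D\<bar>" using norm_Pair_le[of h D] by simp
    also have "\<dots> < d" using y d'(2)[of y] by (auto simp: h_def D_def)
    finally have "norm ((y, u y) - (x, u x)) < d" by (simp add: h_def D_def)
    from d(2)[OF this] have "\<bar>A h + N * D\<bar> \<le> e1 * norm (h, D)"
      by (simp add: zero h_def D_def)
    also have "\<dots> \<le> e1 * (norm h + \<bar>D\<bar>)" using nle e1 by (intro mult_left_mono) auto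
    finally have 1: "\<bar>A h + N * D\<bar> \<le> e1 * (norm h + \<bar>D\<bar>)" .
    have "\<bar>N\<bar> * \<bar>D\<bar> \<le> \<bar>A h + N * D\<bar> + \<bar>A h\<bar>" by (simp flip: abs_mult)
    also have "\<dots> \<le> e1 * (norm h + \<bar>D\<bar>) + norm h * K" using 1 K(2)[of h] by simp
    also have "\<dots> \<le> \<bar>N\<bar> / 2 * (norm h + \<bar>D\<bar>) + norm h * K"
      using e1(2) by (intro add_right_mono mult_right_mono) auto
    also have "\<dots> = (\<bar>N\<bar> * norm h + \<bar>N\<bar> * \<bar>D\<bar>) / 2 + norm h * K" by (simp add: algebra_simps)
    finally have "\<bar>N\<bar> * \<bar>D\<bar> \<le> \<bar>N\<bar> * norm h + 2 * (norm h * K)"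
      by (rule aux)
    then have "\<bar>N\<bar> * \<bar>D\<bar> \<le> norm h * (\<bar>N\<bar> + 2 * K)" by (simp add: algebra_simps)
    then have D: "\<bar>D\<bar> \<le> norm h * (1 + 2 * K / \<bar>N\<bar>)" using N by (simp add: field_simps)
    have "\<bar>A h + N * D\<bar> \<le> e1 * (norm h + norm h * (1 + 2 * K / \<bar>N\<bar>))"
      using 1 D e1(1) by (smt (verit) mult_left_mono)
    also have "\<dots> = (e1 * (2 + 2 * K / \<bar>N\<bar>)) * norm h" by (simp add: algebra_simps)
    also have "\<dots> \<le> e * \<bar>N\<bar> * norm h" using e1(3) by (intro mult_right_mono) auto
    finally have "\<bar>A h + N * D\<bar> / \<bar>N\<bar> \<le> e * norm h" using N by (simp add: field_simps)
    also have "\<bar>A h + N * D\<bar> / \<bar>N\<bar> = \<bar>D - - A h / N\<bar>"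
      using N by (simp add: field_simps flip: abs_divide)
    finally show "norm (u y - u x - - A (y - x) / N) \<le> e * norm (y - x)"
      by (simp add: h_def D_def)
  qed (use d d' in auto)
qed

section \<open>Boosted semitroughs\<close>

text \<open>\<open>sqrt (1 + S^2)\<close> and \<open>S\<close> are the hyperbolic cosine and sine of
  a Lorentz boost in the plane of \<open>a\<close> and the time axis; \<open>axial\<close> and
  \<open>height\<close> are the boosted space and time coordinates.\<close>

definition axial :: "real \<Rightarrow> real ^ 'n \<Rightarrow> real ^ 'n \<Rightarrow> real \<Rightarrow> real" where
  "axial S a x t = sqrt (1 + S\<^sup>2) * (a \<bullet> x) + S * t"

definition height :: "real \<Rightarrow> real ^ 'n \<Rightarrow> real ^ 'n \<Rightarrow> real \<Rightarrow> real" where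
  "height S a x t = sqrt (1 + S\<^sup>2) * t + S * (a \<bullet> x)"

text \<open>The norm of the pair is \<open>sqrt (f^2 + rho^2)\<close>; in this form the triangle
  inequality yields Lipschitz and convexity estimates at once.\<close>

definition defect :: "(real \<Rightarrow> real) \<Rightarrow> real \<Rightarrow> real ^ 'n \<Rightarrow> real ^ 'n \<Rightarrow> real \<Rightarrow> real" where
  "defect f S a x t = height S a x t - norm (f (axial S a x t), x - (a \<bullet> x) *\<^sub>R a)"

text \<open>In the boosted frame \<open>(axial, height)\<close> with axis \<open>a\<close> the hypersurface is
  \<open>height = sqrt (f(axial)\<^sup>2 + \<rho>\<^sup>2)\<close>, where \<open>\<rho>\<close> is the distance from the axis.\<close>

definition trough :: "(real \<Rightarrow> real) \<Rightarrow> real \<Rightarrow> real ^ 'n \<Rightarrow> real ^ 'n \<Rightarrow> real" where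
  "trough f S a x = (THE t. defect f S a x t = 0)"

lemma abs_less_sqrt_1: "\<bar>S\<bar> < sqrt (1 + S\<^sup>2)" for S :: real
  by (rule real_less_rsqrt) simp

lemma sqrt_1_sq: "sqrt (1 + S\<^sup>2) * sqrt (1 + S\<^sup>2) = 1 + S * S" for S :: real
  by (simp add: power2_eq_square)

lemma sqrt_1_minus_mult_plus: "(sqrt (1 + S\<^sup>2) - \<bar>S\<bar>) * (sqrt (1 + S\<^sup>2) + \<bar>S\<bar>) = 1" for S :: real
  using sqrt_1_sq[of S] by (simp add: algebra_simps)

lemma time_from_boost: "t = sqrt (1 + S\<^sup>2) * height S a x t - S * axial S a x t"
proof -
  have "sqrt (1 + S\<^sup>2) * height S a x t - S * axial S a x t
    = (sqrt (1 + S\<^sup>2) * sqrt (1 + S\<^sup>2) - S * S) * t"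
    unfolding height_def axial_def by (simp add: algebra_simps)
  then show ?thesis by (simp only: sqrt_1_sq) simp
qed

lemma space_from_boost: "a \<bullet> x = sqrt (1 + S\<^sup>2) * axial S a x t - S * height S a x t"
proof -
  have "sqrt (1 + S\<^sup>2) * axial S a x t - S * height S a x t
    = (sqrt (1 + S\<^sup>2) * sqrt (1 + S\<^sup>2) - S * S) * (a \<bullet> x)"
    unfolding height_def axial_def by (simp add: algebra_simps)
  then show ?thesis by (simp only: sqrt_1_sq) simp
qed

lemma norm_perp_sq:
  fixes a x :: "real ^ 'n"
  assumes "norm a = 1"
  shows "(norm (x - (a \<bullet> x) *\<^sub>R a))\<^sup>2 = x \<bullet> x - (a \<bullet> x)\<^sup>2"
proof -
  have "a \<bullet> a = 1" using assms by (simp add: dot_square_norm)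
  then show ?thesis
    unfolding power2_norm_eq_inner
    by (simp add: inner_diff_left inner_diff_right inner_commute power2_eq_square)
qed

lemma minkowski_norm_boost: "(height S a x t)\<^sup>2 - (axial S a x t)\<^sup>2 = t\<^sup>2 - (a \<bullet> x)\<^sup>2"
proof -
  have "(height S a x t)\<^sup>2 - (axial S a x t)\<^sup>2
    = (sqrt (1 + S\<^sup>2) * sqrt (1 + S\<^sup>2) - S * S) * (t\<^sup>2 - (a \<bullet> x)\<^sup>2)"
    unfolding height_def axial_def by (simp add: algebra_simps power2_eq_square)
  then show ?thesis by (simp only: sqrt_1_sq) simp
qed

lemma frechet_derivative_imp_gradient:
  assumes "(u has_derivative (\<lambda>h. p \<bullet> h)) (at x)"
  shows "gradient u x = p"
  using frechet_derivative_at[OF assms] by (simp add: gradient_def vec_eq_iff inner_axis flip: fun_eq_iff)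
    (metis inner_axis mult.right_neutral inner_real_def)

section \<open>Existence, uniqueness and continuity of the boosted graphs\<close>

context curvature_profile
begin

text \<open>In \<open>t\<close> the height has slope \<open>sqrt (1 + S^2)\<close>, while the
  subtracted norm has slope at most \<open>\<bar>S\<bar>\<close>, because \<open>f\<close> is
  1-Lipschitz. Existence and uniqueness of the graph and all its continuity rest on this
  margin.\<close>

lemma defect_increasing:
  assumes "t \<le> t'"
  shows "(sqrt (1 + S\<^sup>2) - \<bar>S\<bar>) * (t' - t) \<le> defect f S a x t' - defect f S a x t"
proof -
  let ?v = "x - (a \<bullet> x) *\<^sub>R a"
  have "norm (f (axial S a x t'), ?v) - norm (f (axial S a x t), ?v)
     \<le> norm ((f (axial S a x t'), ?v) - (f (axial S a x t), ?v))"
    by (rule norm_triangle_ineq2)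
  also have "\<dots> = \<bar>f (axial S a x t') - f (axial S a x t)\<bar>" by simp
  also have "\<dots> \<le> \<bar>axial S a x t' - axial S a x t\<bar>" by (rule f_lipschitz)
  also have "\<dots> = \<bar>S\<bar> * (t' - t)"
    using assms by (simp add: axial_def flip: right_diff_distrib) (simp add: abs_mult)
  finally show ?thesis by (simp add: defect_def height_def algebra_simps)
qed

lemma defect_strict_mono: "t < t' \<Longrightarrow> defect f S a x t < defect f S a x t'"
proof -
  assume "t < t'"
  then have "0 < (sqrt (1 + S\<^sup>2) - \<bar>S\<bar>) * (t' - t)" using abs_less_sqrt_1[of S] by simp
  also have "\<dots> \<le> defect f S a x t' - defect f S a x t" by (rule defect_increasing) (use \<open>t < t'\<close> in simp)
  finally show ?thesis by simp
qed

lemma defect_cont: "continuous_on A (\<lambda>(S, a, x, t). defect f S a x t)"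
  unfolding defect_def height_def axial_def case_prod_beta
  by (intro continuous_intros continuous_on_compose2[OF f_cont[of UNIV]]) auto

lemma defect_ex1: "\<exists>!t. defect f S a x t = 0"
proof -
  define c where "c = sqrt (1 + S\<^sup>2) - \<bar>S\<bar>"
  have c: "c > 0" using abs_less_sqrt_1 by (simp add: c_def)
  define d where "d = defect f S a x 0"
  have low: "defect f S a x (- (\<bar>d\<bar> / c)) \<le> 0"
    using defect_increasing[of "- (\<bar>d\<bar> / c)" 0 S a x] c by (simp add: d_def[symmetric] c_def[symmetric])
  have high: "0 \<le> defect f S a x (\<bar>d\<bar> / c)"
    using defect_increasing[of 0 "\<bar>d\<bar> / c" S a x] c by (simp add: d_def[symmetric] c_def[symmetric])
  have "continuous_on UNIV (\<lambda>t. (S, a, x, t))" by (intro continuous_intros)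
  from continuous_on_compose2[OF defect_cont[of UNIV] this]
  have "continuous_on UNIV (\<lambda>t. defect f S a x t)" by simp
  then have "isCont (\<lambda>t. defect f S a x t) t" for t
    by (simp add: continuous_on_eq_continuous_at)
  then have "\<exists>t\<ge>- (\<bar>d\<bar> / c). t \<le> \<bar>d\<bar> / c \<and> defect f S a x t = 0"
    using low high c by (intro IVT) auto
  then obtain t where "defect f S a x t = 0" by blast
  moreover have "t = t'" if "defect f S a x t = 0" "defect f S a x t' = 0" for t t'
    using that defect_strict_mono[of t t' S a x] defect_strict_mono[of t' t S a x]
    by (cases t t' rule: linorder_cases) auto
  ultimately show ?thesis by blast
qed

lemma defect_trough [simp]: "defect f S a x (trough f S a x) = 0"
  unfolding trough_def by (rule theI'[OF defect_ex1])

lemma trough_le_iff: "trough f S a x \<le> t \<longleftrightarrow> 0 \<le> defect f S a x t"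
  using defect_strict_mono[of t "trough f S a x" S a x] defect_strict_mono[of "trough f S a x" t S a x]
  by (cases t "trough f S a x" rule: linorder_cases) auto

text \<open>The factor is the reciprocal of the slope \<open>sqrt (1 + S^2) - \<bar>S\<bar>\<close>.
  The bound converts continuity of \<open>defect\<close> into joint continuity of the graph in
  \<open>S\<close>, \<open>a\<close> and \<open>x\<close>.\<close>

lemma abs_trough_diff_le: "\<bar>trough f S a x - t\<bar> \<le> (sqrt (1 + S\<^sup>2) + \<bar>S\<bar>) * \<bar>defect f S a x t\<bar>"
proof -
  have le: "t' - t \<le> (sqrt (1 + S\<^sup>2) + \<bar>S\<bar>) * (defect f S a x t' - defect f S a x t)" if "t \<le> t'" for t t'
  proof -
    have "t' - t = (sqrt (1 + S\<^sup>2) + \<bar>S\<bar>) * ((sqrt (1 + S\<^sup>2) - \<bar>S\<bar>) * (t' - t))"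
      using sqrt_1_minus_mult_plus[of S] by (metis mult.assoc mult.commute mult.right_neutral)
    also have "\<dots> \<le> (sqrt (1 + S\<^sup>2) + \<bar>S\<bar>) * (defect f S a x t' - defect f S a x t)"
      using that by (intro mult_left_mono defect_increasing) auto
    finally show ?thesis .
  qed
  show ?thesis
    using le[of t "trough f S a x"] le[of "trough f S a x" t] trough_le_iff[of S a x t]
    by (cases "trough f S a x \<le> t") auto
qed

lemma trough_cont: "continuous_on UNIV (\<lambda>(S, a, x). trough f S a x)"
proof -
  let ?u = "\<lambda>z. trough f (fst z) (fst (snd z)) (snd (snd z))"
  have "isCont ?u z0" for z0 :: "real \<times> (real ^ 'n) \<times> (real ^ 'n)"
  proof -
    define t0 where "t0 = ?u z0"
    define D where "D z = (sqrt (1 + (fst z)\<^sup>2) + \<bar>fst z\<bar>) *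
      \<bar>defect f (fst z) (fst (snd z)) (snd (snd z)) t0\<bar>" for z :: "real \<times> (real ^ 'n) \<times> (real ^ 'n)"
    have "continuous_on UNIV D"
    proof -
      have "continuous_on UNIV (\<lambda>z :: real \<times> (real ^ 'n) \<times> (real ^ 'n). (fst z, fst (snd z), snd (snd z), t0))"
        by (intro continuous_intros)
      from continuous_on_compose2[OF defect_cont[of UNIV] this] show ?thesis
        unfolding D_def by (auto intro!: continuous_intros)
    qed
    then have "isCont D z0" by (metis UNIV_I continuous_on_eq_continuous_at open_UNIV)
    moreover have "D z0 = 0" by (simp add: D_def t0_def)
    ultimately have D: "(D \<longlongrightarrow> 0) (at z0)" by (simp add: isCont_def)
    have "((\<lambda>z. ?u z - t0) \<longlongrightarrow> 0) (at z0)"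
      by (rule Lim_null_comparison[OF _ D]) (auto simp: D_def abs_trough_diff_le)
    then show ?thesis by (simp add: isCont_def t0_def LIM_zero_iff)
  qed
  then have "continuous_on UNIV ?u" by (intro continuous_at_imp_continuous_on ballI)
  then show ?thesis by (simp only: split_beta')
qed

lemma trough_cont_x: "isCont (trough f S a) x"
proof -
  have "continuous_on UNIV (\<lambda>x. (S, a, x))" by (intro continuous_intros)
  from continuous_on_compose2[OF trough_cont this] show ?thesis
    by (simp add: continuous_on_eq_continuous_at)
qed

end

section \<open>Gradient, Hessian and Gauss curvature of the boosted graphs\<close>

locale boosted_trough = curvature_profile +
  fixes S :: real and a :: "real ^ 'n"
  assumes a: "norm a = 1"
begin

text \<open>Boost invariance turns the equation of the graph into \<open>t\<^sup>2 - x \<bullet> x = (f l)\<^sup>2 - l\<^sup>2\<close>. Implicit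
  differentiation gives the gradient \<open>p\<close> and \<open>N D\<^sup>2u = I - p p\<^sup>T + \<gamma>' w w\<^sup>T\<close> with \<open>\<gamma> = f f' - l\<close> and
  \<open>w = D l\<close>.\<close>

abbreviation u where "u \<equiv> trough f S a"
definition l where "l x = axial S a x (u x)"
definition gam where "gam y = f y * f' y - y"
definition gam' where "gam' y = (f' y)\<^sup>2 + f y * f'' y - 1"
definition N where "N x = u x - S * gam (l x)"
definition p where "p x = (1 / N x) *\<^sub>R (x + (sqrt (1 + S\<^sup>2) * gam (l x)) *\<^sub>R a)"
definition w where "w x = sqrt (1 + S\<^sup>2) *\<^sub>R a + S *\<^sub>R p x"

lemma height_trough: "height S a x (u x) = sqrt ((f (l x))\<^sup>2 + (x \<bullet> x - (a \<bullet> x)\<^sup>2))"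
  using defect_trough[of S a x] unfolding defect_def
  by (simp add: norm_Pair l_def norm_perp_sq[OF a])

lemma trough_quadric: "(u x)\<^sup>2 - x \<bullet> x = (f (l x))\<^sup>2 - (l x)\<^sup>2"
proof -
  have "x \<bullet> x - (a \<bullet> x)\<^sup>2 \<ge> 0" using norm_perp_sq[OF a, of x] by (metis zero_le_power2)
  then have "(height S a x (u x))\<^sup>2 = (f (l x))\<^sup>2 + (x \<bullet> x - (a \<bullet> x)\<^sup>2)"
    unfolding height_trough by simp
  then show ?thesis using minkowski_norm_boost[of S a x "u x"] by (simp add: l_def)
qed

lemma height_ge: "f (l x) \<le> height S a x (u x)"
proof -
  have "x \<bullet> x - (a \<bullet> x)\<^sup>2 \<ge> 0" using norm_perp_sq[OF a, of x] by (metis zero_le_power2)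
  then show ?thesis unfolding height_trough using f_pos[of "l x"] by (intro real_le_rsqrt) auto
qed

text \<open>\<open>2 N\<close> is the \<open>t\<close>-derivative of the quadric relation, so its
  sign permits implicit differentiation. In the boosted frame \<open>N\<close> is
  \<open>sqrt (1 + S^2) * height - S f f'\<close>, and \<open>height \<ge> f > 0\<close>,
  \<open>\<bar>f'\<bar> < 1\<close>.\<close>

lemma N_pos: "0 < N x"
proof -
  have "N x = sqrt (1 + S\<^sup>2) * height S a x (u x) - S * (f (l x) * f' (l x))"
    using time_from_boost[of "u x" S a x] by (simp add: N_def gam_def l_def algebra_simps)
  moreover have "S * (f (l x) * f' (l x)) < sqrt (1 + S\<^sup>2) * f (l x)"
  proof -
    have "S * (f (l x) * f' (l x)) \<le> \<bar>S\<bar> * \<bar>f' (l x)\<bar> * f (l x)"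
      using abs_ge_self[of "S * (f (l x) * f' (l x))"] f_pos[of "l x"] by (simp add: abs_mult mult_ac)
    also have "\<bar>S\<bar> * \<bar>f' (l x)\<bar> \<le> \<bar>S\<bar> * 1"
      using f'_bound[of "l x"] by (intro mult_left_mono) auto
    also have "\<bar>S\<bar> * 1 * f (l x) < sqrt (1 + S\<^sup>2) * f (l x)"
      using abs_less_sqrt_1[of S] f_pos[of "l x"] by simp
    finally show ?thesis using f_pos[of "l x"] by simp
  qed
  moreover have "sqrt (1 + S\<^sup>2) * f (l x) \<le> sqrt (1 + S\<^sup>2) * height S a x (u x)"
    using height_ge[of x] by (intro mult_left_mono) auto
  ultimately show ?thesis by linarith
qed

lemma trough_has_derivative: "(u has_derivative (\<lambda>h. p x \<bullet> h)) (at x)"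
proof -
  define C where "C = sqrt (1 + S\<^sup>2)"
  define L where "L z = C * (a \<bullet> fst z) + S * snd z" for z :: "(real ^ 'n) \<times> real"
  have L: "L (y, u y) = l y" for y by (simp add: L_def l_def axial_def C_def)
  define F where "F z = (snd z)\<^sup>2 - fst z \<bullet> fst z - ((f (L z))\<^sup>2 - (L z)\<^sup>2)" for z
  define A where "A h = - 2 * ((x + (C * gam (l x)) *\<^sub>R a) \<bullet> h)" for h
  have L': "(L has_derivative L) (at z)" for z
    unfolding L_def by (auto intro!: derivative_eq_intros)
  have fL: "((\<lambda>z. f (L z)) has_derivative (\<lambda>h. L h * f' (L z))) (at z)" for z
    using DERIV_compose_FDERIV[OF f_deriv L'] .
  have "(F has_derivative (\<lambda>h. 2 * snd z * snd h - 2 * (fst z \<bullet> fst h)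
      - 2 * (f (L z) * f' (L z) - L z) * L h)) (at z)" for z
    unfolding F_def
    by (auto intro!: derivative_eq_intros fL L' simp: inner_commute algebra_simps fun_eq_iff)
  from this[of "(x, u x)"]
  have "(F has_derivative (\<lambda>h. A (fst h) + 2 * N x * snd h)) (at (x, u x))"
  proof (rule has_derivative_eq_rhs, intro ext)
    fix h :: "(real ^ 'n) \<times> real"
    have "L h = C * (a \<bullet> fst h) + S * snd h" by (simp add: L_def)
    then show "2 * snd (x, u x) * snd h - 2 * (fst (x, u x) \<bullet> fst h) -
      2 * (f (L (x, u x)) * f' (L (x, u x)) - L (x, u x)) * L h = A (fst h) + 2 * N x * snd h"
      by (simp add: A_def L N_def gam_def inner_add_left algebra_simps)
  qed
  moreover have "bounded_linear A"
    unfolding A_def by (intro bounded_linear_intros)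
  ultimately have "(u has_derivative (\<lambda>h. - A h / (2 * N x))) (at x)"
    using N_pos[of x] trough_quadric by (intro has_derivative_implicit trough_cont_x) (auto simp: F_def L)
  then show ?thesis
    by (rule has_derivative_eq_rhs) (auto simp: A_def p_def C_def fun_eq_iff)
qed

lemma gradient_trough: "gradient u x = p x"
  by (rule frechet_derivative_imp_gradient[OF trough_has_derivative])

lemma l_has_derivative: "(l has_derivative (\<lambda>h. w x \<bullet> h)) (at x)"
  unfolding l_def axial_def
  by (auto intro!: derivative_eq_intros trough_has_derivative simp: fun_eq_iff w_def inner_add_left)

lemma gam_deriv: "(gam has_real_derivative gam' y) (at y)"
  unfolding gam_def gam'_def
  by (auto intro!: derivative_eq_intros f_deriv f'_deriv simp: power2_eq_square)

lemma gam_l_has_derivative: "((\<lambda>x. gam (l x)) has_derivative (\<lambda>h. (w x \<bullet> h) * gam' (l x))) (at x)"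
  by (rule DERIV_compose_FDERIV[OF gam_deriv l_has_derivative])

lemma N_has_derivative: "(N has_derivative (\<lambda>h. p x \<bullet> h - S * ((w x \<bullet> h) * gam' (l x)))) (at x)"
  unfolding N_def by (auto intro!: derivative_eq_intros trough_has_derivative gam_l_has_derivative)

lemma p_has_derivative:
  "(p has_derivative (\<lambda>h. (1 / N x) *\<^sub>R (h - (p x \<bullet> h) *\<^sub>R p x + (gam' (l x) * (w x \<bullet> h)) *\<^sub>R w x))) (at x)"
proof -
  define C where "C = sqrt (1 + S\<^sup>2)"
  define q where "q x = x + (C * gam (l x)) *\<^sub>R a" for x
  have q: "(q has_derivative (\<lambda>h. h + (C * ((w x \<bullet> h) * gam' (l x))) *\<^sub>R a)) (at x)"
    unfolding q_def by (auto intro!: derivative_eq_intros gam_l_has_derivative)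
  have Np: "N x \<noteq> 0" using N_pos[of x] by simp
  have pq: "p = (\<lambda>x. inverse (N x) *\<^sub>R q x)" by (simp add: p_def q_def C_def fun_eq_iff divide_inverse)
  have "((\<lambda>x. inverse (N x) *\<^sub>R q x) has_derivative (\<lambda>h. inverse (N x) *\<^sub>R (h + (C * ((w x \<bullet> h) * gam' (l x))) *\<^sub>R a) +
     (- (inverse (N x) * (p x \<bullet> h - S * ((w x \<bullet> h) * gam' (l x))) * inverse (N x))) *\<^sub>R q x)) (at x)"
  proof -
    note N' = N_has_derivative[of x]
    note i = Deriv.has_derivative_inverse[where f = N and x = x, OF Np N']
    show ?thesis by (rule has_derivative_scaleR[OF i q])
  qed
  then have "(p has_derivative (\<lambda>h. inverse (N x) *\<^sub>R (h + (C * ((w x \<bullet> h) * gam' (l x))) *\<^sub>R a) +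
     (- (inverse (N x) * (p x \<bullet> h - S * ((w x \<bullet> h) * gam' (l x))) * inverse (N x))) *\<^sub>R q x)) (at x)"
    by (simp only: pq[symmetric])
  then show ?thesis
  proof (rule has_derivative_eq_rhs)
    \<comment> \<open>After this substitution the terms \<open>sqrt (1 + S^2) *\<close>
      \<open>a\<close> and \<open>S *\<close> \<open>p\<close> combine into
      \<open>w\<close>.\<close>
    have qp: "q x = N x *\<^sub>R p x" using Np by (simp add: pq)
    show "(\<lambda>h. inverse (N x) *\<^sub>R (h + (C * ((w x \<bullet> h) * gam' (l x))) *\<^sub>R a) +
     (- (inverse (N x) * (p x \<bullet> h - S * ((w x \<bullet> h) * gam' (l x))) * inverse (N x))) *\<^sub>R q x)
     = (\<lambda>h. (1 / N x) *\<^sub>R (h - (p x \<bullet> h) *\<^sub>R p x + (gam' (l x) * (w x \<bullet> h)) *\<^sub>R w x))" (is "?A = ?B")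
    proof
      fix h
      define b where "b = gam' (l x) * (w x \<bullet> h)"
      have "?A h = inverse (N x) *\<^sub>R (h + (C * b) *\<^sub>R a) - (inverse (N x) * (p x \<bullet> h - S * b)) *\<^sub>R p x"
        using Np unfolding qp b_def by (simp add: mult.commute)
      also have "\<dots> = inverse (N x) *\<^sub>R (h + (C * b) *\<^sub>R a - (p x \<bullet> h - S * b) *\<^sub>R p x)"
        by (simp add: scaleR_right_diff_distrib)
      also have "h + (C * b) *\<^sub>R a - (p x \<bullet> h - S * b) *\<^sub>R p x = h - (p x \<bullet> h) *\<^sub>R p x + b *\<^sub>R w x"
        by (simp add: w_def C_def algebra_simps)
      finally show "?A h = ?B h" by (simp add: b_def divide_inverse)
    qed
  qed
qed

lemma hessian_trough: "hessian u x = (1 / N x) *\<^sub>R (mat 1 - outer (p x) (p x) + gam' (l x) *\<^sub>R outer (w x) (w x))"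
  (is "_ = ?H")
proof -
  have "gradient u = p" using gradient_trough by auto
  moreover have "(p has_derivative (\<lambda>h. ?H *v h)) (at x)"
    by (rule has_derivative_eq_rhs[OF p_has_derivative])
      (simp add: fun_eq_iff matrix_vector_mult_add_rdistrib matrix_vector_mult_diff_rdistrib outer_mult
          scaleR_matrix_vector_assoc[symmetric])
  ultimately have "frechet_derivative (gradient u) (at x) = (\<lambda>h. ?H *v h)"
    using frechet_derivative_at by metis
  then show ?thesis by (simp add: hessian_def)
qed

text \<open>\<open>(N p, N)\<close> is the position \<open>(x, u)\<close> plus \<open>gam\<close>
  times the unit spacelike vector \<open>(sqrt (1 + S^2) a, - S)\<close>, whose Minkowski product
  with the position is \<open>l\<close>. Hence \<open>N^2 (1 - |p|^2) = (f^2 - l^2) - 2 gam l -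
  gam^2 = f^2 - (gam + l)^2\<close>, and \<open>gam + l = f f'\<close>.\<close>

lemma one_minus_p_sq: "1 - p x \<bullet> p x = (f (l x))\<^sup>2 * (1 - (f' (l x))\<^sup>2) / (N x)\<^sup>2"
proof -
  define C where "C = sqrt (1 + S\<^sup>2)"
  define g where "g = gam (l x)"
  have aa: "a \<bullet> a = 1" using a by (simp add: dot_square_norm)
  have l: "C * (a \<bullet> x) = l x - S * u x" by (simp add: l_def axial_def C_def)
  have CC: "C * C = 1 + S * S" unfolding C_def by (rule sqrt_1_sq)
  define q where "q = x + (C * g) *\<^sub>R a"
  have "q \<bullet> q = x \<bullet> x + 2 * g * (C * (a \<bullet> x)) + g * g * (C * C)"
    by (simp add: q_def inner_add_left inner_add_right aa inner_commute algebra_simps)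
  also have "\<dots> = x \<bullet> x + 2 * g * (l x - S * u x) + g * g * (1 + S * S)" by (simp only: l CC)
  finally have "(N x)\<^sup>2 - q \<bullet> q = ((u x)\<^sup>2 - x \<bullet> x) - 2 * g * l x - g * g"
    by (simp add: N_def g_def[symmetric] power2_eq_square algebra_simps)
  also have "\<dots> = (f (l x))\<^sup>2 - (g + l x)\<^sup>2"
    unfolding trough_quadric by (simp add: power2_eq_square algebra_simps)
  also have "\<dots> = (f (l x))\<^sup>2 * (1 - (f' (l x))\<^sup>2)"
    by (simp add: g_def gam_def power2_eq_square algebra_simps)
  finally have "(N x)\<^sup>2 - q \<bullet> q = (f (l x))\<^sup>2 * (1 - (f' (l x))\<^sup>2)" .
  moreover have "p x \<bullet> p x = q \<bullet> q / (N x)\<^sup>2"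
    by (simp add: p_def q_def g_def C_def power2_eq_square)
  ultimately show ?thesis using N_pos[of x] by (simp add: diff_divide_distrib[symmetric] field_simps)
qed

lemma p_sq_less: "p x \<bullet> p x < 1"
proof -
  have "0 < (f (l x))\<^sup>2 * (1 - (f' (l x))\<^sup>2) / (N x)\<^sup>2"
    using f_pos[of "l x"] f'_sq_less[of "l x"] N_pos[of x] by simp
  then show ?thesis using one_minus_p_sq[of x] by simp
qed

text \<open>The left side is the squared gradient of \<open>l\<close> in the induced metric. In
  coordinates adapted to the rotation that metric is \<open>(1 - f'^2) dl^2\<close> plus a part in
  which \<open>l\<close> is constant, which predicts the value.\<close>

lemma w_dual_norm:
  "w x \<bullet> w x + (p x \<bullet> w x)\<^sup>2 / (1 - p x \<bullet> p x) = 1 / (1 - (f' (l x))\<^sup>2)"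
proof -
  define C where "C = sqrt (1 + S\<^sup>2)"
  define g where "g = gam (l x)"
  define P where "P = p x \<bullet> p x"
  define \<alpha> where "\<alpha> = a \<bullet> p x"
  have aa: "a \<bullet> a = 1" using a by (simp add: dot_square_norm)
  have CC: "C * C = 1 + S * S" unfolding C_def by (rule sqrt_1_sq)
  have N0: "N x \<noteq> 0" using N_pos[of x] by simp
  have "N x * \<alpha> = a \<bullet> x + C * g" using N0 by (simp add: \<alpha>_def p_def inner_add_right aa C_def g_def)
  then have "N x * (C * \<alpha> + S) = C * (a \<bullet> x) + (C * C) * g + S * N x" by (simp add: algebra_simps)
  also have "\<dots> = l x + g" 
    unfolding CC by (simp add: l_def axial_def N_def g_def C_def algebra_simps power2_eq_square)
  also have "\<dots> = f (l x) * f' (l x)" by (simp add: g_def gam_def)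
  finally have \<alpha>: "C * \<alpha> + S = f (l x) * f' (l x) / N x" using N0 by (simp add: field_simps)
  have ww: "w x \<bullet> w x = C * C + 2 * C * S * \<alpha> + S * S * P"
    by (simp add: w_def C_def[symmetric] inner_add_left inner_add_right aa \<alpha>_def P_def inner_commute algebra_simps)
  have pw: "p x \<bullet> w x = C * \<alpha> + S * P"
    by (simp add: w_def C_def[symmetric] inner_add_right \<alpha>_def P_def inner_commute)
  have "(w x \<bullet> w x) * (1 - P) + (p x \<bullet> w x)\<^sup>2 = C * C * (1 - P + \<alpha>\<^sup>2) + 2 * C * S * \<alpha> + S * S * P"
    unfolding ww pw by (simp add: power2_eq_square algebra_simps)
  also have "\<dots> = (1 - P) + ((C * C) * \<alpha>\<^sup>2 + 2 * C * S * \<alpha> + S * S)"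
    unfolding CC by (simp add: algebra_simps)
  also have "\<dots> = (1 - P) + (C * \<alpha> + S)\<^sup>2" by (simp add: power2_eq_square algebra_simps)
  also have "\<dots> = (f (l x))\<^sup>2 / (N x)\<^sup>2"
    unfolding \<alpha> P_def one_minus_p_sq
    by (simp add: power_divide power_mult_distrib add_divide_distrib[symmetric] algebra_simps)
  finally have 1: "(w x \<bullet> w x) * (1 - P) + (p x \<bullet> w x)\<^sup>2 = (f (l x))\<^sup>2 / (N x)\<^sup>2" .
  have "1 - P > 0" using p_sq_less by (simp add: P_def)
  then have "w x \<bullet> w x + (p x \<bullet> w x)\<^sup>2 / (1 - P) = ((f (l x))\<^sup>2 / (N x)\<^sup>2) / (1 - P)"
    unfolding 1[symmetric] by (simp add: field_simps)
  also have "\<dots> = 1 / (1 - (f' (l x))\<^sup>2)"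
    using f_pos[of "l x"] N0 f'_sq_less[of "l x"] unfolding P_def one_minus_p_sq by simp
  finally show ?thesis by (simp add: P_def)
qed

text \<open>\<open>gam'\<close> may be negative, so definiteness of the Hessian is not visible term
  by term. This quantity decides it, and it is also a factor of the determinant.\<close>

lemma one_plus_gam': "1 + gam' (l x) * (w x \<bullet> w x + (p x \<bullet> w x)\<^sup>2 / (1 - p x \<bullet> p x))
    = f (l x) * f'' (l x) / (1 - (f' (l x))\<^sup>2)"
  using f'_sq_less[of "l x"] unfolding w_dual_norm gam'_def by (simp add: field_simps)

lemma hessian_trough_pos: "h \<noteq> 0 \<Longrightarrow> 0 < h \<bullet> (hessian u x *v h)"
proof -
  assume h: "h \<noteq> 0"
  have "0 < f (l x) * f'' (l x) / (1 - (f' (l x))\<^sup>2)"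
    using f_pos[of "l x"] f''_pos[of "l x"] f'_sq_less[of "l x"] by simp
  then have "0 < h \<bullet> h - (p x \<bullet> h)\<^sup>2 + gam' (l x) * (w x \<bullet> h)\<^sup>2"
    using rank_two_update_pos[OF p_sq_less h, of "gam' (l x)" "w x"] one_plus_gam' by simp
  moreover have "h \<bullet> (hessian u x *v h) = (1 / N x) * (h \<bullet> h - (p x \<bullet> h)\<^sup>2 + gam' (l x) * (w x \<bullet> h)\<^sup>2)"
    unfolding hessian_trough
    by (simp add: matrix_vector_mult_add_rdistrib matrix_vector_mult_diff_rdistrib outer_mult
          scaleR_matrix_vector_assoc[symmetric] inner_add_right inner_diff_right power2_eq_square inner_commute)
  ultimately show ?thesis using N_pos[of x] by simp
qed

lemma det_scaleR: "det (c *\<^sub>R A) = c ^ CARD('m) * det A" for A :: "real ^ 'm ^ 'm"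
  using det_rows_mul[of "\<lambda>_. c" "\<lambda>i. A $ i"] by (simp add: scaleR_vec_def vector_scalar_mult_def)

lemma det_hessian_trough: "det (hessian u x) = (f (l x)) ^ 3 * f'' (l x) / N x ^ (CARD('n) + 2)"
proof -
  have "det (hessian u x) = (1 / N x) ^ CARD('n) * ((1 - p x \<bullet> p x) * (f (l x) * f'' (l x) / (1 - (f' (l x))\<^sup>2)))"
    unfolding hessian_trough det_scaleR det_rank_two_update[OF p_sq_less] one_plus_gam' ..
  moreover define e where "e = 1 - (f' (l x))\<^sup>2"
  moreover have "e > 0" using f'_sq_less[of "l x"] by (simp add: e_def)
  ultimately show ?thesis
    unfolding one_minus_p_sq e_def[symmetric]
    by (simp add: power_add power_divide power2_eq_square power3_eq_cube mult_ac)
qed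

lemma p_cont: "continuous_on UNIV p"
  by (auto intro!: continuous_at_imp_continuous_on has_derivative_continuous[OF p_has_derivative])

lemma l_cont: "continuous_on UNIV l"
  by (auto intro!: continuous_at_imp_continuous_on has_derivative_continuous[OF l_has_derivative])

lemma C2_trough: "C2 u"
  unfolding C2_def
proof (intro conjI)
  show "u differentiable_on UNIV"
    using trough_has_derivative by (auto simp: differentiable_on_def differentiable_def)
  have g: "gradient u = p" using gradient_trough by auto
  show "gradient u differentiable_on UNIV"
    unfolding g using p_has_derivative by (auto simp: differentiable_on_def differentiable_def)
  have N: "continuous_on UNIV N"
    by (auto intro!: continuous_at_imp_continuous_on has_derivative_continuous[OF N_has_derivative])
  have w: "continuous_on UNIV w" unfolding w_def by (intro continuous_intros p_cont)
  have g': "continuous_on UNIV gam'" unfolding gam'_def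
    by (intro continuous_intros f_cont f'_cont f''_cont)
  have o: "continuous_on UNIV (\<lambda>x. outer (v x) (v x))" if "continuous_on UNIV v" for v :: "real ^ 'n \<Rightarrow> real ^ 'n"
    unfolding outer_def by (intro continuous_on_vec_lambda continuous_intros that)
  have "hessian u = (\<lambda>x. (1 / N x) *\<^sub>R (mat 1 - outer (p x) (p x) + gam' (l x) *\<^sub>R outer (w x) (w x)))"
    using hessian_trough by auto
  moreover have "N x \<noteq> 0" for x using N_pos[of x] by simp
  ultimately show "continuous_on UNIV (hessian u)"
    using o[OF p_cont] o[OF w] continuous_on_compose2[OF g' l_cont]
    by (auto intro!: continuous_intros N)
qed

theorem trough_curvature_solution:
  assumes n: "n = CARD('n)"
  shows "u \<in> curvature_solutions k"
proof -
  have npos: "n \<ge> 1" using n by (simp add: Suc_leI)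
  have grad: "(norm (gradient u x))\<^sup>2 = p x \<bullet> p x" for x by (simp add: gradient_trough power2_norm_eq_inner)
  have "norm (gradient u x) < 1" for x
    using p_sq_less[of x] unfolding grad[symmetric] by (simp add: power_less_one_iff abs_square_less_1)
  moreover have "gauss_curvature u x = k" for x
  proof -
    define F where "F = f (l x)"
    define e where "e = 1 - (f' (l x))\<^sup>2"
    have pos: "F > 0" "e > 0" "N x > 0" using f_pos f'_sq_less N_pos by (auto simp: F_def e_def)
    have "(1 - (norm (gradient u x))\<^sup>2) powr ((real n + 2) / 2)
      = ((F / N x)\<^sup>2 * e) powr ((real n + 2) / 2)"
      unfolding grad one_minus_p_sq by (simp add: F_def e_def power_divide)
    also have "\<dots> = ((F / N x)\<^sup>2) powr ((real n + 2) / 2) * e powr ((real n + 2) / 2)"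
      using pos by (subst powr_mult) auto
    also have "((F / N x)\<^sup>2) powr ((real n + 2) / 2) = (F / N x) ^ (n + 2)"
    proof -
      have "(F / N x)\<^sup>2 = (F / N x) powr 2" using pos by (simp add: powr_numeral)
      then have "((F / N x)\<^sup>2) powr ((real n + 2) / 2) = (F / N x) powr (real (n + 2))"
        by (simp add: powr_powr add_divide_distrib add.commute)
      also have "\<dots> = (F / N x) ^ (n + 2)" by (rule powr_realpow) (use pos in simp)
      finally show ?thesis .
    qed
    finally have "gauss_curvature u x = (F ^ 3 * (k * F ^ (n - 1) * e powr ((real n + 2) / 2)) / N x ^ (n + 2)) /
        ((F / N x) ^ (n + 2) * e powr ((real n + 2) / 2))"
      unfolding gauss_curvature_def det_hessian_trough n[symmetric] ode by (simp add: F_def e_def)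
    also have "\<dots> = k * (F ^ 3 * F ^ (n - 1)) / F ^ (n + 2)"
      using pos by (simp add: power_divide)
    also have "F ^ 3 * F ^ (n - 1) = F ^ (n + 2)" using npos by (simp flip: power_add)
    finally show ?thesis using pos by simp
  qed
  ultimately show ?thesis
    using hessian_trough_pos C2_trough
    by (auto simp: curvature_solutions_def strictly_convex_def strictly_spacelike_def)
qed

end

context curvature_profile
begin

lemma trough_has_gradient:
  assumes "norm a = 1"
  shows "(trough f S a has_derivative (\<lambda>h. gradient (trough f S a) x \<bullet> h)) (at x)"
proof -
  interpret boosted_trough n k f f' f'' S a using assms by unfold_locales
  show ?thesis using trough_has_derivative gradient_trough by simp
qed

lemma trough_gradient_less:
  assumes "norm a = 1"
  shows "norm (gradient (trough f S a) x) < 1"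
proof -
  interpret boosted_trough n k f f' f'' S a using assms by unfold_locales
  show ?thesis using C2_trough p_sq_less[of x] unfolding gradient_trough
    by (simp add: norm_eq_sqrt_inner)
qed

text \<open>Each gradient has norm below 1; joint continuity in the boost, the axis and the point
  makes the bound uniform on compact parameter sets.\<close>

lemma trough_gradient_cont:
  "continuous_on (UNIV \<times> sphere 0 1 \<times> UNIV) (\<lambda>(S, a :: real ^ 'n, x). gradient (trough f S a) x)"
proof -
  define L where "L z = axial (fst z) (fst (snd z)) (snd (snd z)) (trough f (fst z) (fst (snd z)) (snd (snd z)))"
    for z :: "real \<times> (real ^ 'n) \<times> (real ^ 'n)"
  define G where "G z = f (L z) * f' (L z) - L z" for z
  define M where "M z = trough f (fst z) (fst (snd z)) (snd (snd z)) - fst z * G z" for z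
  define P where "P z = (1 / M z) *\<^sub>R (snd (snd z) + (sqrt (1 + (fst z)\<^sup>2) * G z) *\<^sub>R fst (snd z))" for z
  have u: "continuous_on A (\<lambda>z. trough f (fst z) (fst (snd z)) (snd (snd z)))"
    for A :: "(real \<times> (real ^ 'n) \<times> (real ^ 'n)) set"
    using trough_cont continuous_on_subset by (fastforce simp: split_beta')
  have L: "continuous_on A L" for A
    unfolding L_def axial_def by (intro continuous_intros u)
  have G: "continuous_on A G" for A
    unfolding G_def
    by (intro continuous_intros continuous_on_compose2[OF f_cont[of UNIV] L] continuous_on_compose2[OF f'_cont[of UNIV] L] L) auto
  have eq: "M z > 0 \<and> gradient (trough f (fst z) (fst (snd z))) (snd (snd z)) = P z"
    if "z \<in> UNIV \<times> sphere 0 1 \<times> UNIV" for z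
  proof -
    interpret boosted_trough n k f f' f'' "fst z" "fst (snd z)" using that by unfold_locales auto
    show ?thesis using N_pos[of "snd (snd z)"] unfolding gradient_trough
      by (simp add: M_def N_def p_def P_def G_def L_def gam_def l_def)
  qed
  have "continuous_on (UNIV \<times> sphere 0 1 \<times> UNIV) P"
    unfolding P_def M_def using eq
    by (intro continuous_intros u G) (auto simp: M_def less_imp_neq[symmetric])
  then show ?thesis
    unfolding split_beta' by (rule continuous_on_eq) (use eq in auto)
qed

lemma trough_solution:
  assumes "norm a = 1" "n = CARD('n)"
  shows "trough f S (a :: real ^ 'n) \<in> curvature_solutions k"
proof -
  interpret boosted_trough n k f f' f'' S a using assms by unfold_locales
  show ?thesis using trough_curvature_solution assms by simp
qed

end

section \<open>Semitroughs and spherical caps\<close>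

text \<open>The null vectors \<open>(\<mu>, 1)\<close> whose boosted axial coordinate is
  nonnegative, that is, a half sphere seen from the boosted frame. \<open>S = 0\<close> gives the
  half sphere itself, and larger \<open>S\<close> means a larger cap.\<close>

definition cap :: "real \<Rightarrow> real ^ 'n \<Rightarrow> (real ^ 'n) set" where
  "cap S a = {\<mu> \<in> sphere 0 1. 0 \<le> axial S a \<mu> 1}"

lemma boost_invariant:
  fixes a x y :: "real ^ 'n"
  assumes "norm a = 1"
  shows "x \<bullet> y - t * s = axial S a x t * axial S a y s - height S a x t * height S a y s
    + (x - (a \<bullet> x) *\<^sub>R a) \<bullet> (y - (a \<bullet> y) *\<^sub>R a)"
proof -
  have aa: "a \<bullet> a = 1" using assms by (simp add: dot_square_norm)
  define C where "C = sqrt (1 + S\<^sup>2)"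
  have CC: "C * C = 1 + S * S" unfolding C_def by (rule sqrt_1_sq)
  have "axial S a x t * axial S a y s - height S a x t * height S a y s
     = (C * C - S * S) * ((a \<bullet> x) * (a \<bullet> y) - t * s)"
    unfolding height_def axial_def C_def[symmetric] by (simp add: algebra_simps)
  moreover have "(x - (a \<bullet> x) *\<^sub>R a) \<bullet> (y - (a \<bullet> y) *\<^sub>R a) = x \<bullet> y - (a \<bullet> x) * (a \<bullet> y)"
    using aa by (simp add: inner_diff_left inner_diff_right inner_commute)
  ultimately show ?thesis by (simp add: CC)
qed

lemma minkowski_sq_boost:
  fixes a x :: "real ^ 'n"
  assumes "norm a = 1"
  shows "t\<^sup>2 - x \<bullet> x = (height S a x t)\<^sup>2 - (axial S a x t)\<^sup>2 - (norm (x - (a \<bullet> x) *\<^sub>R a))\<^sup>2"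
  using boost_invariant[OF assms, of x x t t S]
  by (simp add: power2_eq_square flip: power2_norm_eq_inner)

text \<open>Since \<open>(\<zeta>, 1)\<close> is null, its boosted height is the Euclidean norm of
  its boosted spatial part; so Cauchy-Schwarz can be sharp for such vectors.\<close>

lemma cap_nullD:
  assumes a: "norm a = 1" and "\<zeta> \<in> cap S a"
  shows "0 \<le> axial S a \<zeta> 1" and "0 < height S a \<zeta> 1"
    and "norm (axial S a \<zeta> 1, \<zeta> - (a \<bullet> \<zeta>) *\<^sub>R a) = height S a \<zeta> 1"
proof -
  have \<zeta>: "norm \<zeta> = 1" and "0 \<le> axial S a \<zeta> 1" using assms(2) by (auto simp: cap_def)
  then show "0 \<le> axial S a \<zeta> 1" by simp
  have "\<bar>a \<bullet> \<zeta>\<bar> \<le> 1" using Cauchy_Schwarz_ineq2[of a \<zeta>] a \<zeta> by simp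
  then have "\<bar>S * (a \<bullet> \<zeta>)\<bar> \<le> \<bar>S\<bar> * 1" unfolding abs_mult by (intro mult_left_mono) auto
  then show pos: "0 < height S a \<zeta> 1" using abs_less_sqrt_1[of S] by (simp add: height_def)
  have "(norm (axial S a \<zeta> 1, \<zeta> - (a \<bullet> \<zeta>) *\<^sub>R a))\<^sup>2 = (height S a \<zeta> 1)\<^sup>2"
    using minkowski_sq_boost[OF a, of 1 \<zeta> S] \<zeta> by (simp add: norm_Pair dot_square_norm)
  then show "norm (axial S a \<zeta> 1, \<zeta> - (a \<bullet> \<zeta>) *\<^sub>R a) = height S a \<zeta> 1"
    using pos by (simp add: power2_eq_iff_nonneg)
qed

lemma unit_orthogonal_exists:
  fixes a :: "real ^ 'n"
  assumes "CARD('n) \<ge> 2"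
  obtains e where "norm e = 1" "a \<bullet> e = 0"
proof -
  obtain y where y: "y \<noteq> 0" "orthogonal a y"
    using orthogonal_to_vector_exists[of a] assms by auto
  then show thesis using that[of "y /\<^sub>R norm y"] by (simp add: orthogonal_def)
qed

lemma unit_decomposition:
  fixes a b :: "real ^ 'n"
  assumes "CARD('n) \<ge> 2" "norm a = 1" "norm b = 1"
  obtains e \<theta> where "norm e = 1" "a \<bullet> e = 0" "0 \<le> \<theta>" "\<theta> \<le> pi"
    "b = cos \<theta> *\<^sub>R a + sin \<theta> *\<^sub>R e"
proof -
  define \<theta> where "\<theta> = arccos (a \<bullet> b)"
  have ab: "\<bar>a \<bullet> b\<bar> \<le> 1" using Cauchy_Schwarz_ineq2[of a b] assms by simp
  then have c: "cos \<theta> = a \<bullet> b" "0 \<le> \<theta>" "\<theta> \<le> pi"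
    unfolding \<theta>_def by (auto intro!: cos_arccos arccos_lbound arccos_ubound)
  define r where "r = b - (a \<bullet> b) *\<^sub>R a"
  have ar: "a \<bullet> r = 0" using assms by (simp add: r_def inner_diff_right dot_square_norm)
  have "(norm r)\<^sup>2 = 1 - (a \<bullet> b)\<^sup>2"
    unfolding r_def norm_perp_sq[OF assms(2)] using assms by (simp add: dot_square_norm)
  also have "\<dots> = (sin \<theta>)\<^sup>2" using c by (simp add: sin_squared_eq)
  finally have r: "norm r = sin \<theta>" using c sin_ge_zero[of \<theta>] by (simp add: power2_eq_iff_nonneg)
  show thesis
  proof (cases "sin \<theta> = 0")
    case True
    obtain e where "norm e = 1" "a \<bullet> e = 0" using unit_orthogonal_exists[OF assms(1)] .
    moreover have "b = (a \<bullet> b) *\<^sub>R a" using r True by (simp add: r_def)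
    ultimately show thesis using that[of e \<theta>] c True by simp
  next
    case False
    have "norm (r /\<^sub>R sin \<theta>) = 1" using False r by (metis norm_eq_zero norm_sgn sgn_div_norm)
    moreover have "a \<bullet> (r /\<^sub>R sin \<theta>) = 0" using ar by simp
    moreover have "b = cos \<theta> *\<^sub>R a + sin \<theta> *\<^sub>R (r /\<^sub>R sin \<theta>)"
      using False unfolding c(1) by (simp add: r_def)
    ultimately show thesis using that c(2,3) by blast
  qed
qed

lemma sqrt_1_pos: "0 < sqrt (1 + S\<^sup>2)" for S :: real
  by (simp add: add_pos_nonneg)

text \<open>In terms of the angular radius \<open>\<alpha> = arccos (- S / sqrt (1 + S\<^sup>2))\<close> of a cap and the angle
  \<open>\<theta>\<close> between the centres, inclusion means \<open>\<theta> + \<alpha>\<^sub>A \<le> \<alpha>\<^sub>B\<close>; equivalently, the difference of the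
  Minkowski normals \<open>(sqrt (1 + S\<^sup>2) a, - S)\<close> is causal.\<close>

lemma cap_subset_causal:
  fixes a b :: "real ^ 'n"
  assumes n: "CARD('n) \<ge> 2" and a: "norm a = 1" and b: "norm b = 1" and sub: "cap SA a \<subseteq> cap SB b"
  shows "SA \<le> SB"
    and "norm (sqrt (1 + SA\<^sup>2) *\<^sub>R a - sqrt (1 + SB\<^sup>2) *\<^sub>R b) \<le> SB - SA"
proof -
  define CA CB where "CA = sqrt (1 + SA\<^sup>2)" and "CB = sqrt (1 + SB\<^sup>2)"
  have C: "CA > 0" "CB > 0" "CA * CA = 1 + SA * SA" "CB * CB = 1 + SB * SB" "\<bar>SA\<bar> < CA" "\<bar>SB\<bar> < CB"
    unfolding CA_def CB_def by (rule sqrt_1_pos sqrt_1_sq abs_less_sqrt_1)+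
  define A B where "A = arccos (- SA / CA)" and "B = arccos (- SB / CB)"
  have cs: "cos (arccos (- S / C)) = - S / C \<and> sin (arccos (- S / C)) = 1 / C
      \<and> 0 \<le> arccos (- S / C) \<and> arccos (- S / C) \<le> pi"
    if "C > 0" "C * C = 1 + S * S" "\<bar>S\<bar> < C" for S C :: real
  proof -
    have r: "-1 \<le> - S / C" "- S / C \<le> 1" using that by (auto simp: field_simps)
    have "1 - (- S / C)\<^sup>2 = (C * C - S * S) / (C * C)"
      using that(1) by (simp add: power2_eq_square field_simps)
    also have "\<dots> = (1 / C)\<^sup>2" unfolding that(2) by (simp add: power2_eq_square that(2))
    finally have "1 - (- S / C)\<^sup>2 = (1 / C)\<^sup>2" .
    then have "sin (arccos (- S / C)) = 1 / C" using r that by (simp add: sin_arccos)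
    then show ?thesis using r by (simp add: arccos_lbound arccos_ubound)
  qed
  have A: "cos A = - SA / CA" "sin A = 1 / CA" "0 \<le> A" "A \<le> pi"
    using cs[of CA SA] C by (auto simp: A_def)
  have B: "cos B = - SB / CB" "sin B = 1 / CB" "0 \<le> B" "B \<le> pi"
    using cs[of CB SB] C by (auto simp: B_def)
  obtain e \<theta> where e: "norm e = 1" "a \<bullet> e = 0" "0 \<le> \<theta>" "\<theta> \<le> pi" "b = cos \<theta> *\<^sub>R a + sin \<theta> *\<^sub>R e"
    using unit_decomposition[OF n a b] .
  have aa: "a \<bullet> a = 1" "e \<bullet> e = 1" "b \<bullet> b = 1" "e \<bullet> a = 0" using a b e by (auto simp: dot_square_norm inner_commute)
  have ab: "a \<bullet> b = cos \<theta>" using e aa by (simp add: inner_add_right)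
  \<comment> \<open>The boundary point of the first cap that is farthest from \<open>b\<close>; if
    it lies in the second cap, then \<open>\<theta> + A \<le> B\<close>, provided the sum does not
    exceed \<open>pi\<close>.\<close>
  define \<mu> where "\<mu> = cos A *\<^sub>R a - sin A *\<^sub>R e"
  have "\<mu> \<bullet> \<mu> = 1"
    using sin_cos_squared_add3[of A] by (simp add: \<mu>_def inner_diff_left inner_diff_right aa e power2_eq_square)
  moreover have "axial SA a \<mu> 1 = 0"
    using C A by (simp add: axial_def \<mu>_def inner_diff_right aa e flip: CA_def)
  ultimately have "\<mu> \<in> cap SA a" by (simp add: cap_def norm_eq_1)
  then have "\<mu> \<in> cap SB b" using sub by auto
  then have "0 \<le> CB * (b \<bullet> \<mu>) + SB" by (simp add: cap_def axial_def flip: CB_def)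
  moreover have "b \<bullet> \<mu> = cos (\<theta> + A)"
    by (simp add: e(5) \<mu>_def inner_diff_right inner_add_left aa e cos_add)
  ultimately have cosle: "cos B \<le> cos (\<theta> + A)"
    unfolding B(1) using C(2) by (simp add: field_simps)
  \<comment> \<open>Otherwise the antipode of \<open>b\<close> would lie in the first cap, but it
    lies in no cap centred at \<open>b\<close>.\<close>
  have "\<theta> + A \<le> pi"
  proof (rule ccontr)
    assume "\<not> \<theta> + A \<le> pi"
    then have "cos \<theta> \<le> cos (pi - A)" using A e by (intro cos_monotone_0_pi_le) auto
    then have "- b \<in> cap SA a" using C A by (simp add: cap_def axial_def b ab field_simps flip: CA_def)
    then have "- b \<in> cap SB b" using sub by auto
    then show False using C by (simp add: cap_def axial_def aa flip: CB_def)
  qed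
  then have le: "\<theta> + A \<le> B" using cosle A B e cos_mono_le_eq[of B "\<theta> + A"] by auto
  then have "cos (B - A) \<le> cos \<theta>" using A B e by (intro cos_monotone_0_pi_le) auto
  then have "(SA * SB + 1) / (CA * CB) \<le> a \<bullet> b" unfolding cos_diff ab A B by (simp add: add_divide_distrib mult.commute)
  \<comment> \<open>The Minkowski product of the unit normals \<open>(CA a, - SA)\<close> and
    \<open>(CB b, - SB)\<close> is at least 1; together with \<open>SA \<le> SB\<close> this is
    causality of their difference.\<close>
  then have hh: "1 \<le> CA * CB * (a \<bullet> b) - SA * SB" using C by (simp add: field_simps)
  show S: "SA \<le> SB"
  proof (rule ccontr)
    assume "\<not> SA \<le> SB"
    have "A \<le> B" using le e by simp
    then have "sin (B - A) \<ge> 0" using A B by (intro sin_ge_zero) auto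
    then have "(SB - SA) / (CA * CB) \<ge> 0" unfolding sin_diff A B by (simp add: diff_divide_distrib mult.commute)
    then show False using \<open>\<not> SA \<le> SB\<close> mult_pos_pos[OF C(1,2)] by (simp add: zero_le_divide_iff)
  qed
  have "(norm (CA *\<^sub>R a - CB *\<^sub>R b))\<^sup>2 = CA * CA + CB * CB - 2 * (CA * CB * (a \<bullet> b))"
    by (simp add: power2_norm_eq_inner inner_diff_left inner_diff_right aa inner_commute algebra_simps)
  also have "\<dots> \<le> (SB - SA)\<^sup>2" using hh C by (simp add: power2_eq_square algebra_simps)
  finally show "norm (sqrt (1 + SA\<^sup>2) *\<^sub>R a - sqrt (1 + SB\<^sup>2) *\<^sub>R b) \<le> SB - SA"
    using S unfolding CA_def CB_def by (simp add: power2_le_iff_abs_le abs_le_square_iff)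
qed

lemma trough_quadric':
  assumes "curvature_profile n k f f' f''" "norm a = 1"
  shows "(trough f S a x)\<^sup>2 - x \<bullet> x = (f (axial S a x (trough f S a x)))\<^sup>2 - (axial S a x (trough f S a x))\<^sup>2"
proof -
  interpret curvature_profile n k f f' f'' by fact
  interpret boosted_trough n k f f' f'' S a using assms by unfold_locales
  show ?thesis using trough_quadric by (simp add: l_def)
qed

context curvature_profile
begin

lemma f_convex: "convex_on UNIV f"
  by (rule f''_ge0_imp_convex[OF _ f_deriv f'_deriv]) (auto simp: less_imp_le f''_pos)

text \<open>The epigraph is the set where \<open>defect\<close> is nonnegative, and
  \<open>defect\<close> is concave jointly in \<open>x\<close> and \<open>t\<close>:
  \<open>f\<close> is convex, and the norm of the pair is convex and increasing in its positive
  first entry.\<close>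

lemma trough_convex:
  fixes a :: "real ^ 'n"
  shows "convex_on UNIV (trough f S a)"
proof (intro convex_onI)
  fix \<theta> :: real and x y :: "real ^ 'n"
  assume \<theta>: "0 < \<theta>" "\<theta> < 1"
  define z where "z = (1 - \<theta>) *\<^sub>R x + \<theta> *\<^sub>R y"
  define t where "t = (1 - \<theta>) * trough f S a x + \<theta> * trough f S a y"
  define lx ly where "lx = axial S a x (trough f S a x)" and "ly = axial S a y (trough f S a y)"
  define P where "P x = x - (a \<bullet> x) *\<^sub>R a" for x
  have l: "axial S a z t = (1 - \<theta>) *\<^sub>R lx + \<theta> *\<^sub>R ly"
    by (simp add: axial_def z_def t_def lx_def ly_def inner_add_right algebra_simps)
  have "f (axial S a z t) \<le> (1 - \<theta>) * f lx + \<theta> * f ly"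
    unfolding l using convex_onD[OF f_convex, of \<theta> lx ly] \<theta> by simp
  then have "norm (f (axial S a z t), P z) \<le> norm ((1 - \<theta>) * f lx + \<theta> * f ly, P z)"
    using f_pos[of "axial S a z t"] unfolding norm_Pair by (intro real_sqrt_le_mono) (auto intro!: power_mono)
  also have "((1 - \<theta>) * f lx + \<theta> * f ly, P z) = (1 - \<theta>) *\<^sub>R (f lx, P x) + \<theta> *\<^sub>R (f ly, P y)"
    by (simp add: P_def z_def inner_add_right algebra_simps)
  also have "norm \<dots> \<le> (1 - \<theta>) * norm (f lx, P x) + \<theta> * norm (f ly, P y)"
    using norm_triangle_ineq[of "(1 - \<theta>) *\<^sub>R (f lx, P x)" "\<theta> *\<^sub>R (f ly, P y)"] \<theta>
    by (simp only: norm_scaleR abs_of_pos diff_gt_0_iff_gt)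
  also have "\<dots> = (1 - \<theta>) * height S a x (trough f S a x) + \<theta> * height S a y (trough f S a y)"
    using defect_trough[of S a x] defect_trough[of S a y] by (simp add: defect_def lx_def ly_def P_def)
  also have "\<dots> = height S a z t"
    by (simp add: height_def z_def t_def inner_add_right algebra_simps)
  finally have "0 \<le> defect f S a z t" by (simp add: defect_def P_def)
  then show "trough f S a ((1 - \<theta>) *\<^sub>R x + \<theta> *\<^sub>R y) \<le> (1 - \<theta>) * trough f S a x + \<theta> * trough f S a y"
    by (simp add: trough_le_iff z_def t_def)
qed simp

end

section \<open>Semitroughs against the support functions of their caps\<close>

context semitrough_profile
begin

lemma norm_positive_part_less: "norm (max y 0, v) < norm (f y, v)"
  using f_gt[of y] unfolding norm_Pair by (intro real_sqrt_less_mono) (auto intro!: power_strict_mono)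

text \<open>\<open>x \<bullet> \<zeta> - t\<close> is a Minkowski product with the null vector
  \<open>(\<zeta>, 1)\<close>, computed in the boosted frame. On the cap
  \<open>\<alpha> \<ge> 0\<close>, so \<open>l\<close> may be replaced by \<open>max l 0\<close>;
  Cauchy-Schwarz and \<open>f l > max l 0\<close> finish.\<close>

lemma trough_above_cap:
  assumes a: "norm a = 1" and \<zeta>: "\<zeta> \<in> cap S a"
  shows "x \<bullet> \<zeta> < trough f S a x"
proof -
  define t where "t = trough f S a x"
  define l where "l = axial S a x t"
  define v where "v = x - (a \<bullet> x) *\<^sub>R a"
  define w where "w = \<zeta> - (a \<bullet> \<zeta>) *\<^sub>R a"
  define \<alpha> \<beta> where "\<alpha> = axial S a \<zeta> 1" and "\<beta> = height S a \<zeta> 1"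
  note ab = cap_nullD[OF a \<zeta>, folded \<alpha>_def \<beta>_def w_def]
  have h: "height S a x t = norm (f l, v)"
    using defect_trough[of S a x] by (simp add: defect_def t_def l_def v_def)
  have "x \<bullet> \<zeta> - t = l * \<alpha> + v \<bullet> w - height S a x t * \<beta>"
    using boost_invariant[OF a, of x \<zeta> t 1 S] by (simp add: l_def \<alpha>_def \<beta>_def v_def w_def)
  also have "l * \<alpha> \<le> max l 0 * \<alpha>" using ab by (intro mult_right_mono) auto
  also have "max l 0 * \<alpha> + v \<bullet> w = (max l 0, v) \<bullet> (\<alpha>, w)" by simp
  also have "\<dots> \<le> norm (max l 0, v) * norm (\<alpha>, w)" by (rule norm_cauchy_schwarz)
  also have "\<dots> - height S a x t * \<beta> = (norm (max l 0, v) - norm (f l, v)) * \<beta>"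
    unfolding h ab(3) by (simp add: algebra_simps)
  also have "\<dots> < 0" using norm_positive_part_less[of l v] ab(2) by (intro mult_neg_pos) auto
  finally show ?thesis by (simp add: t_def)
qed

text \<open>The point \<open>\<zeta>\<close> is chosen so that Cauchy-Schwarz in
  \<open>trough_above_cap\<close> becomes an equality. The factor
  \<open>sqrt (1 + S^2) + \<bar>S\<bar>\<close> is the cost of rescaling the null vector to time
  1.\<close>

lemma trough_near_cap:
  fixes a x :: "real ^ 'n" and S :: real
  assumes n: "CARD('n) \<ge> 2" and a: "norm a = 1"
  defines "l \<equiv> axial S a x (trough f S a x)" and "v \<equiv> x - (a \<bullet> x) *\<^sub>R a"
  obtains \<zeta> where "\<zeta> \<in> cap S a"
    "trough f S a x - x \<bullet> \<zeta> \<le> (sqrt (1 + S\<^sup>2) + \<bar>S\<bar>) * (norm (f l, v) - norm (max l 0, v))"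
proof -
  note goal = that
  define t where "t = trough f S a x"
  define C where "C = sqrt (1 + S\<^sup>2)"
  have C: "C > 0" "C * C = 1 + S * S" "\<bar>S\<bar> < C" "(C - \<bar>S\<bar>) * (C + \<bar>S\<bar>) = 1"
    unfolding C_def by (rule sqrt_1_pos sqrt_1_sq abs_less_sqrt_1 sqrt_1_minus_mult_plus)+
  have aa: "a \<bullet> a = 1" using a by (simp add: dot_square_norm)
  have h: "height S a x t = norm (f l, v)"
    using defect_trough[of S a x] by (simp add: defect_def t_def l_def v_def)
  define m where "m = norm (max l 0, v)"
  have main: thesis
    if w: "a \<bullet> w = 0" and \<alpha>: "\<alpha> \<ge> 0" and \<beta>: "norm (\<alpha>, w) = \<beta>" "\<beta> > 0"
      and prod: "l * \<alpha> + v \<bullet> w = m * \<beta>" for w \<alpha> \<beta>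
  proof -
    \<comment> \<open>\<open>y\<close> and \<open>s\<close> are the space and time parts of the null
      vector \<open>(\<alpha>, w, \<beta>)\<close> after undoing the boost.\<close>
    define s where "s = C * \<beta> - S * \<alpha>"
    define y where "y = w + (C * \<alpha> - S * \<beta>) *\<^sub>R a"
    have "\<bar>\<alpha>\<bar> \<le> \<beta>" unfolding \<beta>(1)[symmetric] norm_Pair by (rule real_le_rsqrt) simp
    then have "S * \<alpha> \<le> \<bar>S\<bar> * \<beta>" using mult_mono[of S "\<bar>S\<bar>" \<alpha> \<beta>] \<alpha> by simp
    then have s_ge: "s \<ge> (C - \<bar>S\<bar>) * \<beta>" by (simp add: s_def algebra_simps)
    have s_pos: "s > 0" using s_ge \<beta>(2) C(3) mult_pos_pos[of "C - \<bar>S\<bar>" \<beta>] by linarith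
    have ay: "a \<bullet> y = C * \<alpha> - S * \<beta>" by (simp add: y_def inner_add_right w aa)
    have "axial S a y s = (C * C - S * S) * \<alpha>"
      unfolding axial_def ay C_def[symmetric] s_def by (simp add: algebra_simps)
    then have ax: "axial S a y s = \<alpha>" by (simp add: C)
    have "height S a y s = (C * C - S * S) * \<beta>"
      unfolding height_def ay C_def[symmetric] s_def by (simp add: algebra_simps)
    then have he: "height S a y s = \<beta>" by (simp add: C)
    have yw: "y - (a \<bullet> y) *\<^sub>R a = w" by (simp add: ay) (simp add: y_def)
    have "\<beta>\<^sup>2 = \<alpha>\<^sup>2 + (norm w)\<^sup>2" unfolding \<beta>(1)[symmetric] by (simp add: norm_Pair)
    then have "y \<bullet> y = s\<^sup>2"
      using minkowski_sq_boost[OF a, of s y S] unfolding ax he yw by simp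
    then have ny: "norm y = s" using s_pos by (simp add: norm_eq_sqrt_inner)
    define \<zeta> where "\<zeta> = y /\<^sub>R s"
    have "axial S a \<zeta> 1 = axial S a y s / s" using s_pos by (simp add: axial_def \<zeta>_def field_simps)
    then have "\<zeta> \<in> cap S a" using ny s_pos \<alpha> by (simp add: cap_def ax) (simp add: \<zeta>_def)
    moreover have "t - x \<bullet> \<zeta> \<le> (C + \<bar>S\<bar>) * (norm (f l, v) - m)"
    proof -
      have "t * s - x \<bullet> y = \<beta> * (norm (f l, v) - m)"
        using boost_invariant[OF a, of x y t s S] prod unfolding ax he yw h
        by (simp add: l_def t_def v_def algebra_simps)
      then have "t - x \<bullet> \<zeta> = (\<beta> / s) * (norm (f l, v) - m)"
        using s_pos by (simp add: \<zeta>_def field_simps)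
      also have "\<dots> \<le> (C + \<bar>S\<bar>) * (norm (f l, v) - m)"
      proof (rule mult_right_mono)
        have "\<beta> = ((C - \<bar>S\<bar>) * \<beta>) * (C + \<bar>S\<bar>)" using C(4) by (metis mult.assoc mult.commute mult.right_neutral)
        also have "\<dots> \<le> s * (C + \<bar>S\<bar>)" using s_ge C by (intro mult_right_mono) auto
        finally show "\<beta> / s \<le> C + \<bar>S\<bar>" using s_pos by (simp add: field_simps)
        show "0 \<le> norm (f l, v) - m" using norm_positive_part_less[of l v] by (simp add: m_def)
      qed
      finally show ?thesis .
    qed
    ultimately show thesis using goal by (simp add: t_def C_def m_def)
  qed
  show thesis
  \<comment> \<open>On the half axis \<open>l \<le> 0\<close>, \<open>v = 0\<close> there is no
    direction to align with, and any null vector orthogonal to the axis serves; otherwise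
    \<open>(max l 0, v)\<close> itself is taken.\<close>
  proof (cases "m = 0")
    case True
    then have "max l 0 = 0" "v = 0" unfolding m_def by (auto simp: norm_Pair)
    moreover obtain e where "norm e = 1" "a \<bullet> e = 0" using unit_orthogonal_exists[OF n] .
    ultimately show thesis using main[of e 0 1] True by simp
  next
    case False
    then have "m > 0" by (simp add: m_def)
    moreover have "l * max l 0 + v \<bullet> v = m * m"
    proof -
      have "m * m = (max l 0)\<^sup>2 + (norm v)\<^sup>2" unfolding m_def by (simp add: norm_Pair flip: power2_eq_square)
      then show ?thesis by (simp add: power2_norm_eq_inner) (simp add: max_def power2_eq_square)
    qed
    moreover have "a \<bullet> v = 0" by (simp add: v_def inner_diff_right aa)
    ultimately show thesis using main[of v "max l 0" m] by (simp add: m_def)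
  qed
qed

text \<open>Far out either \<open>\<bar>l\<bar>\<close> is large, where \<open>f l\<close> is close
  to \<open>max l 0\<close>, or \<open>l\<close> is bounded and \<open>v\<close> is large, where the
  difference of the two norms is at most \<open>f^2 / norm v\<close>. One \<open>R\<close> works for
  all \<open>S\<close> in a bounded range, since the boosts distort by bounded factors.\<close>

lemma trough_asymptotic:
  assumes n: "CARD('n) \<ge> 2" and e: "0 < e"
  obtains R where "\<And>S (a :: real ^ 'n) x. \<lbrakk>\<bar>S\<bar> \<le> S0; norm a = 1; R \<le> norm x\<rbrakk> \<Longrightarrow>
    \<exists>\<zeta>\<in>cap S a. trough f S a x \<le> x \<bullet> \<zeta> + e"
proof -
  define C0 where "C0 = sqrt (1 + S0\<^sup>2)"
  define K where "K = C0 + \<bar>S0\<bar>"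
  have K: "K > 0" using sqrt_1_pos[of S0] unfolding K_def C0_def by linarith
  define e1 where "e1 = e / K"
  have e1: "e1 > 0" using e K by (simp add: e1_def)
  obtain L1 where L1: "\<And>y. y \<ge> L1 \<Longrightarrow> f y - y < e1"
    using tendstoD[OF f_top e1] unfolding eventually_at_top_linorder dist_real_def by fastforce
  obtain L2 where L2: "\<And>y. y \<le> L2 \<Longrightarrow> f y < e1"
    using tendstoD[OF f_bot e1] unfolding eventually_at_bot_linorder dist_real_def by fastforce
  define L where "L = max 0 (max L1 (- L2))"
  have L: "f y - max y 0 < e1" if "\<bar>y\<bar> \<ge> L" for y
    using that L1[of y] L2[of y] by (cases "y \<ge> 0") (auto simp: L_def)
  define M where "M = f 0 + L"
  have M: "0 < f y" "f y \<le> M" if "\<bar>y\<bar> \<le> L" for y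
    using that f_lipschitz[of y 0] f_pos[of y] by (auto simp: M_def)
  \<comment> \<open>\<open>V\<close> makes \<open>M^2 / V\<close> equal to \<open>e1\<close>.
    \<open>R\<close> is chosen so that \<open>\<bar>l\<bar> < L\<close> and
    \<open>norm v < V\<close> would, after undoing the boost, force
    \<open>norm x < R\<close>.\<close>
  define V where "V = M\<^sup>2 / e1"
  define R where "R = V + C0 * L + \<bar>S0\<bar> * (M + V) + 1"
  have L0: "L \<ge> 0" by (simp add: L_def)
  have M0: "M > 0" using M[of 0] L0 by simp
  have V0: "V > 0" using M0 e1 by (simp add: V_def)
  show thesis
  proof (rule that[of R])
    fix S and a x :: "real ^ 'n"
    assume S: "\<bar>S\<bar> \<le> S0" and a: "norm a = 1" and x: "R \<le> norm x"
    define C where "C = sqrt (1 + S\<^sup>2)"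
    define l where "l = axial S a x (trough f S a x)"
    define v where "v = x - (a \<bullet> x) *\<^sub>R a"
    have SS: "\<bar>S\<bar> \<le> \<bar>S0\<bar>" using S by simp
    then have CC: "C \<le> C0" "0 < C" unfolding C_def C0_def using sqrt_1_pos[of S]
      by (auto simp: abs_le_square_iff)
    obtain \<zeta> where \<zeta>: "\<zeta> \<in> cap S a"
      "trough f S a x - x \<bullet> \<zeta> \<le> (C + \<bar>S\<bar>) * (norm (f l, v) - norm (max l 0, v))"
      using trough_near_cap[OF n a, of S x] unfolding C_def l_def v_def by blast
    have diff: "norm (f l, v) - norm (max l 0, v) \<le> e1"
    proof (cases "\<bar>l\<bar> \<ge> L")
      case True
      have "norm (f l, v) - norm (max l 0, v) \<le> norm ((f l, v) - (max l 0, v))" by (rule norm_triangle_ineq2)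
      also have "\<dots> = f l - max l 0" using f_gt[of l] by simp
      finally show ?thesis using L[OF True] by simp
    next
      case False
      then have fl: "0 < f l" "f l \<le> M" using M[of l] by auto
      have "norm v \<ge> V"
      proof (rule ccontr)
        assume "\<not> norm v \<ge> V"
        then have v: "norm v < V" by simp
        have h: "height S a x (trough f S a x) = norm (f l, v)"
          using defect_trough[of S a x] by (simp add: defect_def l_def v_def)
        have hle: "norm (f l, v) \<le> M + V" using norm_Pair_le[of "f l" v] fl v by simp
        have "a \<bullet> x = C * l - S * norm (f l, v)"
          using space_from_boost[of a x S "trough f S a x"] h by (simp add: l_def C_def)
        then have "\<bar>a \<bullet> x\<bar> \<le> C * \<bar>l\<bar> + \<bar>S\<bar> * norm (f l, v)"
          using abs_triangle_ineq4[of "C * l" "S * norm (f l, v)"] CC by (simp add: abs_mult)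
        also have "\<dots> \<le> C0 * L + \<bar>S0\<bar> * (M + V)"
          using CC SS hle False L0 by (intro add_mono mult_mono) auto
        finally have ax: "\<bar>a \<bullet> x\<bar> \<le> C0 * L + \<bar>S0\<bar> * (M + V)" .
        have "norm x \<le> norm v + norm ((a \<bullet> x) *\<^sub>R a)"
          using norm_triangle_ineq[of v "(a \<bullet> x) *\<^sub>R a"] by (simp add: v_def)
        also have "\<dots> < V + (C0 * L + \<bar>S0\<bar> * (M + V))" using v ax a by simp
        finally show False using x by (simp add: R_def)
      qed
      define t m where "t = norm (f l, v)" and "m = norm (max l 0, v)"
      have tm: "m < t" "m \<ge> 0" using norm_positive_part_less by (auto simp: t_def m_def)
      have tv: "t \<ge> V" using \<open>norm v \<ge> V\<close> by (smt (verit) norm_snd_le snd_conv t_def)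
      have "(t - m) * V \<le> (t - m) * (t + m)" using tm tv by (intro mult_left_mono) auto
      also have "\<dots> = (f l)\<^sup>2 - (max l 0)\<^sup>2"
        by (simp add: algebra_simps t_def m_def norm_Pair flip: power2_eq_square)
      also have "\<dots> \<le> (f l)\<^sup>2" by simp
      also have "\<dots> \<le> M\<^sup>2" using fl by (intro power_mono) auto
      also have "\<dots> = e1 * V" using e1 by (simp add: V_def)
      finally show ?thesis using V0 by (simp add: t_def m_def)
    qed
    have "trough f S a x - x \<bullet> \<zeta> \<le> (C + \<bar>S\<bar>) * e1"
      using \<zeta>(2) diff CC by (smt (verit) mult_left_mono)
    also have "\<dots> \<le> K * e1" using CC SS e1 by (intro mult_right_mono) (auto simp: K_def)
    also have "\<dots> = e" using K by (simp add: e1_def)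
    finally show "\<exists>\<zeta>\<in>cap S a. trough f S a x \<le> x \<bullet> \<zeta> + e" using \<zeta>(1) by (intro bexI[of _ \<zeta>]) auto
  qed
qed

end

text \<open>Suppose a point of the first graph lies on or above the second one. Causality of the difference
  of the two normals orders its axial coordinates, and \<open>t\<^sup>2 - x \<bullet> x\<close>, which is \<open>(f l)\<^sup>2 - l\<^sup>2\<close> on a
  graph and increasing in \<open>l\<close>, gives a contradiction.\<close>

theorem trough_comparison:
  fixes a b x :: "real ^ 'n"
  assumes A: "semitrough_profile nA kA fA fA' fA''" and B: "semitrough_profile nB kB fB fB' fB''"
    and less: "\<And>y. fA y < fB y"
    and a: "norm a = 1" and b: "norm b = 1"
    and causal: "norm (sqrt (1 + SA\<^sup>2) *\<^sub>R a - sqrt (1 + SB\<^sup>2) *\<^sub>R b) \<le> SB - SA"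
  shows "trough fA SA a x < trough fB SB b x"
proof (rule ccontr)
  interpret A: semitrough_profile nA kA fA fA' fA'' by fact
  interpret B: semitrough_profile nB kB fB fB' fB'' by fact
  define t where "t = trough fA SA a x"
  assume "\<not> trough fA SA a x < trough fB SB b x"
  then have "0 \<le> defect fB SB b x t" using B.trough_le_iff[of SB b x t] by (simp add: t_def)
  define CA CB where "CA = sqrt (1 + SA\<^sup>2)" and "CB = sqrt (1 + SB\<^sup>2)"
  have CB: "CB * CB = 1 + SB * SB" "CB > 0" "\<bar>SB\<bar> < CB"
    unfolding CB_def by (rule sqrt_1_pos sqrt_1_sq abs_less_sqrt_1)+
  have bb: "b \<bullet> b = 1" "a \<bullet> a = 1" using a b by (auto simp: dot_square_norm)
  have SAB: "SA \<le> SB" using causal norm_ge_zero order_trans by (smt (verit))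
  have "1 \<le> CA * CB * (a \<bullet> b) - SA * SB"
  proof -
    have "(norm (CA *\<^sub>R a - CB *\<^sub>R b))\<^sup>2 = CA * CA + CB * CB - 2 * (CA * CB * (a \<bullet> b))"
      by (simp add: power2_norm_eq_inner inner_diff_left inner_diff_right bb inner_commute algebra_simps)
    moreover have "(norm (CA *\<^sub>R a - CB *\<^sub>R b))\<^sup>2 \<le> (SB - SA)\<^sup>2"
      using causal unfolding CA_def CB_def by (intro power_mono) auto
    moreover have "CA * CA = 1 + SA * SA" unfolding CA_def by (rule sqrt_1_sq)
    ultimately show ?thesis using CB by (simp add: power2_eq_square algebra_simps)
  qed
  note causal = SAB this causal[folded CA_def CB_def]
  define lA lB where "lA = axial SA a x t" and "lB = axial SB b x t"
  define h where "h = height SB b x t"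
  define v where "v = x - (b \<bullet> x) *\<^sub>R b"
  have h: "norm (fB lB, v) \<le> h"
    using \<open>0 \<le> defect fB SB b x t\<close> by (simp add: defect_def lB_def h_def v_def)
  have "lA \<le> lB"
  proof -
    \<comment> \<open>Shifting the point by \<open>- s\<close> times the normal
      \<open>(CB b, - SB)\<close> turns its axial coordinate \<open>lB\<close> into
      \<open>max lB 0\<close> and keeps its height. The shifted point \<open>(y, \<tau>)\<close>
      lies in the future cone, where the causal difference of the normals pairs nonpositively; the
      correction carries the factor \<open>s \<le> 0\<close>.\<close>
    define s where "s = min lB 0"
    define y where "y = x - (s * CB) *\<^sub>R b"
    define \<tau> where "\<tau> = t + s * SB"
    have by': "b \<bullet> y = b \<bullet> x - s * CB" by (simp add: y_def inner_diff_right bb)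
    have "axial SB b y \<tau> = lB - s * (CB * CB - SB * SB)"
      unfolding axial_def by' \<tau>_def lB_def CB_def[symmetric] by (simp add: algebra_simps)
    then have ax: "axial SB b y \<tau> = max lB 0" by (simp add: CB s_def)
    have he: "height SB b y \<tau> = h"
      unfolding height_def by' \<tau>_def h_def CB_def[symmetric] by (simp add: algebra_simps)
    have yv: "y - (b \<bullet> y) *\<^sub>R b = v" unfolding by' by (simp add: y_def v_def algebra_simps)
    have hm: "norm (max lB 0, v) < h" using h B.norm_positive_part_less[of lB v] by simp
    have "(norm (max lB 0, v))\<^sup>2 < h\<^sup>2" using hm by (intro power_strict_mono) auto
    then have "y \<bullet> y < \<tau>\<^sup>2"
      using minkowski_sq_boost[OF b, of \<tau> y SB] unfolding ax he yv by (simp add: norm_Pair)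
    moreover have "\<tau> > 0"
    proof -
      have "\<bar>max lB 0\<bar> \<le> norm (max lB 0, v)" unfolding norm_Pair by (rule real_le_rsqrt) simp
      then have lh: "max lB 0 \<le> h" "0 \<le> h" using hm norm_ge_zero[of "(max lB 0, v)"] by linarith+
      have "SB * max lB 0 \<le> \<bar>SB\<bar> * h" using lh by (intro mult_mono) auto
      also have "\<dots> < CB * h" using CB hm norm_ge_zero[of "(max lB 0, v)"] by (intro mult_strict_right_mono) linarith+
      finally show ?thesis using time_from_boost[of \<tau> SB b y] unfolding ax he CB_def[symmetric] by simp
    qed
    ultimately have y\<tau>: "norm y \<le> \<tau>" by (simp add: norm_eq_sqrt_inner real_le_lsqrt less_imp_le)
    define d where "d = CA *\<^sub>R a - CB *\<^sub>R b"
    have "lA - lB = d \<bullet> x + (SA - SB) * t"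
      by (simp add: lA_def lB_def axial_def d_def inner_diff_left algebra_simps flip: CA_def CB_def)
    also have "x = y + (s * CB) *\<^sub>R b" by (simp add: y_def)
    also have "t = \<tau> - s * SB" by (simp add: \<tau>_def)
    also have "d \<bullet> (y + (s * CB) *\<^sub>R b) + (SA - SB) * (\<tau> - s * SB)
       = (d \<bullet> y - (SB - SA) * \<tau>) + s * (CA * CB * (a \<bullet> b) - CB * CB + SB * SB - SA * SB)"
      by (simp add: d_def inner_diff_left inner_add_right bb algebra_simps)
    also have "CA * CB * (a \<bullet> b) - CB * CB + SB * SB - SA * SB = CA * CB * (a \<bullet> b) - SA * SB - 1"
      by (simp add: CB)
    also have "d \<bullet> y - (SB - SA) * \<tau> \<le> 0"
    proof -
      have "d \<bullet> y \<le> norm d * norm y" by (rule norm_cauchy_schwarz)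
      also have "\<dots> \<le> (SB - SA) * \<tau>" using causal y\<tau> by (intro mult_mono) (auto simp: d_def)
      finally show ?thesis by simp
    qed
    also have "s * (CA * CB * (a \<bullet> b) - SA * SB - 1) \<le> 0"
      using causal by (intro mult_nonpos_nonneg) (auto simp: s_def)
    finally show ?thesis by simp
  qed
  have "(fB lB)\<^sup>2 + (norm v)\<^sup>2 \<le> h\<^sup>2"
    using power_mono[OF h, of 2] by (simp add: norm_Pair)
  then have "(fB lB)\<^sup>2 - lB\<^sup>2 \<le> t\<^sup>2 - x \<bullet> x"
    using minkowski_sq_boost[OF b, of t x SB] by (simp add: lB_def h_def v_def)
  moreover have "t\<^sup>2 - x \<bullet> x = (fA lA)\<^sup>2 - lA\<^sup>2"
    using trough_quadric'[OF A.curvature_profile_axioms a] by (simp add: lA_def t_def)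
  moreover have "(fA lA)\<^sup>2 < (fB lA)\<^sup>2"
    using A.f_pos[of lA] less[of lA] by (intro power_strict_mono) auto
  moreover have "(fB lA)\<^sup>2 - lA\<^sup>2 \<le> (fB lB)\<^sup>2 - lB\<^sup>2"
    using \<open>lA \<le> lB\<close> B.f_sq_minus_sq_strict_mono[of lA lB] by (cases "lA = lB") auto
  ultimately show False by simp
qed

section \<open>Inscribed and circumscribed caps\<close>

text \<open>The two conditions say that the closed cap, respectively the open cap, bounded by the circle of geodesic
  curvature \<open>S\<close> through \<open>\<zeta>\<close> with normal \<open>\<nu>\<close>, respectively \<open>- \<nu>\<close>, lies inside, respectively outside, \<open>F\<close>.\<close>

definition touched_at :: "(real ^ 'n) set \<Rightarrow> real \<Rightarrow> real ^ 'n \<Rightarrow> bool" where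
  "touched_at F S \<zeta> \<longleftrightarrow> (\<exists>\<nu>. norm \<nu> = 1 \<and> \<nu> \<bullet> \<zeta> = 0 \<and>
     (\<forall>\<mu> \<in> sphere 0 1. S * (1 - \<zeta> \<bullet> \<mu>) \<le> \<nu> \<bullet> \<mu> \<longrightarrow> \<mu> \<in> F) \<and>
     (\<forall>\<mu> \<in> F. - (\<nu> \<bullet> \<mu>) \<le> S * (1 - \<zeta> \<bullet> \<mu>)))"

definition touching_caps :: "(real ^ 'n) set \<Rightarrow> real \<Rightarrow> bool" where
  "touching_caps F S \<longleftrightarrow> (\<forall>\<zeta> \<in> F \<inter> closure (sphere 0 1 - F). touched_at F S \<zeta>)"

lemma support_fun_attained:
  fixes F :: "(real ^ 'n) set"
  assumes "F \<noteq> {}" "closed F" "F \<subseteq> sphere 0 1"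
  obtains \<zeta> where "\<zeta> \<in> F" "support_fun F x = x \<bullet> \<zeta>" "\<And>\<mu>. \<mu> \<in> F \<Longrightarrow> x \<bullet> \<mu> \<le> support_fun F x"
proof -
  have "compact F" using assms compact_eq_bounded_closed bounded_subset bounded_sphere by blast
  moreover have "continuous_on F (\<lambda>l. x \<bullet> l)" by (intro continuous_intros)
  ultimately obtain \<zeta> where \<zeta>: "\<zeta> \<in> F" "\<And>\<mu>. \<mu> \<in> F \<Longrightarrow> x \<bullet> \<mu> \<le> x \<bullet> \<zeta>"
    using continuous_attains_sup[of F "\<lambda>l. x \<bullet> l"] assms(1) by blast
  then have "support_fun F x = x \<bullet> \<zeta>"
    unfolding support_fun_def by (intro cSup_eq_maximum) auto
  then show thesis using that \<zeta> by simp
qed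

lemma inner_le_1:
  fixes x y :: "'a::real_inner"
  assumes "norm x = 1" "norm y = 1"
  shows "x \<bullet> y \<le> 1" "- 1 \<le> x \<bullet> y"
  using Cauchy_Schwarz_ineq2[of x y] assms by auto

lemma inner_eq_1:
  fixes x y :: "'a::real_inner"
  assumes "norm x = 1" "norm y = 1" "x \<bullet> y = 1"
  shows "x = y"
  using norm_cauchy_schwarz_eq[of x y] assms by simp

lemma unit_dist_sq:
  fixes x y :: "'a::real_inner"
  assumes "norm x = 1" "norm y = 1"
  shows "(dist x y)\<^sup>2 = 2 * (1 - y \<bullet> x)"
proof -
  have "x \<bullet> x = 1" "y \<bullet> y = 1" using assms by (auto simp: dot_square_norm)
  then show ?thesis
    unfolding dist_norm power2_norm_eq_inner by (simp add: inner_diff_left inner_diff_right inner_commute)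
qed

lemma tangential_part:
  fixes x y :: "'a::real_inner"
  assumes "norm x = 1" "norm y = 1"
  defines "v \<equiv> x - (y \<bullet> x) *\<^sub>R y"
  shows "v \<bullet> y = 0" "norm v = sqrt (1 - (y \<bullet> x)\<^sup>2)"
proof -
  have xy: "x \<bullet> x = 1" "y \<bullet> y = 1" using assms by (auto simp: dot_square_norm)
  then show "v \<bullet> y = 0" unfolding v_def inner_diff_left inner_scaleR_left by (simp add: inner_commute)
  have "v \<bullet> v = 1 - (y \<bullet> x)\<^sup>2"
    by (simp add: v_def inner_diff_left inner_diff_right xy inner_commute power2_eq_square)
  then show "norm v = sqrt (1 - (y \<bullet> x)\<^sup>2)" by (simp add: norm_eq_sqrt_inner)
qed

text \<open>Rational parametrisation of the great circle through \<open>\<zeta>\<close> in the direction \<open>e\<close>.\<close>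

lemma great_circle_point:
  fixes \<zeta> e :: "'a::real_inner"
  assumes "norm \<zeta> = 1" "norm e = 1" "e \<bullet> \<zeta> = 0"
  obtains \<mu> where "norm \<mu> = 1" "1 - \<zeta> \<bullet> \<mu> = 2 * r\<^sup>2 / (1 + r\<^sup>2)"
    "\<And>v. v \<bullet> \<zeta> = 0 \<Longrightarrow> v \<bullet> \<mu> = 2 * r / (1 + r\<^sup>2) * (v \<bullet> e)"
proof -
  define \<mu> where "\<mu> = ((1 - r\<^sup>2) / (1 + r\<^sup>2)) *\<^sub>R \<zeta> + (2 * r / (1 + r\<^sup>2)) *\<^sub>R e"
  have p: "1 + r\<^sup>2 \<noteq> 0" by (simp add: add_pos_nonneg less_imp_neq[symmetric])
  have o: "\<zeta> \<bullet> \<zeta> = 1" "e \<bullet> e = 1" "\<zeta> \<bullet> e = 0" using assms by (auto simp: dot_square_norm inner_commute)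
  have "\<mu> \<bullet> \<mu> = ((1 - r\<^sup>2) / (1 + r\<^sup>2))\<^sup>2 + (2 * r / (1 + r\<^sup>2))\<^sup>2"
    by (simp add: \<mu>_def inner_add_left inner_add_right o assms(3) power2_eq_square)
  also have "\<dots> = ((1 - r\<^sup>2)\<^sup>2 + (2 * r)\<^sup>2) / (1 + r\<^sup>2)\<^sup>2"
    by (simp add: power_divide add_divide_distrib)
  also have "(1 - r\<^sup>2)\<^sup>2 + (2 * r)\<^sup>2 = (1 + r\<^sup>2)\<^sup>2" by (simp add: power2_eq_square algebra_simps)
  finally have "norm \<mu> = 1" using p by (simp add: norm_eq_1)
  moreover have "1 - \<zeta> \<bullet> \<mu> = 1 - (1 - r\<^sup>2) / (1 + r\<^sup>2)" by (simp add: \<mu>_def inner_add_right o)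
  then have "1 - \<zeta> \<bullet> \<mu> = 2 * r\<^sup>2 / (1 + r\<^sup>2)" using p by (simp add: field_simps)
  moreover have "v \<bullet> \<mu> = 2 * r / (1 + r\<^sup>2) * (v \<bullet> e)" if "v \<bullet> \<zeta> = 0" for v
    using that by (simp add: \<mu>_def inner_add_right)
  ultimately show thesis using that by blast
qed

text \<open>On the great circle through \<open>\<zeta>\<close> in the direction of \<open>v\<close>,
  \<open>v \<bullet> \<mu>\<close> grows linearly and \<open>1 - \<zeta> \<bullet> \<mu>\<close>
  only quadratically. Hence the open cap reaches \<open>\<zeta>\<close> whatever its curvature
  \<open>\<kappa>\<close>.\<close>

lemma cap_side_closure:
  fixes \<zeta> v :: "real ^ 'n"
  assumes \<zeta>: "norm \<zeta> = 1" and v: "v \<noteq> 0" "v \<bullet> \<zeta> = 0"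
  shows "\<zeta> \<in> closure {\<mu> \<in> sphere 0 1. \<kappa> * (1 - \<zeta> \<bullet> \<mu>) < v \<bullet> \<mu>}"
  unfolding closure_approachable
proof (intro allI impI)
  fix \<epsilon> :: real assume \<epsilon>: "\<epsilon> > 0"
  define r where "r = min (\<epsilon> / 4) (norm v / (\<bar>\<kappa>\<bar> + 1))"
  have "norm v / (\<bar>\<kappa>\<bar> + 1) > 0" using v by (intro divide_pos_pos) auto
  then have "r > 0" using \<epsilon> by (simp add: r_def)
  moreover have "r \<le> \<epsilon> / 4" "r \<le> norm v / (\<bar>\<kappa>\<bar> + 1)"
    unfolding r_def by (rule min.cobounded1, rule min.cobounded2)
  ultimately have r: "r > 0" "r \<le> \<epsilon> / 4" "r \<le> norm v / (\<bar>\<kappa>\<bar> + 1)" .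
  then have r\<kappa>: "r * (\<bar>\<kappa>\<bar> + 1) \<le> norm v" by (simp add: field_simps)
  have p: "1 + r\<^sup>2 > 0" by (simp add: add_pos_nonneg)
  have "norm (v /\<^sub>R norm v) = 1" "(v /\<^sub>R norm v) \<bullet> \<zeta> = 0" using v by auto
  from great_circle_point[OF \<zeta> this, of r]
  obtain \<mu> where \<mu>: "norm \<mu> = 1" "1 - \<zeta> \<bullet> \<mu> = 2 * r\<^sup>2 / (1 + r\<^sup>2)"
    "v \<bullet> \<mu> = 2 * r / (1 + r\<^sup>2) * (v \<bullet> (v /\<^sub>R norm v))" using v by metis
  have "v \<bullet> (v /\<^sub>R norm v) = norm v" using v by (simp add: dot_square_norm power2_eq_square)
  then have v\<mu>: "v \<bullet> \<mu> = 2 * r / (1 + r\<^sup>2) * norm v" using \<mu> by simp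
  have "\<kappa> * r < norm v"
  proof -
    have "r * \<kappa> \<le> r * \<bar>\<kappa>\<bar>" using r by (intro mult_left_mono) auto
    moreover have "r * \<bar>\<kappa>\<bar> + r \<le> norm v" using r\<kappa> by (simp add: distrib_left)
    ultimately have "r * \<kappa> < norm v" using r(1) by linarith
    then show ?thesis by (simp add: mult.commute)
  qed
  then have "2 * r / (1 + r\<^sup>2) * (\<kappa> * r) < 2 * r / (1 + r\<^sup>2) * norm v"
    using r p by (intro mult_strict_left_mono) auto
  then have "\<kappa> * (1 - \<zeta> \<bullet> \<mu>) < v \<bullet> \<mu>" unfolding v\<mu> \<mu>(2) by (simp add: power2_eq_square mult_ac)
  moreover have "dist \<mu> \<zeta> < \<epsilon>"
  proof -
    have "(dist \<mu> \<zeta>)\<^sup>2 = 2 * (1 - \<zeta> \<bullet> \<mu>)"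
      using \<mu>(1) \<zeta> by (rule unit_dist_sq)
    also have "\<dots> = 4 * r\<^sup>2 / (1 + r\<^sup>2)" unfolding \<mu>(2) by simp
    also have "\<dots> \<le> 4 * r\<^sup>2 / 1" using p by (intro divide_left_mono) auto
    also have "\<dots> = (2 * r)\<^sup>2" by (simp add: power2_eq_square)
    finally have "dist \<mu> \<zeta> \<le> 2 * r" by (rule power2_le_imp_le) (use r in simp)
    then show ?thesis using r \<epsilon> by simp
  qed
  ultimately show "\<exists>y\<in>{\<mu> \<in> sphere 0 1. \<kappa> * (1 - \<zeta> \<bullet> \<mu>) < v \<bullet> \<mu>}. dist y \<zeta> < \<epsilon>"
    using \<mu>(1) by auto
qed

text \<open>To first order at \<open>\<zeta>\<close>, \<open>inn\<close> says that no direction has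
  positive product with \<open>v\<close> and negative product with \<open>\<nu>\<close>, which
  forces the normals to agree; the curvature terms are of second order. This identifies the
  direction of a touching ball with that of a touching cap.\<close>

lemma touching_normals:
  fixes \<zeta> v \<nu> :: "real ^ 'n"
  assumes \<zeta>: "norm \<zeta> = 1" and v: "v \<bullet> \<zeta> = 0" and \<nu>: "norm \<nu> = 1" "\<nu> \<bullet> \<zeta> = 0"
    and inn: "\<And>\<mu>. norm \<mu> = 1 \<Longrightarrow> \<kappa> * (1 - \<zeta> \<bullet> \<mu>) < v \<bullet> \<mu> \<Longrightarrow> - (\<nu> \<bullet> \<mu>) \<le> S * (1 - \<zeta> \<bullet> \<mu>)"
  shows "v = norm v *\<^sub>R \<nu>"
proof (rule ccontr)
  assume ne: "v \<noteq> norm v *\<^sub>R \<nu>"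
  define d where "d = norm v - v \<bullet> \<nu>"
  have "v \<bullet> \<nu> \<noteq> norm v" using norm_cauchy_schwarz_eq[of v \<nu>] \<nu> ne by auto
  then have d: "d > 0" using norm_cauchy_schwarz[of v \<nu>] \<nu> by (simp add: d_def)
  \<comment> \<open>If the normals differed, this tangent direction would satisfy
    \<open>v \<bullet> e > 0\<close> and \<open>\<nu> \<bullet> e < 0\<close>.\<close>
  define e where "e = (v - norm v *\<^sub>R \<nu>) /\<^sub>R norm (v - norm v *\<^sub>R \<nu>)"
  define q where "q = norm (v - norm v *\<^sub>R \<nu>)"
  have q: "q > 0" using ne by (simp add: q_def)
  have e: "norm e = 1" "e \<bullet> \<zeta> = 0" using ne v \<nu> by (auto simp: e_def inner_diff_left)
  have v0: "norm v > 0" using ne by auto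
  have ve: "v \<bullet> e = norm v * d / q"
    unfolding e_def q_def[symmetric] d_def
    by (simp add: inner_diff_right dot_square_norm power2_eq_square algebra_simps divide_inverse)
  have \<nu>e: "\<nu> \<bullet> e = - d / q"
    unfolding e_def q_def[symmetric] d_def
    using \<nu> by (simp add: inner_diff_right dot_square_norm inner_commute divide_inverse algebra_simps)
  define A where "A = min (norm v * d / q) (d / q)"
  have A: "A > 0" using d q v0 by (simp add: A_def)
  \<comment> \<open>Small enough that the first-order margin \<open>A\<close> exceeds both
    \<open>r * \<kappa>\<close> and \<open>r * S\<close>.\<close>
  define r where "r = A / (\<bar>\<kappa>\<bar> + \<bar>S\<bar> + 1)"
  have r: "r > 0" using A by (simp add: r_def)
  have "r * (\<bar>\<kappa>\<bar> + \<bar>S\<bar> + 1) = A" by (simp add: r_def)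
  then have rA: "r * \<bar>\<kappa>\<bar> + r * \<bar>S\<bar> + r = A" by (simp add: algebra_simps)
  have p: "2 * r / (1 + r\<^sup>2) > 0" using r by (simp add: add_pos_nonneg)
  obtain \<mu> where \<mu>: "norm \<mu> = 1" "1 - \<zeta> \<bullet> \<mu> = 2 * r\<^sup>2 / (1 + r\<^sup>2)"
    "v \<bullet> \<mu> = 2 * r / (1 + r\<^sup>2) * (v \<bullet> e)" "\<nu> \<bullet> \<mu> = 2 * r / (1 + r\<^sup>2) * (\<nu> \<bullet> e)"
    using great_circle_point[OF \<zeta> e, of r] v \<nu> by metis
  have eq: "K * (1 - \<zeta> \<bullet> \<mu>) = 2 * r / (1 + r\<^sup>2) * (r * K)" for K
    unfolding \<mu>(2) by (simp add: power2_eq_square)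
  have abs: "r * K \<le> r * \<bar>K\<bar>" "0 \<le> r * \<bar>K\<bar>" for K :: real using r by (auto intro: mult_left_mono)
  have "r * \<kappa> < v \<bullet> e" unfolding ve using rA r abs[of \<kappa>] abs[of S] min.cobounded1[of "norm v * d / q" "d / q"]
    unfolding A_def by linarith
  then have "\<kappa> * (1 - \<zeta> \<bullet> \<mu>) < v \<bullet> \<mu>" unfolding eq \<mu>(3) using p by (rule mult_strict_left_mono)
  then have "- (\<nu> \<bullet> \<mu>) \<le> S * (1 - \<zeta> \<bullet> \<mu>)" using inn \<mu>(1) by blast
  moreover have "r * S < - (\<nu> \<bullet> e)" unfolding \<nu>e using rA r abs[of \<kappa>] abs[of S] min.cobounded2[of "norm v * d / q" "d / q"]
    unfolding A_def minus_divide_left minus_minus by linarith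
  then have "S * (1 - \<zeta> \<bullet> \<mu>) < - (\<nu> \<bullet> \<mu>)"
    unfolding eq \<mu>(4) minus_mult_right using p by (rule mult_strict_left_mono)
  ultimately show False by simp
qed

text \<open>Dictionary between two descriptions of a cap: by a boundary point
  \<open>\<zeta>\<close>, inward normal \<open>\<nu>\<close> and curvature \<open>S\<close>, or by
  its centre \<open>a\<close>.\<close>

lemma cap_from_touching:
  fixes \<zeta> \<nu> :: "real ^ 'n" and S :: real
  assumes "norm \<zeta> = 1" "norm \<nu> = 1" "\<nu> \<bullet> \<zeta> = 0"
  defines "a \<equiv> (\<nu> - S *\<^sub>R \<zeta>) /\<^sub>R sqrt (1 + S\<^sup>2)"
  shows "norm a = 1" "axial S a \<mu> 1 = \<nu> \<bullet> \<mu> + S * (1 - \<zeta> \<bullet> \<mu>)"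
proof -
  have "(norm (\<nu> - S *\<^sub>R \<zeta>))\<^sup>2 = 1 + S\<^sup>2"
  proof -
    have "\<zeta> \<bullet> \<zeta> = 1" "\<nu> \<bullet> \<nu> = 1" using assms by (auto simp: dot_square_norm)
    then show ?thesis unfolding power2_norm_eq_inner using assms(3)
      by (simp add: inner_diff_left inner_diff_right inner_commute power2_eq_square)
  qed
  then have "norm (\<nu> - S *\<^sub>R \<zeta>) = sqrt (1 + S\<^sup>2)" by (metis norm_ge_zero real_sqrt_unique)
  then show "norm a = 1" using sqrt_1_pos[of S] by (simp add: a_def)
  have "sqrt (1 + S\<^sup>2) \<noteq> 0" using sqrt_1_pos[of S] by linarith
  then show "axial S a \<mu> 1 = \<nu> \<bullet> \<mu> + S * (1 - \<zeta> \<bullet> \<mu>)"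
    unfolding axial_def a_def by (simp add: inner_diff_left algebra_simps)
qed

context
  fixes F :: "(real ^ 'n) set" and S :: real
  assumes n: "CARD('n) \<ge> 2" and F: "F \<noteq> {}" "closed F" "F \<subseteq> sphere 0 1" "F \<noteq> sphere 0 1"
    and S: "0 \<le> S" and touch: "touching_caps F S"
begin

text \<open>The sphere is connected in dimension at least 2, so it is not a disjoint union of
  \<open>F\<close> and the closure of its complement.\<close>

lemma boundary_point_exists: "\<exists>\<zeta>. \<zeta> \<in> F \<inter> closure (sphere 0 1 - F)"
proof (rule ccontr)
  assume "\<not> ?thesis"
  then have dis: "F \<inter> closure (sphere 0 1 - F) = {}" by auto
  have "connected (sphere (0 :: real ^ 'n) 1)" using n by (intro connected_sphere) simp
  moreover have "closed (closure (sphere 0 1 - F))" by simp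
  moreover have "sphere 0 1 \<subseteq> F \<union> closure (sphere 0 1 - F)"
    using closure_subset[of "sphere 0 1 - F"] by blast
  moreover have "F \<inter> closure (sphere 0 1 - F) \<inter> sphere 0 1 = {}" using dis by auto
  moreover have "F \<inter> sphere 0 1 \<noteq> {}" using F by auto
  moreover have "closure (sphere 0 1 - F) \<inter> sphere 0 1 \<noteq> {}"
    using F closure_subset[of "sphere 0 1 - F"] by blast
  ultimately show False using F(2) unfolding connected_closed by blast
qed

text \<open>If \<open>\<xi>\<close> is far from the complement of \<open>F\<close>, centre the cap at \<open>\<xi>\<close>. Otherwise the largest ball
  around \<open>\<xi>\<close> inside \<open>F\<close> touches the boundary at a point \<open>\<zeta>\<close>, so that \<open>\<xi>\<close> lies on the normal at \<open>\<zeta>\<close>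
  and in the interior touching cap.\<close>

lemma inscribed_cap:
  assumes \<xi>: "\<xi> \<in> F"
  shows "\<exists>a. norm a = 1 \<and> \<xi> \<in> cap (- S) a \<and> cap (- S) a \<subseteq> F"
proof -
  define M where "M = closure (sphere 0 1 - F)"
  have M: "closed M" "M \<subseteq> sphere 0 1" "M \<noteq> {}" "sphere 0 1 - M \<subseteq> F"
  proof -
    show "M \<subseteq> sphere 0 1" unfolding M_def by (rule closure_minimal) auto
    show "M \<noteq> {}" using F by (auto simp: M_def)
    show "sphere 0 1 - M \<subseteq> F" using closure_subset[of "sphere 0 1 - F"] unfolding M_def by blast
  qed (simp add: M_def)
  have n\<xi>: "norm \<xi> = 1" using \<xi> F by auto
  define C where "C = sqrt (1 + S\<^sup>2)"
  have C: "C > 0" "C * C = 1 + S * S" "\<bar>S\<bar> < C"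
    unfolding C_def by (rule sqrt_1_pos sqrt_1_sq abs_less_sqrt_1)+
  obtain \<zeta> where \<zeta>: "\<zeta> \<in> M" "\<And>\<mu>. \<mu> \<in> M \<Longrightarrow> \<xi> \<bullet> \<mu> \<le> \<xi> \<bullet> \<zeta>"
    using support_fun_attained[OF M(3,1,2), of \<xi>] by metis
  then have n\<zeta>: "norm \<zeta> = 1" using M by auto
  define c where "c = \<zeta> \<bullet> \<xi>"
  show ?thesis
  \<comment> \<open>\<open>S / C\<close> is the cosine of the radius of a cap of parameter
    \<open>- S\<close>, and \<open>c\<close> that of the distance from \<open>\<xi>\<close> to the
    complement.\<close>
  proof (cases "c < S / C")
    case True
    have "cap (- S) \<xi> \<subseteq> F"
    proof
      fix \<mu> assume "\<mu> \<in> cap (- S) \<xi>"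
      then have "norm \<mu> = 1" "S / C \<le> \<xi> \<bullet> \<mu>" using C by (auto simp: cap_def axial_def field_simps simp flip: C_def)
      then have "\<mu> \<notin> M" using \<zeta>(2)[of \<mu>] True by (auto simp: c_def inner_commute)
      then show "\<mu> \<in> F" using M(4) \<open>norm \<mu> = 1\<close> by auto
    qed
    moreover have "\<xi> \<in> cap (- S) \<xi>" using n\<xi> C by (simp add: cap_def axial_def dot_square_norm flip: C_def)
    ultimately show ?thesis using n\<xi> by blast
  next
    case False
    \<comment> \<open>Tangent direction at \<open>\<zeta>\<close> pointing to \<open>\<xi>\<close>.
      Relative to \<open>\<zeta>\<close> the open ball \<open>\<xi> \<bullet> \<mu> > c\<close> is a
      cap with normal \<open>v\<close> and curvature \<open>c\<close>, up to normalisation.\<close>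
    define v where "v = \<xi> - c *\<^sub>R \<zeta>"
    note v = tangential_part[OF n\<xi> n\<zeta>, folded c_def, folded v_def]
    have side: "\<mu> \<in> F" if "norm \<mu> = 1" "c * (1 - \<zeta> \<bullet> \<mu>) < v \<bullet> \<mu>" for \<mu>
    proof -
      have "\<xi> \<bullet> \<mu> > c" using that(2) by (simp add: v_def inner_diff_left algebra_simps)
      then have "\<mu> \<notin> M" using \<zeta>(2)[of \<mu>] by (auto simp: c_def inner_commute)
      then show ?thesis using M(4) that by auto
    qed
    \<comment> \<open>So far \<open>\<zeta>\<close> is only a limit of points outside
      \<open>F\<close>. Either it equals \<open>\<xi>\<close>, or it is a limit of points of the
      ball around \<open>\<xi>\<close>.\<close>
    have "\<zeta> \<in> F"
    proof (cases "v = 0")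
      case True
      then have "1 - c\<^sup>2 = 0" using v by simp
      moreover have "c \<ge> 0" using False S C by (meson divide_nonneg_pos linorder_not_less order_trans)
      ultimately have "c = 1" by (simp add: power2_eq_1_iff)
      then show ?thesis using inner_eq_1[OF n\<zeta> n\<xi>] \<xi> by (simp add: c_def)
    next
      case False
      have "\<zeta> \<in> closure F"
        using cap_side_closure[OF n\<zeta> False v(1), of c] side
        by (rule_tac subsetD[OF closure_mono]) auto
      then show ?thesis using F by simp
    qed
    then obtain \<nu> where \<nu>: "norm \<nu> = 1" "\<nu> \<bullet> \<zeta> = 0"
      "\<And>\<mu>. norm \<mu> = 1 \<Longrightarrow> S * (1 - \<zeta> \<bullet> \<mu>) \<le> \<nu> \<bullet> \<mu> \<Longrightarrow> \<mu> \<in> F"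
      "\<And>\<mu>. \<mu> \<in> F \<Longrightarrow> - (\<nu> \<bullet> \<mu>) \<le> S * (1 - \<zeta> \<bullet> \<mu>)"
      using touch \<zeta>(1) unfolding touching_caps_def touched_at_def M_def by fastforce
    have v\<nu>: "v = norm v *\<^sub>R \<nu>"
      by (rule touching_normals[OF n\<zeta> v(1) \<nu>(1,2)]) (use side \<nu>(4) in blast)
    have "\<nu> \<bullet> \<nu> = 1" using \<nu> by (simp add: dot_square_norm)
    then have "\<nu> \<bullet> v = norm v" by (metis inner_scaleR_right mult.right_neutral v\<nu>)
    moreover have "\<xi> = v + c *\<^sub>R \<zeta>" by (simp add: v_def)
    ultimately have \<nu>\<xi>: "\<nu> \<bullet> \<xi> = sqrt (1 - c\<^sup>2)" using \<nu>(2) v(2) by (simp add: inner_add_right)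
    have c1: "c \<le> 1" using inner_le_1[OF n\<zeta> n\<xi>] by (simp add: c_def)
    \<comment> \<open>This is membership of \<open>\<xi>\<close> in the touching cap. Squared, it
      reads \<open>S^2 (1 - c) \<le> 1 + c\<close>, which follows from
      \<open>S^2 \<le> S C \<le> c C^2\<close>.\<close>
    have key: "S * (1 - c) \<le> sqrt (1 - c\<^sup>2)"
    proof (rule real_le_rsqrt)
      have "S * S \<le> C * S" using C S by (intro mult_right_mono) auto
      also have "\<dots> = (S / C) * (C * C)" using C(1) by simp
      also have "\<dots> \<le> c * (C * C)" using False C by (intro mult_right_mono) auto
      also have "\<dots> = c * (1 + S * S)" using C by simp
      finally have "S * S * (1 - c) \<le> 1 + c" by (simp add: algebra_simps)
      then have "(1 - c) * (S * S * (1 - c)) \<le> (1 - c) * (1 + c)" using c1 by (intro mult_left_mono) auto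
      then show "(S * (1 - c))\<^sup>2 \<le> 1 - c\<^sup>2" by (simp add: power2_eq_square algebra_simps)
    qed
    define a where "a = (\<nu> - (- S) *\<^sub>R \<zeta>) /\<^sub>R sqrt (1 + (- S)\<^sup>2)"
    note a = cap_from_touching[OF n\<zeta> \<nu>(1,2), of "- S", folded a_def]
    have "\<xi> \<in> cap (- S) a"
      using n\<xi> key \<nu>\<xi> unfolding cap_def a(2) by (simp add: c_def)
    moreover have "cap (- S) a \<subseteq> F"
      using \<nu>(3) unfolding cap_def a(2) by auto
    ultimately show ?thesis using a(1) by blast
  qed
qed

lemma circumscribed_cap_exists: "\<exists>b. norm b = 1 \<and> F \<subseteq> cap S b"
proof -
  obtain \<zeta> where \<zeta>: "\<zeta> \<in> F \<inter> closure (sphere 0 1 - F)" using boundary_point_exists by auto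
  then obtain \<nu> where \<nu>: "norm \<nu> = 1" "\<nu> \<bullet> \<zeta> = 0" "\<And>\<mu>. \<mu> \<in> F \<Longrightarrow> - (\<nu> \<bullet> \<mu>) \<le> S * (1 - \<zeta> \<bullet> \<mu>)"
    using touch unfolding touching_caps_def touched_at_def by blast
  have "norm \<zeta> = 1" using \<zeta> F by auto
  note b = cap_from_touching[OF this \<nu>(1,2), of S]
  have "F \<subseteq> cap S ((\<nu> - S *\<^sub>R \<zeta>) /\<^sub>R sqrt (1 + S\<^sup>2))"
    using F \<nu>(3) unfolding cap_def b(2) by fastforce
  then show ?thesis using b(1) by blast
qed

text \<open>The same argument from the outside. When \<open>e\<close> is far from \<open>F\<close>, the cap is the complement of the
  largest ball around \<open>e\<close> that misses \<open>F\<close>; it is not too small because \<open>F\<close> contains a cap.\<close>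

lemma circumscribed_cap_unit:
  assumes e: "norm e = 1"
  shows "\<exists>b S'. norm b = 1 \<and> \<bar>S'\<bar> \<le> S \<and> F \<subseteq> cap S' b \<and> (\<forall>\<mu>\<in>cap S' b. e \<bullet> \<mu> \<le> support_fun F e)"
proof -
  obtain \<zeta> where \<zeta>: "\<zeta> \<in> F" "support_fun F e = e \<bullet> \<zeta>" "\<And>\<mu>. \<mu> \<in> F \<Longrightarrow> e \<bullet> \<mu> \<le> support_fun F e"
    using support_fun_attained[OF F(1-3)] by blast
  define c where "c = \<zeta> \<bullet> e"
  have sup: "support_fun F e = c" using \<zeta> by (simp add: c_def inner_commute)
  have n\<zeta>: "norm \<zeta> = 1" using \<zeta> F by auto
  have c1: "c \<le> 1" using inner_le_1[OF n\<zeta> e] by (simp add: c_def)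
  define v where "v = e - c *\<^sub>R \<zeta>"
  note v = tangential_part[OF e n\<zeta>, folded c_def, folded v_def]
  \<comment> \<open>\<open>c\<close> is the cosine of the distance from \<open>e\<close> to
    \<open>F\<close>. In the middle case the complement of the ball around \<open>e\<close> has
    parameter \<open>c / sqrt (1 - c^2) < S\<close>. In the last case this would be too large, and
    the exterior touching cap at \<open>\<zeta>\<close> is used; the inequality then absorbs its
    tangential excess. For \<open>c = 1\<close> the support bound is trivial.\<close>
  consider "c = 1" | "c < 1" "c < S * sqrt (1 - c\<^sup>2)" | "c < 1" "S * sqrt (1 - c\<^sup>2) \<le> c"
    using c1 by linarith
  then show ?thesis
  proof cases
    case 1
    obtain b where "norm b = 1" "F \<subseteq> cap S b" using circumscribed_cap_exists by blast
    moreover have "\<forall>\<mu>\<in>cap S b. e \<bullet> \<mu> \<le> 1" using inner_le_1[OF e] by (auto simp: cap_def)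
    ultimately show ?thesis using S 1 sup by (intro exI[of _ b] exI[of _ S]) auto
  next
    case 2
    obtain a where a: "norm a = 1" "cap (- S) a \<subseteq> F" using inscribed_cap F(1) by blast
    define C where "C = sqrt (1 + S\<^sup>2)"
    have C: "C > 0" "C * C = 1 + S * S" "\<bar>S\<bar> < C"
      unfolding C_def by (rule sqrt_1_pos sqrt_1_sq abs_less_sqrt_1)+
    have aa: "a \<bullet> a = 1" using a by (simp add: dot_square_norm)
    \<comment> \<open>Otherwise \<open>F\<close> would consist of \<open>- e\<close> alone, whereas
      an inscribed cap contains its centre and also a boundary point \<open>\<mu>\<close>.\<close>
    have c_gt: "c > - 1"
    proof (rule ccontr)
      assume "\<not> - 1 < c"
      then have only: "\<mu> = - e" if "\<mu> \<in> F" for \<mu>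
        using \<zeta>(3)[OF that] sup that F(3) e inner_le_1(2)[OF e, of \<mu>] inner_eq_1[of "- e" \<mu>] by force
      obtain w where w: "norm w = 1" "a \<bullet> w = 0" using unit_orthogonal_exists[OF n] .
      have w': "w \<bullet> w = 1" "w \<bullet> a = 0" using w by (auto simp: dot_square_norm inner_commute)
      define \<mu> where "\<mu> = (S / C) *\<^sub>R a + (1 / C) *\<^sub>R w"
      have "\<mu> \<bullet> \<mu> = (S * S + 1) / (C * C)"
        by (simp add: \<mu>_def inner_add_left inner_add_right aa w w' add_divide_distrib)
      also have "S * S + 1 = C * C" using C(2) by simp
      also have "C * C / (C * C) = 1" using C(1) by simp
      finally have "norm \<mu> = 1" by (simp add: norm_eq_1)
      moreover have a\<mu>: "a \<bullet> \<mu> = S / C" by (simp add: \<mu>_def inner_add_right aa w)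
      ultimately have "\<mu> \<in> cap (- S) a" using C by (simp add: cap_def axial_def flip: C_def)
      moreover have "a \<in> cap (- S) a" using C a by (simp add: cap_def axial_def aa flip: C_def)
      ultimately have "\<mu> = a" using only a(2) by blast
      then show False using a\<mu> aa C by simp
    qed
    define q where "q = sqrt (1 - c\<^sup>2)"
    have "c\<^sup>2 < 1" using c_gt 2(1) by (simp add: abs_square_less_1)
    then have q: "q > 0" "q\<^sup>2 = 1 - c\<^sup>2" by (auto simp: q_def)
    define S' where "S' = c / q"
    have "1 + S'\<^sup>2 = (q\<^sup>2 + c\<^sup>2) / q\<^sup>2" using q(1) by (simp add: S'_def power_divide field_simps)
    also have "\<dots> = (1 / q)\<^sup>2" using q(2) by (simp add: power_divide)
    finally have sq: "sqrt (1 + S'\<^sup>2) = 1 / q" using q by simp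
    have ax: "axial S' (- e) \<mu> 1 = (c - e \<bullet> \<mu>) / q" for \<mu>
      unfolding axial_def sq by (simp add: S'_def diff_divide_distrib)
    have sub: "F \<subseteq> cap S' (- e)"
      using F(3) \<zeta>(3) q sup unfolding cap_def ax by fastforce
    \<comment> \<open>Parameters are monotone under inclusion, and the inscribed cap lies in
      \<open>F\<close>, hence in the new cap.\<close>
    have "- S \<le> S'"
      by (rule cap_subset_causal(1)[OF n a(1), of "- e"]) (use e a(2) sub in auto)
    moreover have "S' \<le> S" using 2(2) q unfolding S'_def q_def[symmetric] by (simp add: pos_divide_le_eq)
    moreover have "\<forall>\<mu>\<in>cap S' (- e). e \<bullet> \<mu> \<le> support_fun F e"
      using q sup unfolding cap_def ax by (auto simp: zero_le_divide_iff)
    ultimately show ?thesis using sub e by (intro exI[of _ "- e"] exI[of _ S']) auto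
  next
    case 3
    have "c \<ge> 0"
    proof -
      have "\<bar>c\<bar> \<le> 1" using inner_le_1[OF n\<zeta> e] by (simp add: c_def)
      then have "0 \<le> S * sqrt (1 - c\<^sup>2)" using S by (simp add: abs_square_le_1)
      then show ?thesis using 3 by simp
    qed
    then have "c\<^sup>2 < 1" using 3(1) by (simp add: abs_square_less_1)
    then have v0: "v \<noteq> 0" using v(2) by auto
    have side: "\<mu> \<notin> F" if "norm \<mu> = 1" "c * (1 - \<zeta> \<bullet> \<mu>) < v \<bullet> \<mu>" for \<mu>
    proof -
      have "e \<bullet> \<mu> > c" using that(2) by (simp add: v_def inner_diff_left algebra_simps)
      then show ?thesis using \<zeta>(3)[of \<mu>] sup by auto
    qed
    have "\<zeta> \<in> closure (sphere 0 1 - F)"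
      using cap_side_closure[OF n\<zeta> v0 v(1), of c] side
      by (rule_tac subsetD[OF closure_mono]) auto
    then obtain \<nu> where \<nu>: "norm \<nu> = 1" "\<nu> \<bullet> \<zeta> = 0"
      "\<And>\<mu>. norm \<mu> = 1 \<Longrightarrow> S * (1 - \<zeta> \<bullet> \<mu>) \<le> \<nu> \<bullet> \<mu> \<Longrightarrow> \<mu> \<in> F"
      "\<And>\<mu>. \<mu> \<in> F \<Longrightarrow> - (\<nu> \<bullet> \<mu>) \<le> S * (1 - \<zeta> \<bullet> \<mu>)"
      using touch \<zeta>(1) unfolding touching_caps_def touched_at_def by fastforce
    have v\<nu>: "v = norm v *\<^sub>R (- \<nu>)"
    proof (rule touching_normals[OF n\<zeta> v(1)])
      fix \<mu> :: "real ^ 'n" assume "norm \<mu> = 1" "c * (1 - \<zeta> \<bullet> \<mu>) < v \<bullet> \<mu>"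
      then show "- (- \<nu> \<bullet> \<mu>) \<le> S * (1 - \<zeta> \<bullet> \<mu>)" using side \<nu>(3)[of \<mu>] by force
    qed (use \<nu> in auto)
    define b where "b = (\<nu> - S *\<^sub>R \<zeta>) /\<^sub>R sqrt (1 + S\<^sup>2)"
    note b = cap_from_touching[OF n\<zeta> \<nu>(1,2), of S, folded b_def]
    have "F \<subseteq> cap S b"
    proof
      fix \<mu> assume "\<mu> \<in> F"
      then show "\<mu> \<in> cap S b" using F(3) \<nu>(4)[of \<mu>] unfolding cap_def b(2) by auto
    qed
    moreover have "e \<bullet> \<mu> \<le> c" if "\<mu> \<in> cap S b" for \<mu>
    proof -
      have \<mu>: "norm \<mu> = 1" "- (\<nu> \<bullet> \<mu>) \<le> S * (1 - \<zeta> \<bullet> \<mu>)" using that unfolding cap_def b(2) by auto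
      have "e = c *\<^sub>R \<zeta> + v" by (simp add: v_def)
      then have "e \<bullet> \<mu> = c * (\<zeta> \<bullet> \<mu>) + v \<bullet> \<mu>" by (simp add: inner_add_left)
      also have "v \<bullet> \<mu> = norm v * (- (\<nu> \<bullet> \<mu>))" by (subst v\<nu>) simp
      also have "\<dots> \<le> norm v * (S * (1 - \<zeta> \<bullet> \<mu>))" using \<mu> by (intro mult_left_mono) auto
      also have "\<dots> = (S * sqrt (1 - c\<^sup>2)) * (1 - \<zeta> \<bullet> \<mu>)" unfolding v(2) by simp
      also have "\<dots> \<le> c * (1 - \<zeta> \<bullet> \<mu>)" using 3 inner_le_1[OF n\<zeta> \<mu>(1)] by (intro mult_right_mono) auto
      finally show ?thesis by (simp add: algebra_simps)
    qed
    ultimately show ?thesis using b(1) S sup by (intro exI[of _ b] exI[of _ S]) auto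
  qed
qed

lemma circumscribed_cap:
  "\<exists>b S'. norm b = 1 \<and> \<bar>S'\<bar> \<le> S \<and> F \<subseteq> cap S' b \<and> (\<forall>\<mu>\<in>cap S' b. x \<bullet> \<mu> \<le> support_fun F x)"
proof (cases "x = 0")
  case True
  obtain b where "norm b = 1" "F \<subseteq> cap S b" using circumscribed_cap_exists by blast
  moreover have "support_fun F x = 0" using True support_fun_attained[OF F(1-3), of x] by auto
  ultimately show ?thesis using S True by (intro exI[of _ b] exI[of _ S]) auto
next
  case False
  define e where "e = x /\<^sub>R norm x"
  have e: "norm e = 1" using False by (simp add: e_def)
  obtain b S' where b: "norm b = 1" "\<bar>S'\<bar> \<le> S" "F \<subseteq> cap S' b" "\<And>\<mu>. \<mu> \<in> cap S' b \<Longrightarrow> e \<bullet> \<mu> \<le> support_fun F e"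
    using circumscribed_cap_unit[OF e] by blast
  have x: "x = norm x *\<^sub>R e" using False by (simp add: e_def)
  obtain \<zeta> where \<zeta>: "\<zeta> \<in> F" "support_fun F e = e \<bullet> \<zeta>" using support_fun_attained[OF F(1-3)] by blast
  have "x \<bullet> \<zeta> \<le> support_fun F x" using support_fun_attained[OF F(1-3), of x] \<zeta>(1) by blast
  moreover have "x \<bullet> \<mu> \<le> x \<bullet> \<zeta>" if "\<mu> \<in> cap S' b" for \<mu>
    using b(4)[OF that] \<zeta>(2) by (subst (1 2) x) (simp add: mult_left_mono)
  ultimately show ?thesis using b by (meson order_trans)
qed

end

section \<open>Admissible sets have touching caps\<close>

text \<open>Both touching caps shrink as \<open>S\<close> grows, because
  \<open>1 - \<zeta> \<bullet> \<mu> \<ge> 0\<close>.\<close>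

lemma touched_at_mono:
  assumes "touched_at F S \<zeta>" "S \<le> S'" "norm \<zeta> = 1" "F \<subseteq> sphere 0 1"
  shows "touched_at F S' \<zeta>"
proof -
  have le: "S * (1 - \<zeta> \<bullet> \<mu>) \<le> S' * (1 - \<zeta> \<bullet> \<mu>)" if "\<mu> \<in> sphere 0 1" for \<mu>
    using inner_le_1[OF assms(3), of \<mu>] that assms(2) by (intro mult_right_mono) auto
  obtain \<nu> where \<nu>: "norm \<nu> = 1" "\<nu> \<bullet> \<zeta> = 0"
    "\<And>\<mu>. \<mu> \<in> sphere 0 1 \<Longrightarrow> S * (1 - \<zeta> \<bullet> \<mu>) \<le> \<nu> \<bullet> \<mu> \<Longrightarrow> \<mu> \<in> F"
    "\<And>\<mu>. \<mu> \<in> F \<Longrightarrow> - (\<nu> \<bullet> \<mu>) \<le> S * (1 - \<zeta> \<bullet> \<mu>)"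
    using assms(1) unfolding touched_at_def by blast
  then show ?thesis
    unfolding touched_at_def using le assms(4) by (intro exI[of _ \<nu>]) (meson order_trans subsetD)
qed

lemma finite_uniform_bound:
  fixes P :: "'a \<Rightarrow> real \<Rightarrow> bool"
  assumes "finite A" and "\<And>x. x \<in> A \<Longrightarrow> \<exists>s. P x s"
    and mono: "\<And>x s s'. x \<in> A \<Longrightarrow> P x s \<Longrightarrow> s \<le> s' \<Longrightarrow> P x s'"
  shows "\<exists>s\<ge>0. \<forall>x\<in>A. P x s"
proof -
  obtain g where g: "\<And>x. x \<in> A \<Longrightarrow> P x (g x)" using assms(2) by metis
  define s where "s = (\<Sum>x\<in>A. \<bar>g x\<bar>)"
  have "g x \<le> s" if "x \<in> A" for x
  proof -
    have "\<bar>g x\<bar> \<le> s" unfolding s_def by (rule member_le_sum) (use that assms(1) in auto)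
    then show ?thesis by simp
  qed
  then have "\<forall>x\<in>A. P x s" using g mono by blast
  moreover have "s \<ge> 0" by (simp add: s_def sum_nonneg)
  ultimately show ?thesis by blast
qed

text \<open>The relative boundary is compact, so finitely many local values of \<open>S\<close>
  suffice, and \<open>touched_at_mono\<close> allows passing to a common larger one.\<close>

lemma touching_caps_local:
  assumes F: "closed F" "F \<subseteq> sphere 0 1"
    and loc: "\<And>p. p \<in> F \<inter> closure (sphere 0 1 - F) \<Longrightarrow>
      \<exists>r>0. \<exists>S. \<forall>\<zeta> \<in> F \<inter> closure (sphere 0 1 - F) \<inter> ball p r. touched_at F S \<zeta>"
  shows "\<exists>S\<ge>0. touching_caps F S"
proof -
  define B where "B = F \<inter> closure (sphere 0 1 - F)"
  have "bounded F" using F(2) bounded_sphere bounded_subset by blast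
  then have B: "compact B" unfolding B_def using F(1) by (auto simp: compact_eq_bounded_closed bounded_Int)
  obtain r where r: "\<And>p. p \<in> B \<Longrightarrow> r p > 0 \<and> (\<exists>S. \<forall>\<zeta> \<in> B \<inter> ball p (r p). touched_at F S \<zeta>)"
    using loc unfolding B_def by metis
  obtain D where D: "D \<subseteq> B" "finite D" "B \<subseteq> (\<Union>p\<in>D. ball p (r p))"
  proof (rule compactE_image[OF B, of B "\<lambda>p. ball p (r p)"])
    show "B \<subseteq> (\<Union>p\<in>B. ball p (r p))"
    proof
      fix p assume "p \<in> B"
      then show "p \<in> (\<Union>p\<in>B. ball p (r p))" using r[of p] by (intro UN_I[of p]) auto
    qed
  qed auto
  have B1: "norm \<zeta> = 1" if "\<zeta> \<in> B" for \<zeta> using that F(2) by (auto simp: B_def)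
  have "\<exists>s\<ge>0. \<forall>p\<in>D. \<forall>\<zeta> \<in> B \<inter> ball p (r p). touched_at F s \<zeta>"
  proof (rule finite_uniform_bound[OF D(2)])
    fix p assume "p \<in> D"
    then show "\<exists>s. \<forall>\<zeta> \<in> B \<inter> ball p (r p). touched_at F s \<zeta>" using r D(1) by blast
  next
    fix p s s' assume "\<forall>\<zeta> \<in> B \<inter> ball p (r p). touched_at F s \<zeta>" "(s::real) \<le> s'"
    then show "\<forall>\<zeta> \<in> B \<inter> ball p (r p). touched_at F s' \<zeta>" using touched_at_mono[OF _ _ B1 F(2)] by blast
  qed
  then obtain s where "s \<ge> 0" "\<And>p \<zeta>. p \<in> D \<Longrightarrow> \<zeta> \<in> B \<Longrightarrow> \<zeta> \<in> ball p (r p) \<Longrightarrow> touched_at F s \<zeta>" by blast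
  then show ?thesis using D(3) unfolding touching_caps_def B_def[symmetric] by blast
qed

section \<open>Open sets with C^{1,1} boundary\<close>

lemma differentiable_has_gradient:
  fixes f :: "real ^ 'n \<Rightarrow> real"
  assumes "f differentiable (at x)"
  shows "(f has_derivative (\<lambda>h. gradient f x \<bullet> h)) (at x)"
proof -
  define D where "D = frechet_derivative f (at x)"
  have D: "(f has_derivative D) (at x)" using assms by (simp add: D_def frechet_derivative_works)
  then have lin: "linear D" by (rule has_derivative_linear)
  have "D h = gradient f x \<bullet> h" for h
  proof -
    have "h = (\<Sum>i\<in>UNIV. h $ i *\<^sub>R axis i 1)" by (simp add: basis_expansion flip: scalar_mult_eq_scaleR)
    then have "D h = D (\<Sum>i\<in>UNIV. h $ i *\<^sub>R axis i 1)" by simp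
    also have "\<dots> = (\<Sum>i\<in>UNIV. h $ i * D (axis i 1))"
      by (simp add: linear_sum[OF lin] linear_scale[OF lin])
    also have "\<dots> = gradient f x \<bullet> h"
      by (simp add: gradient_def inner_vec_def D_def mult.commute)
    finally show ?thesis .
  qed
  then have "D = (\<lambda>h. gradient f x \<bullet> h)" by auto
  then show ?thesis using D by simp
qed

text \<open>The mean value inequality on the segment, applied to \<open>f\<close> minus its linear
  part, with the Lipschitz gradient in place of a second derivative.\<close>

lemma gradient_taylor:
  fixes f :: "real ^ 'n \<Rightarrow> real"
  assumes diff: "f differentiable_on UNIV" and L: "L-lipschitz_on K (gradient f)"
    and K: "convex K" "y \<in> K" "z \<in> K"
  shows "\<bar>f y - f z - gradient f z \<bullet> (y - z)\<bar> \<le> L * (norm (y - z))\<^sup>2"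
proof -
  define g where "g w = f w - gradient f z \<bullet> w" for w
  have seg: "closed_segment z y \<subseteq> K" using K by (simp add: closed_segment_subset)
  have L0: "L \<ge> 0" using L lipschitz_on_nonneg by blast
  have "norm (g y - g z) \<le> (L * norm (y - z)) * norm (y - z)"
  proof (rule differentiable_bound[of "closed_segment z y" g "\<lambda>w h. (gradient f w - gradient f z) \<bullet> h"])
    fix w assume w: "w \<in> closed_segment z y"
    have "f differentiable (at w)" using diff by (simp add: differentiable_on_def)
    then show "(g has_derivative (\<lambda>h. (gradient f w - gradient f z) \<bullet> h)) (at w within closed_segment z y)"
      unfolding g_def
      by (auto intro!: derivative_eq_intros has_derivative_at_withinI[OF differentiable_has_gradient]
          simp: inner_diff_left)
    show "onorm (\<lambda>h. (gradient f w - gradient f z) \<bullet> h) \<le> L * norm (y - z)"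
    proof (rule onorm_le)
      fix h
      have "norm ((gradient f w - gradient f z) \<bullet> h) \<le> norm (gradient f w - gradient f z) * norm h"
        by (simp add: Cauchy_Schwarz_ineq2)
      also have "norm (gradient f w - gradient f z) \<le> L * norm (w - z)"
        using lipschitz_onD[OF L, of w z] w seg K by (auto simp: dist_norm)
      also have "norm (w - z) \<le> norm (y - z)"
        using segment_bound1[of w z y] w by (simp add: norm_minus_commute)
      finally show "norm ((gradient f w - gradient f z) \<bullet> h) \<le> L * norm (y - z) * norm h"
        using L0 by (simp add: mult_left_mono mult_right_mono)
    qed
  qed auto
  moreover have "g y - g z = f y - f z - gradient f z \<bullet> (y - z)" by (simp add: g_def inner_diff_right)
  ultimately show ?thesis by (simp add: power2_eq_square mult.assoc)
qed

text \<open>\<open>\<Psi>\<close> is a local defining function of \<open>F\<close>. Its linear part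
  splits into a tangential piece of length \<open>q\<close> with direction \<open>- \<nu>\<close>
  and a radial piece, which on the sphere is of second order. So up to
  \<open>(G + 2 * L) * (1 - \<zeta> \<bullet> \<mu>)\<close> the value \<open>\<Psi> \<mu>\<close>
  is \<open>- q * (\<nu> \<bullet> \<mu>)\<close>.\<close>

lemma touched_at_from_expansion:
  fixes F :: "(real ^ 'n) set" and \<Psi> :: "real ^ 'n \<Rightarrow> real"
  assumes F: "F \<subseteq> sphere 0 1" and \<zeta>: "\<zeta> \<in> F" and r: "r > 0"
    and inn: "\<And>\<mu>. \<mu> \<in> sphere 0 1 \<Longrightarrow> dist \<mu> \<zeta> < r \<Longrightarrow> \<Psi> \<mu> < 0 \<Longrightarrow> \<mu> \<in> F"
    and out: "\<And>\<mu>. \<mu> \<in> F \<Longrightarrow> dist \<mu> \<zeta> < r \<Longrightarrow> \<Psi> \<mu> \<le> 0"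
    and expand: "\<And>\<mu>. \<mu> \<in> sphere 0 1 \<Longrightarrow> \<bar>\<Psi> \<mu> - D \<bullet> (\<mu> - \<zeta>)\<bar> \<le> L * (dist \<mu> \<zeta>)\<^sup>2"
    and D: "norm D \<le> G" "norm (D - (\<zeta> \<bullet> D) *\<^sub>R \<zeta>) \<ge> 1 / 2" and L: "L \<ge> 0"
  shows "touched_at F (2 / r + 2 * (G + 2 * L) + 1) \<zeta>"
proof -
  \<comment> \<open>\<open>2 / r\<close> confines the points in question to the range where
    \<open>\<Psi>\<close> describes \<open>F\<close>; \<open>2 * (G + 2 * L)\<close> beats the
    quadratic error, its factor 2 making up for \<open>q \<ge> 1 / 2\<close>; the 1 gives
    strictness.\<close>
  define S where "S = 2 / r + 2 * (G + 2 * L) + 1"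
  have n\<zeta>: "norm \<zeta> = 1" "\<zeta> \<bullet> \<zeta> = 1" using F \<zeta> by (auto simp: dot_square_norm)
  have G: "G \<ge> 0" using D(1) norm_ge_zero order_trans by blast
  have S: "S > 0" "S > 2 / r" "S > 2 * (G + 2 * L)" using r G L by (auto simp: S_def add_pos_nonneg add_nonneg_pos)
  define d where "d = \<zeta> \<bullet> D"
  define T where "T = D - d *\<^sub>R \<zeta>"
  define q where "q = norm T"
  have q: "q \<ge> 1 / 2" using D(2) by (simp add: q_def T_def d_def)
  have dG: "\<bar>d\<bar> \<le> G" using Cauchy_Schwarz_ineq2[of \<zeta> D] D(1) n\<zeta> by (simp add: d_def)
  define \<nu> where "\<nu> = - T /\<^sub>R q"
  have q0: "q > 0" using q by simp
  have \<nu>1: "norm \<nu> = 1" using q0 by (simp add: \<nu>_def q_def)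
  have "T \<bullet> \<zeta> = 0" unfolding T_def inner_diff_left inner_scaleR_left n\<zeta> d_def by (simp add: inner_commute)
  then have \<nu>\<zeta>: "\<nu> \<bullet> \<zeta> = 0" by (simp add: \<nu>_def)
  have D\<mu>: "D \<bullet> (\<mu> - \<zeta>) = - q * (\<nu> \<bullet> \<mu>) - d * (1 - \<zeta> \<bullet> \<mu>)" for \<mu>
  proof -
    have "D = d *\<^sub>R \<zeta> - q *\<^sub>R \<nu>" using q0 by (simp add: \<nu>_def T_def)
    then have "D \<bullet> \<mu> = (d *\<^sub>R \<zeta> - q *\<^sub>R \<nu>) \<bullet> \<mu>" by (rule arg_cong)
    then have "D \<bullet> \<mu> = - q * (\<nu> \<bullet> \<mu>) + d * (\<zeta> \<bullet> \<mu>)" by (simp add: inner_diff_left)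
    moreover have "D \<bullet> \<zeta> = d" by (simp add: d_def inner_commute)
    ultimately show ?thesis by (simp add: inner_diff_right algebra_simps)
  qed
  have near: "dist \<mu> \<zeta> < r" if \<mu>: "\<mu> \<in> sphere 0 1" and le: "S * (1 - \<zeta> \<bullet> \<mu>) \<le> \<bar>\<nu> \<bullet> \<mu>\<bar>" for \<mu>
  proof (cases "\<mu> = \<zeta>")
    case False
    then have d0: "dist \<mu> \<zeta> > 0" by simp
    have "\<nu> \<bullet> \<mu> = \<nu> \<bullet> (\<mu> - \<zeta>)" by (simp add: inner_diff_right \<nu>\<zeta>)
    then have "\<bar>\<nu> \<bullet> \<mu>\<bar> \<le> dist \<mu> \<zeta>" using Cauchy_Schwarz_ineq2[of \<nu> "\<mu> - \<zeta>"] \<nu>1 by (simp add: dist_norm)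
    moreover have "(dist \<mu> \<zeta>)\<^sup>2 = 2 * (1 - \<zeta> \<bullet> \<mu>)" using unit_dist_sq[of \<mu> \<zeta>] \<mu> n\<zeta> by simp
    then have w: "1 - \<zeta> \<bullet> \<mu> = (dist \<mu> \<zeta>)\<^sup>2 / 2" by simp
    ultimately have "S * ((dist \<mu> \<zeta>)\<^sup>2 / 2) \<le> dist \<mu> \<zeta>" using le by (simp only: w)
    then have "dist \<mu> \<zeta> * (S * dist \<mu> \<zeta>) \<le> dist \<mu> \<zeta> * 2" by (simp add: power2_eq_square algebra_simps)
    then have "S * dist \<mu> \<zeta> \<le> 2" using d0 mult_le_cancel_left_pos by blast
    moreover have "2 < S * r" using S(2) r by (simp add: field_simps)
    ultimately have "S * dist \<mu> \<zeta> < S * r" by simp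
    then show ?thesis using S(1) mult_less_cancel_left_pos by blast
  qed (use r in simp)
  have w0: "0 \<le> 1 - \<zeta> \<bullet> \<mu>" if "\<mu> \<in> sphere 0 1" for \<mu> using inner_le_1[of \<zeta> \<mu>] n\<zeta> that by auto
  have wpos: "0 < 1 - \<zeta> \<bullet> \<mu>" if "\<mu> \<in> sphere 0 1" "\<mu> \<noteq> \<zeta>" for \<mu>
    using w0[OF that(1)] inner_eq_1[of \<zeta> \<mu>] n\<zeta> that by force
  have exp2: "\<bar>\<Psi> \<mu> + q * (\<nu> \<bullet> \<mu>)\<bar> \<le> (G + 2 * L) * (1 - \<zeta> \<bullet> \<mu>)" if \<mu>: "\<mu> \<in> sphere 0 1" for \<mu>
  proof -
    have dd: "(dist \<mu> \<zeta>)\<^sup>2 = 2 * (1 - \<zeta> \<bullet> \<mu>)" using unit_dist_sq[of \<mu> \<zeta>] \<mu> n\<zeta> by simp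
    have "\<bar>\<Psi> \<mu> + q * (\<nu> \<bullet> \<mu>) + d * (1 - \<zeta> \<bullet> \<mu>)\<bar> \<le> L * (2 * (1 - \<zeta> \<bullet> \<mu>))"
      using expand[OF \<mu>] unfolding D\<mu> dd by (simp add: algebra_simps)
    moreover have "\<bar>d * (1 - \<zeta> \<bullet> \<mu>)\<bar> \<le> G * (1 - \<zeta> \<bullet> \<mu>)"
      using dG w0[OF \<mu>] by (simp add: abs_mult mult_right_mono)
    ultimately show ?thesis by (simp add: algebra_simps)
  qed
  have "\<mu> \<in> F" if \<mu>: "\<mu> \<in> sphere 0 1" and le: "S * (1 - \<zeta> \<bullet> \<mu>) \<le> \<nu> \<bullet> \<mu>" for \<mu>
  proof (cases "\<mu> = \<zeta>")
    case False
    have "\<Psi> \<mu> \<le> (G + 2 * L) * (1 - \<zeta> \<bullet> \<mu>) - q * (\<nu> \<bullet> \<mu>)" using exp2[OF \<mu>] by simp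
    also have "\<dots> \<le> (G + 2 * L) * (1 - \<zeta> \<bullet> \<mu>) - 1 / 2 * (S * (1 - \<zeta> \<bullet> \<mu>))"
      using q le S w0[OF \<mu>] by (intro diff_left_mono mult_mono) auto
    also have "\<dots> = (G + 2 * L - S / 2) * (1 - \<zeta> \<bullet> \<mu>)"
      by (simp add: field_simps)
    also have "\<dots> < 0" using S(3) wpos[OF \<mu> False] by (intro mult_neg_pos) auto
    finally have "\<Psi> \<mu> < 0" by simp
    moreover have "dist \<mu> \<zeta> < r" by (rule near[OF \<mu>]) (use le in simp)
    ultimately show ?thesis using inn \<mu> by blast
  qed (use \<zeta> in simp)
  moreover have "- (\<nu> \<bullet> \<mu>) \<le> S * (1 - \<zeta> \<bullet> \<mu>)" if \<mu>F: "\<mu> \<in> F" for \<mu>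
  proof (rule ccontr)
    assume "\<not> - (\<nu> \<bullet> \<mu>) \<le> S * (1 - \<zeta> \<bullet> \<mu>)"
    then have lt: "S * (1 - \<zeta> \<bullet> \<mu>) < - (\<nu> \<bullet> \<mu>)" by simp
    have \<mu>: "\<mu> \<in> sphere 0 1" using \<mu>F F by auto
    have ne: "\<mu> \<noteq> \<zeta>" using lt n\<zeta> \<nu>\<zeta> by auto
    have "(G + 2 * L) * (1 - \<zeta> \<bullet> \<mu>) < (S / 2) * (1 - \<zeta> \<bullet> \<mu>)"
      using S(3) wpos[OF \<mu> ne] by (intro mult_strict_right_mono) auto
    moreover have "1 / 2 * (S * (1 - \<zeta> \<bullet> \<mu>)) \<le> q * (- (\<nu> \<bullet> \<mu>))"
      using q lt S w0[OF \<mu>] by (intro mult_mono) auto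
    ultimately have "\<Psi> \<mu> > 0" using exp2[OF \<mu>] unfolding mult_minus_right by linarith
    moreover have "dist \<mu> \<zeta> < r" by (rule near[OF \<mu>]) (use lt in simp)
    ultimately show False using out[OF \<mu>F] by simp
  qed
  ultimately show ?thesis using \<nu>1 \<nu>\<zeta> unfolding touched_at_def S_def by blast
qed

text \<open>In the chart at \<open>p\<close> the defining function is
  \<open>x \<bullet> \<nu> - f (P x)\<close>. The same chart serves all boundary points near
  \<open>p\<close>, so the constants depend on \<open>p\<close> only.\<close>

lemma C11_boundary_touching_caps:
  fixes U :: "(real ^ 'n) set"
  assumes U: "openin (top_of_set (sphere 0 1)) U" and C11: "C11_boundary_in_sphere U"
  shows "\<exists>S\<ge>0. touching_caps (closure U) S"
proof (rule touching_caps_local)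
  define F where "F = closure U"
  have Us: "U \<subseteq> sphere 0 1" using openin_subset[OF U] by simp
  then show Fs: "closure U \<subseteq> sphere 0 1" by (simp add: closure_minimal)
  show "closed (closure U)" by simp
  obtain W where W: "open W" "U = sphere 0 1 \<inter> W" using U by (metis openin_open)
  define B where "B = closure U \<inter> closure (sphere 0 1 - closure U)"
  have BU: "\<zeta> \<notin> U" if "\<zeta> \<in> B" for \<zeta>
  proof
    assume "\<zeta> \<in> U"
    then have "\<zeta> \<in> W \<inter> closure (sphere 0 1 - closure U)" using that W by (auto simp: B_def)
    then have "W \<inter> (sphere 0 1 - closure U) \<noteq> {}" using open_Int_closure_eq_empty[OF W(1)] by blast
    then show False using W closure_subset[of U] by auto
  qed
  fix p assume "p \<in> closure U \<inter> closure (sphere 0 1 - closure U)"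
  then have pB: "p \<in> B" by (simp add: B_def)
  have np: "norm p = 1" using pB Fs by (auto simp: B_def)
  \<comment> \<open>Points of \<open>B\<close> are limits of \<open>U\<close> outside
    \<open>U\<close>, hence lie in its frontier, where a chart is available.\<close>
  have "top_of_set (sphere 0 1) interior_of U = U" using U by (rule interior_of_openin)
  moreover have "p \<in> top_of_set (sphere 0 1) closure_of U"
    using pB Us np by (simp add: closure_of_subtopology B_def Int_absorb1)
  ultimately have "p \<in> top_of_set (sphere 0 1) frontier_of U"
    using BU[OF pB] by (simp add: frontier_of_def)
  then obtain \<nu> r f where \<nu>: "norm \<nu> = 1" "\<nu> \<bullet> p = 0" and r: "0 < r" and f: "C11 f"
    and graph: "U \<inter> ball p r = {x \<in> sphere 0 1 \<inter> ball p r.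
             x \<bullet> \<nu> < f (x - (x \<bullet> p) *\<^sub>R p - (x \<bullet> \<nu>) *\<^sub>R \<nu>)}"
    using C11 unfolding C11_boundary_in_sphere_def by blast
  have o: "\<nu> \<bullet> \<nu> = 1" "p \<bullet> p = 1" "p \<bullet> \<nu> = 0" using \<nu> np by (auto simp: dot_square_norm inner_commute)
  define P where "P x = x - (x \<bullet> p) *\<^sub>R p - (x \<bullet> \<nu>) *\<^sub>R \<nu>" for x
  have Pdiff: "P x - P y = P (x - y)" for x y by (simp add: P_def inner_diff_left algebra_simps)
  have Padj: "P x \<bullet> y = x \<bullet> P y" for x y
    by (simp add: P_def inner_diff_left inner_diff_right inner_commute)
  have Pp: "P x \<bullet> p = 0" and P\<nu>: "P x \<bullet> \<nu> = 0" for x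
    using o \<nu>(2) by (auto simp: P_def inner_diff_left)
  have Pnorm: "norm (P x) \<le> norm x" for x
  proof -
    have "P x \<bullet> P x = P x \<bullet> x" by (subst (2) P_def) (simp add: inner_diff_right Pp P\<nu>)
    also have "\<dots> \<le> norm (P x) * norm x" by (rule norm_cauchy_schwarz)
    finally have "norm (P x) * norm (P x) \<le> norm (P x) * norm x" by (simp add: dot_square_norm power2_eq_square)
    then show ?thesis by (cases "P x = 0") auto
  qed
  define \<Psi> where "\<Psi> x = x \<bullet> \<nu> - f (P x)" for x
  have diff: "f differentiable_on UNIV" using f by (simp add: C11_def)
  have "continuous_on UNIV f" using diff by (rule differentiable_imp_continuous_on)
  moreover have "continuous_on UNIV P" unfolding P_def by (intro continuous_intros)
  ultimately have fP: "continuous_on UNIV (\<lambda>x. f (P x))"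
    using continuous_on_compose2[of UNIV f UNIV P] by auto
  then have \<Psi>: "continuous_on UNIV \<Psi>" unfolding \<Psi>_def by (intro continuous_intros)
  have graph': "\<mu> \<in> U \<longleftrightarrow> \<Psi> \<mu> < 0" if "\<mu> \<in> sphere 0 1" "\<mu> \<in> ball p r" for \<mu>
    using graph that unfolding \<Psi>_def P_def by fastforce
  have closed: "\<Psi> \<mu> \<le> 0" if "\<mu> \<in> closure U" "\<mu> \<in> ball p r" for \<mu>
  proof -
    have "\<mu> \<in> closure (ball p r \<inter> U)" using open_Int_closure_subset[of "ball p r" U] that by auto
    also have "\<dots> \<subseteq> closure {x. \<Psi> x \<le> 0}" using graph' Us by (intro closure_mono) fastforce
    also have "\<dots> = {x. \<Psi> x \<le> 0}"
      by (intro closure_closed closed_Collect_le \<Psi> continuous_intros)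
    finally show ?thesis by simp
  qed
  obtain L where L: "L-lipschitz_on (cball 0 1) (gradient f)"
    using f unfolding C11_def by (meson compact_cball)
  have L0: "L \<ge> 0" using L lipschitz_on_nonneg by blast
  define G where "G = 1 + (norm (gradient f 0) + L)"
  have G1: "G \<ge> 1" using L0 by (simp add: G_def)
  \<comment> \<open>\<open>r / 2\<close> leaves a ball of radius \<open>r / 2\<close> around
    \<open>\<zeta>\<close> inside the chart. \<open>1 / (2 * G)\<close> keeps \<open>\<zeta>\<close>
    so close to \<open>p\<close> that removing the radial part of \<open>D\<close>, which satisfies
    \<open>D \<bullet> \<nu> = 1\<close>, costs at most \<open>1 / 2\<close>.\<close>
  define \<rho> where "\<rho> = min (r / 2) (1 / (2 * G))"
  have \<rho>: "\<rho> > 0" "\<rho> \<le> r / 2" "\<rho> \<le> 1 / (2 * G)"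
    using r G1 unfolding \<rho>_def by (simp, rule_tac min.cobounded1, rule_tac min.cobounded2)
  have "touched_at (closure U) (2 / (r / 2) + 2 * (G + 2 * L) + 1) \<zeta>"
    if \<zeta>: "\<zeta> \<in> B" "\<zeta> \<in> ball p \<rho>" for \<zeta>
  proof -
    have \<zeta>F: "\<zeta> \<in> closure U" using \<zeta> by (simp add: B_def)
    have n\<zeta>: "norm \<zeta> = 1" "\<zeta> \<in> sphere 0 1" using \<zeta>F Fs by auto
    have \<zeta>r: "\<zeta> \<in> ball p r" using \<zeta>(2) \<rho> r by auto
    have \<Psi>0: "\<Psi> \<zeta> = 0"
      using closed[OF \<zeta>F \<zeta>r] graph'[OF n\<zeta>(2) \<zeta>r] BU[OF \<zeta>(1)] by simp
    define g where "g = gradient f (P \<zeta>)"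
    define D where "D = \<nu> - P g"
    have P1: "P \<mu> \<in> cball 0 1" if "norm \<mu> = 1" for \<mu> using Pnorm[of \<mu>] that by simp
    have "norm g \<le> norm (gradient f 0) + norm (g - gradient f 0)"
      by (metis add_diff_cancel_left' diff_add_cancel norm_triangle_ineq add.commute)
    also have "norm (g - gradient f 0) \<le> L * norm (P \<zeta>)"
      using lipschitz_onD[OF L P1[OF n\<zeta>(1)], of 0] by (simp add: g_def dist_norm)
    also have "\<dots> \<le> L * 1" using P1[OF n\<zeta>(1)] L0 by (intro mult_left_mono) auto
    finally have g: "norm g \<le> norm (gradient f 0) + L" by simp
    have DG: "norm D \<le> G"
      using norm_triangle_ineq4[of \<nu> "P g"] Pnorm[of g] g \<nu> by (simp add: D_def G_def)
    have D\<nu>: "D \<bullet> \<nu> = 1" by (simp add: D_def inner_diff_left o P\<nu>)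
    have small: "\<bar>\<zeta> \<bullet> \<nu>\<bar> < \<rho>"
    proof -
      have "\<zeta> \<bullet> \<nu> = (\<zeta> - p) \<bullet> \<nu>" by (simp add: inner_diff_left o)
      then have "\<bar>\<zeta> \<bullet> \<nu>\<bar> \<le> norm (\<zeta> - p)" using Cauchy_Schwarz_ineq2[of "\<zeta> - p" \<nu>] \<nu> by simp
      then show ?thesis using \<zeta>(2) by (simp add: dist_norm norm_minus_commute)
    qed
    have "\<bar>(\<zeta> \<bullet> D) * (\<zeta> \<bullet> \<nu>)\<bar> \<le> G * \<rho>"
      unfolding abs_mult using Cauchy_Schwarz_ineq2[of \<zeta> D] n\<zeta> DG small G1
      by (intro mult_mono) auto
    also have "\<dots> \<le> 1 / 2" using \<rho>(3) G1 by (simp add: field_simps)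
    finally have "1 / 2 \<le> (D - (\<zeta> \<bullet> D) *\<^sub>R \<zeta>) \<bullet> \<nu>" by (simp add: inner_diff_left D\<nu>)
    also have "\<dots> \<le> norm (D - (\<zeta> \<bullet> D) *\<^sub>R \<zeta>)" using norm_cauchy_schwarz[of _ \<nu>] \<nu> by simp
    finally have DT: "1 / 2 \<le> norm (D - (\<zeta> \<bullet> D) *\<^sub>R \<zeta>)" .
    show ?thesis
    proof (rule touched_at_from_expansion[OF Fs \<zeta>F, where \<Psi> = \<Psi> and D = D])
      fix \<mu> :: "real ^ 'n" assume \<mu>: "\<mu> \<in> sphere 0 1"
      have Pg: "g \<bullet> P (\<mu> - \<zeta>) = P g \<bullet> (\<mu> - \<zeta>)" by (simp only: Padj)
      have "\<Psi> \<mu> - D \<bullet> (\<mu> - \<zeta>) = (\<Psi> \<mu> - \<Psi> \<zeta>) - D \<bullet> (\<mu> - \<zeta>)" by (simp add: \<Psi>0)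
      also have "\<dots> = - (f (P \<mu>) - f (P \<zeta>) - g \<bullet> (P \<mu> - P \<zeta>))"
        unfolding Pdiff Pg by (simp add: \<Psi>_def D_def inner_diff_left inner_diff_right inner_commute)
      finally have "\<bar>\<Psi> \<mu> - D \<bullet> (\<mu> - \<zeta>)\<bar> \<le> L * (norm (P \<mu> - P \<zeta>))\<^sup>2"
        using gradient_taylor[OF diff L convex_cball, of "P \<mu>" "P \<zeta>"] P1 \<mu> n\<zeta> by (simp add: g_def)
      also have "\<dots> \<le> L * (dist \<mu> \<zeta>)\<^sup>2"
        using Pnorm[of "\<mu> - \<zeta>"] L0 by (simp add: Pdiff dist_norm mult_left_mono power_mono)
      finally show "\<bar>\<Psi> \<mu> - D \<bullet> (\<mu> - \<zeta>)\<bar> \<le> L * (dist \<mu> \<zeta>)\<^sup>2" .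
    next
      fix \<mu> :: "real ^ 'n" assume \<mu>: "\<mu> \<in> sphere 0 1" "dist \<mu> \<zeta> < r / 2" "\<Psi> \<mu> < 0"
      have "dist p \<mu> < r" using dist_triangle[of p \<mu> \<zeta>] \<mu>(2) \<zeta>(2) \<rho>(2) by (simp add: dist_commute)
      then show "\<mu> \<in> closure U" using graph'[OF \<mu>(1)] \<mu>(3) closure_subset[of U] by auto
    next
      fix \<mu> assume \<mu>: "\<mu> \<in> closure U" "dist \<mu> \<zeta> < r / 2"
      have "dist p \<mu> < r" using dist_triangle[of p \<mu> \<zeta>] \<mu>(2) \<zeta>(2) \<rho>(2) by (simp add: dist_commute)
      then show "\<Psi> \<mu> \<le> 0" using closed \<mu>(1) by simp
    qed (use r DG DT L0 in auto)
  qed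
  then show "\<exists>r>0. \<exists>S. \<forall>\<zeta>\<in>closure U \<inter> closure (sphere 0 1 - closure U) \<inter> ball p r. touched_at (closure U) S \<zeta>"
    using \<rho>(1) unfolding B_def[symmetric] by (intro exI[of _ \<rho>] conjI exI[of _ "2 / (r / 2) + 2 * (G + 2 * L) + 1"]) auto
qed

section \<open>Finite unions of arcs of the circle\<close>

lemma plane_expansion:
  fixes x e1 e2 :: "real ^ 'n"
  assumes "CARD('n) = 2" "norm e1 = 1" "norm e2 = 1" "e1 \<bullet> e2 = 0"
  shows "x = (x \<bullet> e1) *\<^sub>R e1 + (x \<bullet> e2) *\<^sub>R e2"
proof (rule ccontr)
  define y where "y = x - (x \<bullet> e1) *\<^sub>R e1 - (x \<bullet> e2) *\<^sub>R e2"
  assume "\<not> ?thesis"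
  then have y: "y \<noteq> 0" by (auto simp: y_def algebra_simps)
  have o: "e1 \<bullet> e1 = 1" "e2 \<bullet> e2 = 1" "e2 \<bullet> e1 = 0" using assms by (auto simp: dot_square_norm inner_commute)
  have ye: "y \<bullet> e1 = 0" "y \<bullet> e2 = 0" by (auto simp: y_def inner_diff_left o assms)
  have "pairwise orthogonal {y, e1, e2}"
    unfolding pairwise_def orthogonal_def using ye assms o by (auto simp: inner_commute)
  moreover have "0 \<notin> {y, e1, e2}" using y o by auto
  ultimately have "independent {y, e1, e2}" by (rule pairwise_orthogonal_independent)
  then have "card {y, e1, e2} \<le> 2" using independent_bound[of "{y, e1, e2}"] assms by simp
  moreover have "y \<noteq> e1" "y \<noteq> e2" "e1 \<noteq> e2" using ye y assms o by auto
  ultimately show False by simp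
qed

text \<open>An arc is the cap around its midpoint; half its length \<open>\<delta>\<close> is the
  angular radius, so \<open>T\<close> is minus the cotangent of \<open>\<delta>\<close>.\<close>

lemma circle_arc_cap:
  fixes A :: "(real ^ 'n) set"
  assumes n: "CARD('n) = 2" and "circle_arc A"
  obtains c T where "norm c = 1" "A = cap T c"
proof -
  obtain e1 e2 a b where e: "norm e1 = 1" "norm e2 = 1" "e1 \<bullet> e2 = 0" and ab: "a < b" "b < a + 2 * pi"
    and A: "A = (\<lambda>t. cos t *\<^sub>R e1 + sin t *\<^sub>R e2) ` {a..b}"
    using assms(2) unfolding circle_arc_def by blast
  have o: "e1 \<bullet> e1 = 1" "e2 \<bullet> e2 = 1" "e2 \<bullet> e1 = 0" using e by (auto simp: dot_square_norm inner_commute)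
  define E where "E t = cos t *\<^sub>R e1 + sin t *\<^sub>R e2" for t
  define m \<delta> where "m = (a + b) / 2" and "\<delta> = (b - a) / 2"
  have \<delta>: "0 < \<delta>" "\<delta> < pi" using ab by (auto simp: \<delta>_def)
  have EE: "E s \<bullet> E t = cos (t - s)" for s t
    by (simp add: E_def inner_add_left inner_add_right o e cos_diff)
  have E1: "norm (E t) = 1" for t by (simp add: norm_eq_1 EE)
  define T where "T = - cos \<delta> / sin \<delta>"
  have s: "sin \<delta> > 0" using \<delta> by (rule sin_gt_zero)
  have "1 + T\<^sup>2 = ((sin \<delta>)\<^sup>2 + (cos \<delta>)\<^sup>2) / (sin \<delta>)\<^sup>2" 
    using s by (simp add: T_def power_divide add_divide_distrib del: sin_cos_squared_add sin_cos_squared_add2)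
  also have "\<dots> = (1 / sin \<delta>)\<^sup>2" by (simp add: power_divide)
  finally have C: "sqrt (1 + T\<^sup>2) = 1 / sin \<delta>" using s by simp
  have ax: "axial T (E m) \<mu> 1 = (E m \<bullet> \<mu> - cos \<delta>) / sin \<delta>" for \<mu>
    unfolding axial_def C by (simp add: T_def diff_divide_distrib)
  have "A = cap T (E m)"
  proof (intro equalityI subsetI)
    fix \<mu> assume "\<mu> \<in> A"
    then obtain t where t: "t \<in> {a..b}" "\<mu> = E t" by (auto simp: A E_def)
    have "\<bar>t - m\<bar> \<le> \<delta>" using t by (auto simp: m_def \<delta>_def abs_le_iff field_simps)
    then have "cos \<delta> \<le> cos \<bar>t - m\<bar>" using \<delta> by (intro cos_monotone_0_pi_le) auto
    then show "\<mu> \<in> cap T (E m)" using s by (simp add: cap_def ax t(2) EE E1)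
  next
    fix \<mu> assume \<mu>: "\<mu> \<in> cap T (E m)"
    then have n\<mu>: "norm \<mu> = 1" by (simp add: cap_def)
    have \<mu>e: "\<mu> = (\<mu> \<bullet> e1) *\<^sub>R e1 + (\<mu> \<bullet> e2) *\<^sub>R e2" by (rule plane_expansion[OF n e])
    have "\<mu> \<bullet> \<mu> = (\<mu> \<bullet> e1)\<^sup>2 + (\<mu> \<bullet> e2)\<^sup>2"
      by (subst (2) \<mu>e) (simp add: inner_add_right power2_eq_square)
    then have "(\<mu> \<bullet> e1)\<^sup>2 + (\<mu> \<bullet> e2)\<^sup>2 = 1" using n\<mu> by (simp add: dot_square_norm)
    then obtain t where t: "\<mu> \<bullet> e1 = cos t" "\<mu> \<bullet> e2 = sin t" using sincos_total_2pi by metis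
    \<comment> \<open>Shifts the angle by full turns to within \<open>pi\<close> of the midpoint,
      where the cosine is monotone in the distance.\<close>
    define k where "k = \<lfloor>(t - m + pi) / (2 * pi)\<rfloor>"
    define t' where "t' = t - 2 * pi * real_of_int k"
    have "real_of_int k \<le> (t - m + pi) / (2 * pi)" "(t - m + pi) / (2 * pi) < real_of_int k + 1"
      unfolding k_def by linarith+
    then have "2 * pi * real_of_int k \<le> t - m + pi" "t - m + pi < 2 * pi * (real_of_int k + 1)"
      by (auto simp: field_simps)
    then have t': "\<bar>t' - m\<bar> \<le> pi" by (auto simp: t'_def algebra_simps abs_le_iff)
    have "cos t' = cos t" "sin t' = sin t" unfolding t'_def
      using cos_int_2pin sin_int_2pin by (simp_all add: cos_diff sin_diff mult.assoc mult.commute[of pi] mult.left_commute)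
    then have \<mu>E: "\<mu> = E t'" using \<mu>e t by (simp add: E_def)
    have "cos \<delta> \<le> cos \<bar>t' - m\<bar>" using \<mu> s by (simp add: cap_def ax \<mu>E EE zero_le_divide_iff)
    then have "\<bar>t' - m\<bar> \<le> \<delta>" using t' \<delta> cos_mono_le_eq[of \<delta> "\<bar>t' - m\<bar>"] by simp
    then have "t' \<in> {a..b}" by (auto simp: m_def \<delta>_def abs_le_iff field_simps)
    then show "\<mu> \<in> A" using \<mu>E by (auto simp: A E_def)
  qed
  then show thesis using that[of "E m" T] E1 by simp
qed

text \<open>Converse to \<open>cap_from_touching\<close>: at a boundary point the inward unit normal
  is \<open>C c + T \<zeta>\<close>, and \<open>T\<close> reappears as the curvature.\<close>

lemma cap_boundary_normal:
  fixes c \<zeta> :: "real ^ 'n"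
  assumes c: "norm c = 1" and \<zeta>: "norm \<zeta> = 1" "axial T c \<zeta> 1 = 0"
  obtains \<nu> where "norm \<nu> = 1" "\<nu> \<bullet> \<zeta> = 0" "cap T c = {\<mu> \<in> sphere 0 1. - (\<nu> \<bullet> \<mu>) \<le> T * (1 - \<zeta> \<bullet> \<mu>)}"
proof -
  define C where "C = sqrt (1 + T\<^sup>2)"
  have C: "C * C = 1 + T * T" unfolding C_def by (rule sqrt_1_sq)
  have o: "c \<bullet> c = 1" "\<zeta> \<bullet> \<zeta> = 1" using c \<zeta> by (auto simp: dot_square_norm)
  have c\<zeta>: "C * (c \<bullet> \<zeta>) = - T" using \<zeta>(2) by (simp add: axial_def C_def)
  define \<nu> where "\<nu> = C *\<^sub>R c + T *\<^sub>R \<zeta>"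
  have "\<nu> \<bullet> \<zeta> = 0" by (simp add: \<nu>_def inner_add_left o c\<zeta>)
  moreover have "\<nu> \<bullet> \<nu> = C * C + 2 * T * (C * (c \<bullet> \<zeta>)) + T * T"
    by (simp add: \<nu>_def inner_add_left inner_add_right o inner_commute algebra_simps)
  then have "\<nu> \<bullet> \<nu> = 1" unfolding c\<zeta> C by simp
  moreover have "axial T c \<mu> 1 = \<nu> \<bullet> \<mu> + T * (1 - \<zeta> \<bullet> \<mu>)" for \<mu>
    by (simp add: axial_def \<nu>_def inner_add_left algebra_simps flip: C_def)
  then have "cap T c = {\<mu> \<in> sphere 0 1. - (\<nu> \<bullet> \<mu>) \<le> T * (1 - \<zeta> \<bullet> \<mu>)}"
    unfolding cap_def by auto
  ultimately show thesis using that by (simp add: norm_eq_1)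
qed

lemma finite_cap_boundary:
  fixes c :: "real ^ 'n"
  assumes n: "CARD('n) = 2" and c: "norm c = 1"
  shows "finite {\<mu>. norm \<mu> = 1 \<and> axial T c \<mu> 1 = 0}"
proof -
  obtain e where e: "norm e = 1" "c \<bullet> e = 0" using unit_orthogonal_exists[of c] n by auto
  define k where "k = - T / sqrt (1 + T\<^sup>2)"
  define q where "q = sqrt (1 - k\<^sup>2)"
  have "\<mu> \<in> {k *\<^sub>R c + q *\<^sub>R e, k *\<^sub>R c + (- q) *\<^sub>R e}" if "norm \<mu> = 1" "axial T c \<mu> 1 = 0" for \<mu>
  proof -
    have \<mu>e: "\<mu> = (\<mu> \<bullet> c) *\<^sub>R c + (\<mu> \<bullet> e) *\<^sub>R e" by (rule plane_expansion[OF n c e])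
    have k: "\<mu> \<bullet> c = k" using that(2) sqrt_1_pos[of T] by (simp add: axial_def k_def field_simps inner_commute)
    have "\<mu> \<bullet> \<mu> = (\<mu> \<bullet> c)\<^sup>2 + (\<mu> \<bullet> e)\<^sup>2"
      by (subst (2) \<mu>e) (simp add: inner_add_right power2_eq_square)
    then have "(\<mu> \<bullet> e)\<^sup>2 = 1 - k\<^sup>2" using that k by (simp add: dot_square_norm)
    then have "\<bar>\<mu> \<bullet> e\<bar> = q" by (simp add: q_def flip: real_sqrt_abs)
    then show ?thesis using \<mu>e k by (metis abs_if insert_iff minus_minus)
  qed
  then have "{\<mu>. norm \<mu> = 1 \<and> axial T c \<mu> 1 = 0} \<subseteq> {k *\<^sub>R c + q *\<^sub>R e, k *\<^sub>R c + (- q) *\<^sub>R e}" by blast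
  then show ?thesis by (rule finite_subset) simp
qed

text \<open>There are finitely many boundary points, each an endpoint of an arc \<open>A0\<close>.
  That arc supplies the normal and the interior cap. For the exterior cap each arc is bounded
  separately: arcs away from \<open>\<zeta>\<close> have positive distance to it, and arcs ending at
  \<open>\<zeta>\<close> have the same inward normal.\<close>

lemma arcs_touching_caps:
  fixes F :: "(real ^ 'n) set"
  assumes n: "CARD('n) = 2" and \<A>: "finite \<A>" "\<And>A. A \<in> \<A> \<Longrightarrow> circle_arc A" and F: "F = \<Union>\<A>"
  shows "\<exists>S\<ge>0. touching_caps F S"
proof -
  have "\<exists>c T. norm c = 1 \<and> A = cap T c" if "A \<in> \<A>" for A
    using circle_arc_cap[OF n \<A>(2)[OF that]] by metis
  then obtain c T where cT: "\<And>A. A \<in> \<A> \<Longrightarrow> norm (c A) = 1 \<and> A = cap (T A) (c A)" by metis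
  define B where "B = F \<inter> closure (sphere 0 1 - F)"
  have Fs: "F \<subseteq> sphere 0 1"
  proof
    fix \<mu> assume "\<mu> \<in> F"
    then obtain A where "A \<in> \<A>" "\<mu> \<in> A" by (auto simp: F)
    then have "\<mu> \<in> cap (T A) (c A)" using cT by blast
    then show "\<mu> \<in> sphere 0 1" by (simp add: cap_def)
  qed
  have cont: "continuous_on UNIV (\<lambda>\<mu>. axial t a \<mu> 1)" for t and a :: "real ^ 'n"
    unfolding axial_def by (intro continuous_intros)
  have closed: "closed A" if "A \<in> \<A>" for A
  proof -
    have "A = sphere 0 1 \<inter> {\<mu>. 0 \<le> axial (T A) (c A) \<mu> 1}" using cT[OF that] unfolding cap_def by blast
    moreover have "closed (sphere 0 1 \<inter> {\<mu>. 0 \<le> axial (T A) (c A) \<mu> 1})"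
      by (intro closed_Int closed_sphere closed_Collect_le cont continuous_intros)
    ultimately show ?thesis by simp
  qed
  have zero: "axial (T A) (c A) \<zeta> 1 = 0" if "A \<in> \<A>" "\<zeta> \<in> A" "\<zeta> \<in> B" for A \<zeta>
  proof -
    have "\<zeta> \<in> closure (sphere 0 1 - F)" using that(3) by (simp add: B_def)
    also have "\<dots> \<subseteq> closure {\<mu>. axial (T A) (c A) \<mu> 1 \<le> 0}"
    proof (rule closure_mono, rule subsetI)
      fix \<mu> assume "\<mu> \<in> sphere 0 1 - F"
      then have "\<mu> \<in> sphere 0 1" "\<mu> \<notin> cap (T A) (c A)" using that(1) cT[OF that(1)] by (auto simp: F)
      then show "\<mu> \<in> {\<mu>. axial (T A) (c A) \<mu> 1 \<le> 0}" unfolding cap_def by auto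
    qed
    also have "\<dots> = {\<mu>. axial (T A) (c A) \<mu> 1 \<le> 0}"
      by (intro closure_closed closed_Collect_le cont continuous_intros)
    finally have "axial (T A) (c A) \<zeta> 1 \<le> 0" by simp
    moreover have "\<zeta> \<in> cap (T A) (c A)" using that cT by simp
    then have "axial (T A) (c A) \<zeta> 1 \<ge> 0" by (simp add: cap_def)
    ultimately show ?thesis by simp
  qed
  have "B \<subseteq> (\<Union>A\<in>\<A>. {\<mu>. norm \<mu> = 1 \<and> axial (T A) (c A) \<mu> 1 = 0})"
  proof
    fix \<zeta> assume "\<zeta> \<in> B"
    then obtain A where "A \<in> \<A>" "\<zeta> \<in> A" by (auto simp: B_def F)
    then show "\<zeta> \<in> (\<Union>A\<in>\<A>. {\<mu>. norm \<mu> = 1 \<and> axial (T A) (c A) \<mu> 1 = 0})"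
      using zero \<open>\<zeta> \<in> B\<close> Fs by (force simp: B_def)
  qed
  moreover have "finite (\<Union>A\<in>\<A>. {\<mu>. norm \<mu> = 1 \<and> axial (T A) (c A) \<mu> 1 = 0})"
    using \<A>(1) finite_cap_boundary[OF n] cT by blast
  ultimately have "finite B" by (rule finite_subset)
  moreover have "\<exists>S. touched_at F S \<zeta>" if \<zeta>: "\<zeta> \<in> B" for \<zeta>
  proof -
    have n\<zeta>: "norm \<zeta> = 1" using \<zeta> Fs by (auto simp: B_def)
    obtain A0 where A0: "A0 \<in> \<A>" "\<zeta> \<in> A0" using \<zeta> by (auto simp: B_def F)
    obtain \<nu> where \<nu>: "norm \<nu> = 1" "\<nu> \<bullet> \<zeta> = 0"
      "cap (T A0) (c A0) = {\<mu> \<in> sphere 0 1. - (\<nu> \<bullet> \<mu>) \<le> T A0 * (1 - \<zeta> \<bullet> \<mu>)}"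
      using cap_boundary_normal[OF _ n\<zeta> zero[OF A0 \<zeta>]] cT[OF A0(1)] by blast
    have w: "0 \<le> 1 - \<zeta> \<bullet> \<mu>" if "\<mu> \<in> sphere 0 1" for \<mu> using inner_le_1[OF n\<zeta>, of \<mu>] that by simp
    have "\<exists>s. \<forall>\<mu>\<in>A. - (\<nu> \<bullet> \<mu>) \<le> s * (1 - \<zeta> \<bullet> \<mu>)" if A: "A \<in> \<A>" for A
    proof (cases "\<zeta> \<in> A")
      case True
      obtain \<nu>' where \<nu>': "norm \<nu>' = 1" "\<nu>' \<bullet> \<zeta> = 0"
        "cap (T A) (c A) = {\<mu> \<in> sphere 0 1. - (\<nu>' \<bullet> \<mu>) \<le> T A * (1 - \<zeta> \<bullet> \<mu>)}"
        using cap_boundary_normal[OF _ n\<zeta> zero[OF A True \<zeta>]] cT[OF A] by blast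
      have \<nu>'_eq: "\<nu>' = (\<nu>' \<bullet> \<nu>) *\<^sub>R \<nu>" using plane_expansion[OF n n\<zeta> \<nu>(1), of \<nu>'] \<nu>(2) \<nu>'(2) by (simp add: inner_commute)
      then have "\<bar>\<nu>' \<bullet> \<nu>\<bar> = 1" using \<nu>(1) \<nu>'(1) by (metis mult.right_neutral norm_scaleR)
      then consider "\<nu>' = \<nu>" | "\<nu>' = - \<nu>" using \<nu>'_eq by (cases "\<nu>' \<bullet> \<nu> \<ge> 0") auto
      then show ?thesis
      proof cases
        case 1
        then show ?thesis using \<nu>'(3) cT[OF A] by (intro exI[of _ "T A"]) auto
      next
        \<comment> \<open>Opposite inward normals are impossible, since the two arcs would then
          cover a neighbourhood of \<open>\<zeta>\<close>. On \<open>W\<close> the identity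
          \<open>(\<nu> \<bullet> \<mu>)^2 = (1 - \<zeta> \<bullet> \<mu>) * (1 + \<zeta> \<bullet>
          \<mu>)\<close> gives \<open>\<bar>\<nu> \<bullet> \<mu>\<bar> \<ge> K * (1 - \<zeta>
          \<bullet> \<mu>)\<close>, so that every unit vector there lies in one of the two
          caps.\<close>
        case 2
        define K where "K = max \<bar>T A\<bar> \<bar>T A0\<bar>"
        define W where "W = {\<mu> :: real ^ 'n. K\<^sup>2 * (1 - \<zeta> \<bullet> \<mu>) < 1 + \<zeta> \<bullet> \<mu>}"
        have "open W" unfolding W_def by (intro open_Collect_less continuous_intros)
        moreover have "\<zeta> \<in> W" using n\<zeta> by (simp add: W_def dot_square_norm)
        moreover have "\<zeta> \<in> closure (sphere 0 1 - F)" using \<zeta> by (simp add: B_def)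
        ultimately have "W \<inter> (sphere 0 1 - F) \<noteq> {}" using open_Int_closure_eq_empty by blast
        then obtain \<mu> where \<mu>: "\<mu> \<in> W" "\<mu> \<in> sphere 0 1" "\<mu> \<notin> F" by auto
        have \<mu>e: "\<mu> = (\<mu> \<bullet> \<zeta>) *\<^sub>R \<zeta> + (\<mu> \<bullet> \<nu>) *\<^sub>R \<nu>"
          by (rule plane_expansion[OF n n\<zeta> \<nu>(1)]) (use \<nu>(2) in \<open>simp add: inner_commute\<close>)
        have "\<mu> \<bullet> \<mu> = (\<mu> \<bullet> \<zeta>)\<^sup>2 + (\<mu> \<bullet> \<nu>)\<^sup>2"
          by (subst (2) \<mu>e) (simp add: inner_add_right power2_eq_square)
        then have "(\<nu> \<bullet> \<mu>)\<^sup>2 = (1 - \<zeta> \<bullet> \<mu>) * (1 + \<zeta> \<bullet> \<mu>)"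
          using \<mu>(2) by (simp add: dot_square_norm inner_commute power2_eq_square algebra_simps)
        also have "\<dots> \<ge> (1 - \<zeta> \<bullet> \<mu>) * (K\<^sup>2 * (1 - \<zeta> \<bullet> \<mu>))"
          using \<mu>(1) w[OF \<mu>(2)] by (intro mult_left_mono) (auto simp: W_def)
        finally have "(K * (1 - \<zeta> \<bullet> \<mu>))\<^sup>2 \<le> (\<nu> \<bullet> \<mu>)\<^sup>2" by (simp add: power2_eq_square algebra_simps)
        then have "K * (1 - \<zeta> \<bullet> \<mu>) \<le> \<bar>\<nu> \<bullet> \<mu>\<bar>"
          using w[OF \<mu>(2)] by (metis abs_ge_self abs_le_square_iff order_trans)
        moreover have "- T A0 * (1 - \<zeta> \<bullet> \<mu>) \<le> K * (1 - \<zeta> \<bullet> \<mu>)"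
          by (rule mult_right_mono) (use w[OF \<mu>(2)] in \<open>auto simp: K_def\<close>)
        moreover have "- T A * (1 - \<zeta> \<bullet> \<mu>) \<le> K * (1 - \<zeta> \<bullet> \<mu>)"
          by (rule mult_right_mono) (use w[OF \<mu>(2)] in \<open>auto simp: K_def\<close>)
        ultimately have "\<mu> \<in> cap (T A0) (c A0) \<or> \<mu> \<in> cap (T A) (c A)"
          unfolding \<nu>(3) \<nu>'(3) using \<mu>(2) 2 by (auto simp: abs_if split: if_splits)
        then show ?thesis using \<mu>(3) cT A A0 by (auto simp: F)
      qed
    next
      case False
      obtain d where d: "d > 0" "\<And>\<mu>. \<mu> \<in> A \<Longrightarrow> d \<le> dist \<zeta> \<mu>"
        using separate_point_closed[OF closed[OF A] False] by blast
      have "- (\<nu> \<bullet> \<mu>) \<le> (2 / d\<^sup>2) * (1 - \<zeta> \<bullet> \<mu>)" if \<mu>: "\<mu> \<in> A" for \<mu>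
      proof -
        have n\<mu>: "norm \<mu> = 1" using \<mu> A Fs by (auto simp: F)
        have "- (\<nu> \<bullet> \<mu>) \<le> 1" using inner_le_1[OF \<nu>(1) n\<mu>] by simp
        also have "1 \<le> (dist \<mu> \<zeta>)\<^sup>2 / d\<^sup>2"
          using power_mono[OF d(2)[OF \<mu>], of 2] d(1) by (simp add: dist_commute)
        also have "\<dots> = (2 / d\<^sup>2) * (1 - \<zeta> \<bullet> \<mu>)" using unit_dist_sq[OF n\<mu> n\<zeta>] by simp
        finally show ?thesis .
      qed
      then show ?thesis by blast
    qed
    then have "\<exists>s\<ge>0. \<forall>A\<in>\<A>. \<forall>\<mu>\<in>A. - (\<nu> \<bullet> \<mu>) \<le> s * (1 - \<zeta> \<bullet> \<mu>)"
    proof (rule finite_uniform_bound[OF \<A>(1)])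
      fix A and s s' :: real assume "A \<in> \<A>" "\<forall>\<mu>\<in>A. - (\<nu> \<bullet> \<mu>) \<le> s * (1 - \<zeta> \<bullet> \<mu>)" "s \<le> s'"
      then show "\<forall>\<mu>\<in>A. - (\<nu> \<bullet> \<mu>) \<le> s' * (1 - \<zeta> \<bullet> \<mu>)"
        using w Fs by (smt (verit) F Union_iff mult_right_mono subsetD)
    qed
    then obtain s where s: "s \<ge> 0" "\<And>A \<mu>. A \<in> \<A> \<Longrightarrow> \<mu> \<in> A \<Longrightarrow> - (\<nu> \<bullet> \<mu>) \<le> s * (1 - \<zeta> \<bullet> \<mu>)" by blast
    have out: "- (\<nu> \<bullet> \<mu>) \<le> (s + \<bar>T A0\<bar>) * (1 - \<zeta> \<bullet> \<mu>)" if "\<mu> \<in> F" for \<mu>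
    proof -
      obtain A where "A \<in> \<A>" "\<mu> \<in> A" using \<open>\<mu> \<in> F\<close> by (auto simp: F)
      then have "- (\<nu> \<bullet> \<mu>) \<le> s * (1 - \<zeta> \<bullet> \<mu>)" by (rule s(2))
      also have "\<dots> \<le> (s + \<bar>T A0\<bar>) * (1 - \<zeta> \<bullet> \<mu>)" using w[of \<mu>] that Fs by (intro mult_right_mono) auto
      finally show ?thesis .
    qed
    have inn: "\<mu> \<in> F" if \<mu>: "\<mu> \<in> sphere 0 1" "(s + \<bar>T A0\<bar>) * (1 - \<zeta> \<bullet> \<mu>) \<le> \<nu> \<bullet> \<mu>" for \<mu>
    proof -
      have "- T A0 * (1 - \<zeta> \<bullet> \<mu>) \<le> (s + \<bar>T A0\<bar>) * (1 - \<zeta> \<bullet> \<mu>)"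
        using w[OF \<mu>(1)] s(1) by (intro mult_right_mono) auto
      then have "\<mu> \<in> cap (T A0) (c A0)" unfolding \<nu>(3) using \<mu> by simp
      then show ?thesis using cT A0 by (auto simp: F)
    qed
    show ?thesis unfolding touched_at_def using \<nu>(1,2) out inn by blast
  qed
  ultimately have "\<exists>S\<ge>0. \<forall>\<zeta>\<in>B. touched_at F S \<zeta>"
  proof (rule finite_uniform_bound)
    fix \<zeta> and s s' :: real assume "\<zeta> \<in> B" "touched_at F s \<zeta>" "s \<le> s'"
    moreover have "norm \<zeta> = 1" using \<open>\<zeta> \<in> B\<close> Fs by (auto simp: B_def)
    ultimately show "touched_at F s' \<zeta>" using touched_at_mono Fs by blast
  qed
  then show ?thesis unfolding touching_caps_def B_def .
qed

theorem admissible_touching_caps: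
  fixes F :: "(real ^ 'n) set"
  assumes "CARD('n) \<ge> 2" "admissible_set F"
  shows "\<exists>S\<ge>0. touching_caps F S"
proof (cases "CARD('n) = 2")
  case True
  then obtain \<A> where "finite \<A>" "\<forall>A\<in>\<A>. circle_arc A" "F = \<Union>\<A>"
    using assms(2) unfolding admissible_set_def by blast
  then show ?thesis using arcs_touching_caps[OF True] by blast
next
  case False
  then have "CARD('n) \<ge> 3" using assms(1) by simp
  then show ?thesis using assms(2) C11_boundary_touching_caps unfolding admissible_set_def by blast
qed

section \<open>Uniform estimates and the barriers\<close>

lemma compact_positive_lower_bound:
  fixes f :: "'a::topological_space \<Rightarrow> real"
  assumes "compact K" "continuous_on K f" "\<And>z. z \<in> K \<Longrightarrow> 0 < f z"
  obtains \<delta> where "\<delta> > 0" "\<And>z. z \<in> K \<Longrightarrow> \<delta> \<le> f z"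
proof (cases "K = {}")
  case True
  then show thesis using that[of 1] by simp
next
  case False
  then obtain z where "z \<in> K" "\<And>y. y \<in> K \<Longrightarrow> f z \<le> f y"
    using continuous_attains_inf[OF assms(1) _ assms(2)] by blast
  then show thesis using that[of "f z"] assms(3) by blast
qed

context curvature_profile
begin

lemma trough_cont_compose:
  fixes g h :: "'b::topological_space \<Rightarrow> real ^ 'n"
  assumes "continuous_on A s" "continuous_on A g" "continuous_on A h"
  shows "continuous_on A (\<lambda>z. trough f (s z) (g z) (h z))"
proof -
  have "continuous_on A (\<lambda>z. (s z, g z, h z))" by (intro continuous_intros assms)
  from continuous_on_compose2[OF trough_cont this] show ?thesis by simp
qed

text \<open>The gradient norm is continuous and below 1 on a compact set of parameters and points.
  \<open>K\<close> is enlarged to a ball, so that segments between its points stay in the range of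
  the bound.\<close>

lemma trough_uniform_lipschitz:
  fixes K :: "(real ^ 'n) set"
  assumes "compact K"
  obtains \<theta> where "\<theta> > 0" "\<And>S a x y. \<lbrakk>\<bar>S\<bar> \<le> S0; norm a = 1; x \<in> K; y \<in> K\<rbrakk> \<Longrightarrow>
    \<bar>trough f S a x - trough f S a y\<bar> \<le> (1 - \<theta>) * norm (x - y)"
proof -
  obtain R where "\<forall>x\<in>K. norm x \<le> R"
    using compact_imp_bounded[OF assms] unfolding bounded_iff by blast
  then have R: "K \<subseteq> cball 0 R" by auto
  define Z where "Z = {- S0..S0} \<times> sphere (0 :: real ^ 'n) 1 \<times> cball (0 :: real ^ 'n) R"
  have "compact Z" unfolding Z_def by (intro compact_Times compact_Icc compact_sphere compact_cball)
  moreover have "continuous_on Z (\<lambda>(S, a, x). gradient (trough f S a) x)"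
    by (rule continuous_on_subset[OF trough_gradient_cont]) (auto simp: Z_def)
  then have "continuous_on Z (\<lambda>z. 1 - norm ((\<lambda>(S, a, x). gradient (trough f S a) x) z))"
    by (intro continuous_intros)
  moreover have "0 < 1 - norm ((\<lambda>(S, a, x). gradient (trough f S a) x) z)" if "z \<in> Z" for z
    using that trough_gradient_less by (auto simp: Z_def)
  ultimately obtain \<theta> where \<theta>: "\<theta> > 0" "\<And>z. z \<in> Z \<Longrightarrow> \<theta> \<le> 1 - norm ((\<lambda>(S, a, x). gradient (trough f S a) x) z)"
    using compact_positive_lower_bound[of Z "\<lambda>z. 1 - norm ((\<lambda>(S, a, x). gradient (trough f S a) x) z)"] by blast
  show thesis
  proof (rule that[OF \<theta>(1)])
    fix S and a x y :: "real ^ 'n"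
    assume S: "\<bar>S\<bar> \<le> S0" and a: "norm a = 1" and xy: "x \<in> K" "y \<in> K"
    have "norm (trough f S a x - trough f S a y) \<le> (1 - \<theta>) * norm (x - y)"
    proof (rule differentiable_bound[OF convex_cball])
      fix z :: "real ^ 'n" assume z: "z \<in> cball 0 R"
      show "(trough f S a has_derivative (\<lambda>h. gradient (trough f S a) z \<bullet> h)) (at z within cball 0 R)"
        by (rule has_derivative_at_withinI[OF trough_has_gradient[OF a]])
      have "(S, a, z) \<in> Z" using S a z by (auto simp: Z_def)
      then have g: "norm (gradient (trough f S a) z) \<le> 1 - \<theta>" using \<theta>(2) by fastforce
      show "onorm (\<lambda>h. gradient (trough f S a) z \<bullet> h) \<le> 1 - \<theta>"
      proof (rule onorm_le)
        fix h
        show "norm (gradient (trough f S a) z \<bullet> h) \<le> (1 - \<theta>) * norm h"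
          using Cauchy_Schwarz_ineq2[of "gradient (trough f S a) z" h] mult_right_mono[OF g, of "norm h"] by simp
      qed
    qed (use R xy in auto)
    then show "\<bar>trough f S a x - trough f S a y\<bar> \<le> (1 - \<theta>) * norm (x - y)" by simp
  qed
qed

end

lemma (in semitrough_profile) trough_cap_gap:
  fixes K :: "(real ^ 'n) set"
  assumes "compact K"
  obtains \<delta> where "\<delta> > 0"
    "\<And>a \<zeta> x. \<lbrakk>norm a = 1; \<zeta> \<in> cap S a; x \<in> K\<rbrakk> \<Longrightarrow> x \<bullet> \<zeta> + \<delta> \<le> trough f S a x"
proof -
  define Z where "Z = (sphere (0 :: real ^ 'n) 1 \<times> sphere (0 :: real ^ 'n) 1 \<times> K) \<inter>
    {z. 0 \<le> axial S (fst z) (fst (snd z)) 1}"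
  have "closed {z :: (real ^ 'n) \<times> (real ^ 'n) \<times> (real ^ 'n). 0 \<le> axial S (fst z) (fst (snd z)) 1}"
    unfolding axial_def by (intro closed_Collect_le continuous_intros)
  then have "compact Z" unfolding Z_def
    by (intro compact_Int_closed compact_Times compact_sphere assms)
  moreover have "continuous_on Z (\<lambda>z. trough f S (fst z) (snd (snd z)) - snd (snd z) \<bullet> fst (snd z))"
    by (intro continuous_intros trough_cont_compose)
  moreover have "0 < trough f S (fst z) (snd (snd z)) - snd (snd z) \<bullet> fst (snd z)" if "z \<in> Z" for z
    using trough_above_cap[of "fst z" "fst (snd z)" S "snd (snd z)"] that by (auto simp: Z_def cap_def)
  ultimately obtain \<delta> where \<delta>: "\<delta> > 0"
    "\<And>z. z \<in> Z \<Longrightarrow> \<delta> \<le> trough f S (fst z) (snd (snd z)) - snd (snd z) \<bullet> fst (snd z)"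
    using compact_positive_lower_bound[of Z "\<lambda>z. trough f S (fst z) (snd (snd z)) - snd (snd z) \<bullet> fst (snd z)"] by blast
  show thesis
  proof (rule that[OF \<delta>(1)])
    fix a \<zeta> x :: "real ^ 'n" assume "norm a = 1" "\<zeta> \<in> cap S a" "x \<in> K"
    then have "(a, \<zeta>, x) \<in> Z" by (auto simp: Z_def cap_def)
    then show "x \<bullet> \<zeta> + \<delta> \<le> trough f S a x" using \<delta>(2)[of "(a, \<zeta>, x)"] by simp
  qed
qed

text \<open>The strict pointwise comparison becomes a uniform gap by compactness. The causal
  inequality is continuous in the parameters, so the admissible pairs form a compact set.\<close>

lemma trough_family_gap:
  fixes K :: "(real ^ 'n) set"
  assumes A: "semitrough_profile nA kA fA fA' fA''" and B: "semitrough_profile nB kB fB fB' fB''"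
    and less: "\<And>y. fA y < fB y" and K: "compact K"
  obtains \<delta> where "\<delta> > 0"
    "\<And>SA SB a b x. \<lbrakk>\<bar>SA\<bar> \<le> S0; \<bar>SB\<bar> \<le> S0; norm a = 1; norm b = 1; x \<in> K;
       norm (sqrt (1 + SA\<^sup>2) *\<^sub>R a - sqrt (1 + SB\<^sup>2) *\<^sub>R b) \<le> SB - SA\<rbrakk>
      \<Longrightarrow> trough fA SA a x + \<delta> \<le> trough fB SB b x"
proof -
  interpret A: semitrough_profile nA kA fA fA' fA'' by fact
  interpret B: semitrough_profile nB kB fB fB' fB'' by fact
  define d where "d z = (case z of (SA, SB, a :: real ^ 'n, b, x) \<Rightarrow> trough fB SB b x - trough fA SA a x)" for z
  define Z where "Z = ({- S0..S0} \<times> {- S0..S0} \<times> sphere (0 :: real ^ 'n) 1 \<times> sphere (0 :: real ^ 'n) 1 \<times> K) \<inter>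
    {(SA, SB, a, b, x). norm (sqrt (1 + SA\<^sup>2) *\<^sub>R a - sqrt (1 + SB\<^sup>2) *\<^sub>R b) \<le> SB - SA}"
  have "closed {(SA, SB, a :: real ^ 'n, b, x :: real ^ 'n).
      norm (sqrt (1 + SA\<^sup>2) *\<^sub>R a - sqrt (1 + SB\<^sup>2) *\<^sub>R b) \<le> SB - SA}"
    unfolding split_beta' by (intro closed_Collect_le continuous_intros)
  then have "compact Z" unfolding Z_def
    by (intro compact_Int_closed compact_Times compact_sphere compact_Icc K)
  moreover have "continuous_on Z d"
    unfolding d_def split_beta' by (intro continuous_intros A.trough_cont_compose B.trough_cont_compose)
  moreover have "0 < d z" if "z \<in> Z" for z
    using trough_comparison[OF A B less] that by (auto simp: Z_def d_def)
  ultimately obtain \<delta> where \<delta>: "\<delta> > 0" "\<And>z. z \<in> Z \<Longrightarrow> \<delta> \<le> d z"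
    using compact_positive_lower_bound by blast
  show thesis
  proof (rule that[OF \<delta>(1)])
    fix SA SB :: real and a b x :: "real ^ 'n"
    assume "\<bar>SA\<bar> \<le> S0" "\<bar>SB\<bar> \<le> S0" "norm a = 1" "norm b = 1" "x \<in> K"
       "norm (sqrt (1 + SA\<^sup>2) *\<^sub>R a - sqrt (1 + SB\<^sup>2) *\<^sub>R b) \<le> SB - SA"
    then have "(SA, SB, a, b, x) \<in> Z" by (auto simp: Z_def)
    then show "trough fA SA a x + \<delta> \<le> trough fB SB b x"
      using \<delta>(2)[of "(SA, SB, a, b, x)"] by (simp add: d_def)
  qed
qed

text \<open>\<open>low\<close> and \<open>up\<close> ask for one member of a family at each
  \<open>x\<close>, while \<open>gap\<close> and \<open>lip\<close> are uniform over the families.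
  Asymptotics are required of the upper family alone, because
  \<open>V \<le> ul \<le> uu\<close>.\<close>

lemma barriers_from_families:
  fixes V :: "real ^ 'n \<Rightarrow> real" and \<U>1 \<U>2 :: "(real ^ 'n \<Rightarrow> real) set"
  assumes ne: "\<U>1 \<noteq> {}" "\<U>2 \<noteq> {}"
    and sol: "\<U>1 \<subseteq> curvature_solutions k1" "\<U>2 \<subseteq> curvature_solutions k2"
    and conv: "\<And>u. u \<in> \<U>1 \<Longrightarrow> convex_on UNIV u"
    and low: "\<And>K. compact K \<Longrightarrow> \<exists>\<delta>>0. \<forall>x\<in>K. \<exists>u\<in>\<U>1. V x + \<delta> \<le> u x"
    and gap: "\<And>K. compact K \<Longrightarrow> \<exists>\<delta>>0. \<forall>u\<in>\<U>1. \<forall>v\<in>\<U>2. \<forall>x\<in>K. u x + \<delta> \<le> v x"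
    and up: "\<And>\<epsilon>. \<epsilon> > 0 \<Longrightarrow> \<exists>R. \<forall>x. R \<le> norm x \<longrightarrow> (\<exists>v\<in>\<U>2. v x \<le> V x + \<epsilon>)"
    and lip: "\<And>K. compact K \<Longrightarrow> \<exists>\<theta>>0. \<forall>u\<in>\<U>1 \<union> \<U>2. \<forall>x\<in>K. \<forall>y\<in>K. \<bar>u x - u y\<bar> \<le> (1 - \<theta>) * norm (x - y)"
  shows "\<exists>ul uu. (\<forall>x. ul x \<le> uu x) \<and>
    convex_on UNIV ul \<and> sup_of_solutions k1 ul \<and> inf_of_solutions k2 uu \<and>
    ((\<lambda>x. \<bar>ul x - V x\<bar> + \<bar>uu x - V x\<bar>) \<longlongrightarrow> 0) at_infinity \<and>
    (\<forall>C. compact C \<longrightarrow> (\<exists>\<theta>>0. \<forall>x\<in>C. \<forall>y\<in>C.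
       \<bar>ul x - ul y\<bar> \<le> (1 - \<theta>) * norm (x - y) \<and> \<bar>uu x - uu y\<bar> \<le> (1 - \<theta>) * norm (x - y))) \<and>
    (\<forall>C. compact C \<longrightarrow> (\<exists>\<delta>>0. \<forall>x\<in>C. V x + \<delta> \<le> ul x \<and> ul x \<le> uu x - \<delta>))"
proof -
  define ul where "ul x = (SUP u\<in>\<U>1. u x)" for x
  define uu where "uu x = (INF u\<in>\<U>2. u x)" for x
  \<comment> \<open>The gap on a singleton orders the families; any member of one then bounds the
    other, so the supremum and the infimum are genuine.\<close>
  have uv: "u x \<le> v x" if "u \<in> \<U>1" "v \<in> \<U>2" for u v x
    using gap[of "{x}"] that by force
  obtain u0 v0 where u0: "u0 \<in> \<U>1" and v0: "v0 \<in> \<U>2" using ne by blast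
  have bdd1: "bdd_above ((\<lambda>u. u x) ` \<U>1)" for x by (rule bdd_aboveI2) (rule uv[OF _ v0])
  have bdd2: "bdd_below ((\<lambda>u. u x) ` \<U>2)" for x by (rule bdd_belowI2) (rule uv[OF u0])
  have ul_ge: "u x \<le> ul x" if "u \<in> \<U>1" for u x unfolding ul_def by (rule cSUP_upper[OF that bdd1])
  have ul_le: "ul x \<le> c" if "\<And>u. u \<in> \<U>1 \<Longrightarrow> u x \<le> c" for c x unfolding ul_def by (rule cSUP_least[OF ne(1) that])
  have uu_le: "uu x \<le> v x" if "v \<in> \<U>2" for v x unfolding uu_def by (rule cINF_lower[OF bdd2 that])
  have uu_ge: "c \<le> uu x" if "\<And>v. v \<in> \<U>2 \<Longrightarrow> c \<le> v x" for c x unfolding uu_def by (rule cINF_greatest[OF ne(2) that])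
  have le: "ul x \<le> uu x" for x by (intro ul_le uu_ge uv)
  have "convex_on UNIV ul"
  proof (rule convex_onI)
    fix t x y assume t: "(0::real) < t" "t < 1"
    show "ul ((1 - t) *\<^sub>R x + t *\<^sub>R y) \<le> (1 - t) * ul x + t * ul y"
    proof (rule ul_le)
      fix u assume u: "u \<in> \<U>1"
      have "u ((1 - t) *\<^sub>R x + t *\<^sub>R y) \<le> (1 - t) * u x + t * u y"
        using convex_onD[OF conv[OF u], of t x y] t by simp
      also have "\<dots> \<le> (1 - t) * ul x + t * ul y"
        using t ul_ge[OF u] by (intro add_mono mult_left_mono) auto
      finally show "u ((1 - t) *\<^sub>R x + t *\<^sub>R y) \<le> (1 - t) * ul x + t * ul y" .
    qed
  qed simp
  moreover have "sup_of_solutions k1 ul"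
    unfolding sup_of_solutions_def using ne sol bdd1 by (intro exI[of _ \<U>1]) (auto simp: ul_def)
  moreover have "inf_of_solutions k2 uu"
    unfolding inf_of_solutions_def using ne sol bdd2 by (intro exI[of _ \<U>2]) (auto simp: uu_def)
  moreover have V: "V x \<le> ul x" for x
  proof -
    obtain \<delta> u where "\<delta> > 0" "u \<in> \<U>1" "V x + \<delta> \<le> u x" using low[of "{x}"] by auto
    then show ?thesis using ul_ge[of u x] by simp
  qed
  have "((\<lambda>x. \<bar>ul x - V x\<bar> + \<bar>uu x - V x\<bar>) \<longlongrightarrow> 0) at_infinity"
  proof (rule tendstoI)
    fix \<epsilon> :: real assume \<epsilon>: "\<epsilon> > 0"
    obtain R where R: "\<And>x. R \<le> norm x \<Longrightarrow> \<exists>v\<in>\<U>2. v x \<le> V x + \<epsilon> / 3"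
      using up[of "\<epsilon> / 3"] \<epsilon> by auto
    have "dist (\<bar>ul x - V x\<bar> + \<bar>uu x - V x\<bar>) 0 < \<epsilon>" if x: "R \<le> norm x" for x
    proof -
      obtain v where "v \<in> \<U>2" "v x \<le> V x + \<epsilon> / 3" using R[OF x] by auto
      then have "uu x \<le> V x + \<epsilon> / 3" using uu_le[of v x] by simp
      then show ?thesis using V[of x] le[of x] \<epsilon> by simp
    qed
    then show "\<forall>\<^sub>F x in at_infinity. dist (\<bar>ul x - V x\<bar> + \<bar>uu x - V x\<bar>) 0 < \<epsilon>"
      unfolding eventually_at_infinity by blast
  qed
  moreover have "\<exists>\<theta>>0. \<forall>x\<in>K. \<forall>y\<in>K.
       \<bar>ul x - ul y\<bar> \<le> (1 - \<theta>) * norm (x - y) \<and> \<bar>uu x - uu y\<bar> \<le> (1 - \<theta>) * norm (x - y)" if "compact K" for K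
  proof -
    obtain \<theta> where \<theta>: "\<theta> > 0" "\<And>u x y. \<lbrakk>u \<in> \<U>1 \<union> \<U>2; x \<in> K; y \<in> K\<rbrakk> \<Longrightarrow> \<bar>u x - u y\<bar> \<le> (1 - \<theta>) * norm (x - y)"
      using lip[OF \<open>compact K\<close>] by blast
    have 1: "ul x \<le> ul y + (1 - \<theta>) * norm (x - y)" if xy: "x \<in> K" "y \<in> K" for x y
    proof (rule ul_le)
      fix u assume "u \<in> \<U>1"
      then show "u x \<le> ul y + (1 - \<theta>) * norm (x - y)" using \<theta>(2)[of u x y] xy ul_ge[of u y] by simp
    qed
    have 2: "uu x - (1 - \<theta>) * norm (x - y) \<le> uu y" if xy: "x \<in> K" "y \<in> K" for x y
    proof (rule uu_ge)
      fix u assume "u \<in> \<U>2"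
      then show "uu x - (1 - \<theta>) * norm (x - y) \<le> u y" using \<theta>(2)[of u x y] xy uu_le[of u x] by simp
    qed
    show ?thesis
    proof (intro exI[of _ \<theta>] conjI ballI)
      fix x y assume xy: "x \<in> K" "y \<in> K"
      show "\<bar>ul x - ul y\<bar> \<le> (1 - \<theta>) * norm (x - y)"
        using 1[OF xy] 1[OF xy(2,1)] by (simp add: norm_minus_commute)
      show "\<bar>uu x - uu y\<bar> \<le> (1 - \<theta>) * norm (x - y)"
        using 2[OF xy] 2[OF xy(2,1)] by (simp add: norm_minus_commute)
    qed (rule \<theta>(1))
  qed
  moreover have "\<exists>\<delta>>0. \<forall>x\<in>K. V x + \<delta> \<le> ul x \<and> ul x \<le> uu x - \<delta>" if "compact K" for K
  proof -
    obtain \<delta>1 where d1: "\<delta>1 > 0" "\<And>x. x \<in> K \<Longrightarrow> \<exists>u\<in>\<U>1. V x + \<delta>1 \<le> u x"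
      using low[OF \<open>compact K\<close>] by blast
    obtain \<delta>2 where d2: "\<delta>2 > 0" "\<And>u v x. \<lbrakk>u \<in> \<U>1; v \<in> \<U>2; x \<in> K\<rbrakk> \<Longrightarrow> u x + \<delta>2 \<le> v x"
      using gap[OF \<open>compact K\<close>] by blast
    have "V x + min \<delta>1 \<delta>2 \<le> ul x \<and> ul x \<le> uu x - min \<delta>1 \<delta>2" if x: "x \<in> K" for x
    proof
      show "V x + min \<delta>1 \<delta>2 \<le> ul x" using d1(2)[OF x] ul_ge[of _ x] by force
      have "ul x \<le> uu x - \<delta>2"
      proof (rule ul_le)
        fix u assume u: "u \<in> \<U>1"
        have "u x + \<delta>2 \<le> uu x" by (rule uu_ge) (rule d2(2)[OF u _ x])
        then show "u x \<le> uu x - \<delta>2" by simp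
      qed
      then show "ul x \<le> uu x - min \<delta>1 \<delta>2" by simp
    qed
    then show ?thesis using d1(1) d2(1) by (intro exI[of _ "min \<delta>1 \<delta>2"]) auto
  qed
  ultimately show ?thesis using le by (intro exI[of _ ul] exI[of _ uu]) simp
qed

section \<open>The whole sphere\<close>

text \<open>Writing the hyperboloid as a trough with \<open>S = 0\<close> makes the curvature,
  convexity and gradient results available for it.\<close>

lemma hyperboloid_trough:
  assumes a: "norm a = 1" and \<kappa>: "0 < \<kappa>"
  shows "trough (\<lambda>y. sqrt (y\<^sup>2 + \<kappa>)) 0 a x = sqrt ((norm x)\<^sup>2 + \<kappa>)"
proof -
  have "norm (sqrt ((a \<bullet> x)\<^sup>2 + \<kappa>), x - (a \<bullet> x) *\<^sub>R a) = sqrt ((norm x)\<^sup>2 + \<kappa>)"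
    using \<kappa> by (simp add: norm_Pair norm_perp_sq[OF a] dot_square_norm add_pos_nonneg add_nonneg_nonneg)
  then show ?thesis
    unfolding trough_def by (simp add: defect_def height_def axial_def)
qed

text \<open>No cap contains the whole sphere, so the upper family of semitroughs would be empty
  here. One hyperboloid for each curvature serves instead; they are ordered because
  \<open>\<kappa>\<close> decreases in \<open>k\<close>.\<close>

lemma hyperboloid_barriers:
  fixes k1 k2 :: real
  assumes n: "CARD('n) \<ge> 2" and k: "0 < k2" "k2 < k1"
  obtains u1 u2 :: "real ^ 'n \<Rightarrow> real" where "u1 \<in> curvature_solutions k1" "u2 \<in> curvature_solutions k2"
    "convex_on UNIV u1" "\<And>K. compact K \<Longrightarrow> \<exists>\<delta>>0. \<forall>x\<in>K. norm x + \<delta> \<le> u1 x"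
    "\<And>K. compact K \<Longrightarrow> \<exists>\<delta>>0. \<forall>x\<in>K. u1 x + \<delta> \<le> u2 x"
    "\<And>\<epsilon>. \<epsilon> > 0 \<Longrightarrow> \<exists>R. \<forall>x. R \<le> norm x \<longrightarrow> u2 x \<le> norm x + \<epsilon>"
    "\<And>K. compact K \<Longrightarrow> \<exists>\<theta>>0. \<forall>u\<in>{u1, u2}. \<forall>x\<in>K. \<forall>y\<in>K. \<bar>u x - u y\<bar> \<le> (1 - \<theta>) * norm (x - y)"
proof -
  define \<kappa> where "\<kappa> k = k powr (- 2 / real CARD('n))" for k :: real
  have \<kappa>_pos: "\<kappa> k > 0" if "k > 0" for k using that by (simp add: \<kappa>_def)
  have \<kappa>_less: "\<kappa> k1 < \<kappa> k2" unfolding \<kappa>_def using k n by (intro powr_less_mono2_neg) auto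
  define h where "h k x = sqrt ((norm x)\<^sup>2 + \<kappa> k)" for k and x :: "real ^ 'n"
  obtain a :: "real ^ 'n" where a: "norm a = 1" using vector_choose_size[of 1] by auto
  have h: "h k = trough (\<lambda>y. sqrt (y\<^sup>2 + \<kappa> k)) 0 a" if "k > 0" for k
    using hyperboloid_trough[OF a \<kappa>_pos[OF that]] by (auto simp: h_def)
  have prof: "curvature_profile CARD('n) k (\<lambda>y. sqrt (y\<^sup>2 + \<kappa> k)) (\<lambda>y. y / sqrt (y\<^sup>2 + \<kappa> k))
    (\<lambda>y. \<kappa> k / (sqrt (y\<^sup>2 + \<kappa> k)) ^ 3)" if "k > 0" for k
    unfolding \<kappa>_def using that n by (intro hyperboloid_profile) auto
  have cont: "continuous_on A (h k)" for A k unfolding h_def by (intro continuous_intros)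
  have k1: "k1 > 0" using k by simp
  show thesis
  proof (rule that[of "h k1" "h k2"])
    show "h k1 \<in> curvature_solutions k1" "h k2 \<in> curvature_solutions k2"
      using curvature_profile.trough_solution[OF prof a refl] h k by auto
    show "convex_on UNIV (h k1)" using curvature_profile.trough_convex[OF prof[OF k1]] h[OF k1] by metis
  next
    fix K :: "(real ^ 'n) set" assume K: "compact K"
    have "norm x < h k1 x" for x
      unfolding h_def using \<kappa>_pos[OF k1] by (intro real_less_rsqrt) simp
    then have "0 < h k1 x - norm x" for x by simp
    moreover have "continuous_on K (\<lambda>x. h k1 x - norm x)" by (intro continuous_intros cont)
    ultimately obtain \<delta> where "\<delta> > 0" "\<And>z. z \<in> K \<Longrightarrow> \<delta> \<le> h k1 z - norm z"
      using compact_positive_lower_bound[OF K] by blast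
    then show "\<exists>\<delta>>0. \<forall>x\<in>K. norm x + \<delta> \<le> h k1 x" by (intro exI[of _ \<delta>]) force
    have "h k1 x < h k2 x" for x unfolding h_def using \<kappa>_less by (intro real_sqrt_less_mono) simp
    then have "0 < h k2 x - h k1 x" for x by simp
    moreover have "continuous_on K (\<lambda>x. h k2 x - h k1 x)" by (intro continuous_intros cont)
    ultimately obtain \<delta> where "\<delta> > 0" "\<And>z. z \<in> K \<Longrightarrow> \<delta> \<le> h k2 z - h k1 z"
      using compact_positive_lower_bound[OF K] by blast
    then show "\<exists>\<delta>>0. \<forall>x\<in>K. h k1 x + \<delta> \<le> h k2 x" by (intro exI[of _ \<delta>]) force
    obtain \<theta>1 where t1: "\<theta>1 > 0" "\<And>x y. \<lbrakk>x \<in> K; y \<in> K\<rbrakk> \<Longrightarrow> \<bar>h k1 x - h k1 y\<bar> \<le> (1 - \<theta>1) * norm (x - y)"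
      using curvature_profile.trough_uniform_lipschitz[OF prof[OF k1] K, of 0] a h[OF k1] by (metis abs_zero order_refl)
    obtain \<theta>2 where t2: "\<theta>2 > 0" "\<And>x y. \<lbrakk>x \<in> K; y \<in> K\<rbrakk> \<Longrightarrow> \<bar>h k2 x - h k2 y\<bar> \<le> (1 - \<theta>2) * norm (x - y)"
      using curvature_profile.trough_uniform_lipschitz[OF prof[OF k(1)] K, of 0] a h[OF k(1)] by (metis abs_zero order_refl)
    have min: "(1 - \<theta>1) * norm z \<le> (1 - min \<theta>1 \<theta>2) * norm z" "(1 - \<theta>2) * norm z \<le> (1 - min \<theta>1 \<theta>2) * norm z"
      for z :: "real ^ 'n" by (auto intro!: mult_right_mono)
    show "\<exists>\<theta>>0. \<forall>u\<in>{h k1, h k2}. \<forall>x\<in>K. \<forall>y\<in>K. \<bar>u x - u y\<bar> \<le> (1 - \<theta>) * norm (x - y)"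
    proof (intro exI[of _ "min \<theta>1 \<theta>2"] conjI ballI)
      fix u x y assume "u \<in> {h k1, h k2}" and xy: "x \<in> K" "y \<in> K"
      then consider "u = h k1" | "u = h k2" by blast
      then show "\<bar>u x - u y\<bar> \<le> (1 - min \<theta>1 \<theta>2) * norm (x - y)"
        using order_trans[OF t1(2)[OF xy] min(1)] order_trans[OF t2(2)[OF xy] min(2)] by cases simp_all
    qed (use t1(1) t2(1) in simp)
  next
    fix \<epsilon> :: real assume \<epsilon>: "\<epsilon> > 0"
    have "h k2 x \<le> norm x + \<epsilon>" if x: "\<kappa> k2 / \<epsilon> \<le> norm x" for x
      unfolding h_def
    proof (rule real_le_lsqrt)
      have "\<kappa> k2 \<le> \<epsilon> * norm x" using x \<epsilon> by (simp add: field_simps)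
      moreover have "\<epsilon> * norm x \<ge> 0" using \<epsilon> by simp
      ultimately have "\<kappa> k2 \<le> 2 * (\<epsilon> * norm x) + \<epsilon>\<^sup>2" using zero_le_power2[of \<epsilon>] by linarith
      then show "(norm x)\<^sup>2 + \<kappa> k2 \<le> (norm x + \<epsilon>)\<^sup>2" by (simp add: power2_eq_square algebra_simps)
    qed (use \<epsilon> \<kappa>_pos[OF k(1)] in auto)
    then show "\<exists>R. \<forall>x. R \<le> norm x \<longrightarrow> h k2 x \<le> norm x + \<epsilon>" by blast
  qed
qed

lemma support_fun_sphere:
  fixes x :: "real ^ 'n"
  shows "support_fun (sphere 0 1) x = norm x"
proof -
  obtain a :: "real ^ 'n" where a: "norm a = 1" using vector_choose_size[of 1] by auto
  define e where "e = (if x = 0 then a else x /\<^sub>R norm x)"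
  have e: "norm e = 1" using a by (simp add: e_def)
  have "x \<bullet> e = norm x" by (simp add: e_def dot_square_norm power2_eq_square)
  moreover have "x \<bullet> y \<le> norm x" if "norm y = 1" for y using norm_cauchy_schwarz[of x y] that by simp
  ultimately show ?thesis
    unfolding support_fun_def using e by (intro cSup_eq_maximum) (auto simp: image_iff intro!: bexI[of _ e])
qed

theorem theorem1p1:
  fixes F :: "(real ^ 'n) set" and k1 k2 :: real
  assumes "CARD('n) \<ge> 2"
    and "admissible_set F"
    and "0 < k2" and "k2 < k1"
  shows "\<exists>ul uu :: real ^ 'n \<Rightarrow> real.
    (\<forall>x. ul x \<le> uu x) \<and>
    convex_on UNIV ul \<and> sup_of_solutions k1 ul \<and>
    inf_of_solutions k2 uu \<and>
    ((\<lambda>x. \<bar>ul x - support_fun F x\<bar> + \<bar>uu x - support_fun F x\<bar>) \<longlongrightarrow> 0) at_infinity \<and>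
    (\<forall>C. compact C \<longrightarrow> (\<exists>\<theta>>0. \<forall>x\<in>C. \<forall>y\<in>C.
       \<bar>ul x - ul y\<bar> \<le> (1 - \<theta>) * norm (x - y) \<and>
       \<bar>uu x - uu y\<bar> \<le> (1 - \<theta>) * norm (x - y))) \<and>
    (\<forall>C. compact C \<longrightarrow> (\<exists>\<delta>>0. \<forall>x\<in>C.
       support_fun F x + \<delta> \<le> ul x \<and> ul x \<le> uu x - \<delta>))"
proof (cases "F = sphere 0 1")
  case True
  have V: "support_fun F = norm" using support_fun_sphere unfolding True by auto
  obtain u1 u2 :: "real ^ 'n \<Rightarrow> real" where u: "u1 \<in> curvature_solutions k1" "u2 \<in> curvature_solutions k2"
    "convex_on UNIV u1" "\<And>K. compact K \<Longrightarrow> \<exists>\<delta>>0. \<forall>x\<in>K. norm x + \<delta> \<le> u1 x"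
    "\<And>K. compact K \<Longrightarrow> \<exists>\<delta>>0. \<forall>x\<in>K. u1 x + \<delta> \<le> u2 x"
    "\<And>\<epsilon>. \<epsilon> > 0 \<Longrightarrow> \<exists>R. \<forall>x. R \<le> norm x \<longrightarrow> u2 x \<le> norm x + \<epsilon>"
    "\<And>K. compact K \<Longrightarrow> \<exists>\<theta>>0. \<forall>u\<in>{u1, u2}. \<forall>x\<in>K. \<forall>y\<in>K. \<bar>u x - u y\<bar> \<le> (1 - \<theta>) * norm (x - y)"
    using hyperboloid_barriers[OF assms(1,3,4)] by blast
  show ?thesis unfolding V
  proof (rule barriers_from_families[of "{u1}" "{u2}"])
    show "\<exists>\<theta>>0. \<forall>u\<in>{u1} \<union> {u2}. \<forall>x\<in>K. \<forall>y\<in>K. \<bar>u x - u y\<bar> \<le> (1 - \<theta>) * norm (x - y)" if "compact K" for K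
      using u(7)[OF that] by (simp add: insert_commute)
  qed (use u in auto)
next
  case False
  note n = assms(1)
  have F: "F \<noteq> {}" "closed F" "F \<subseteq> sphere 0 1" using assms(2) by (auto simp: admissible_set_def)
  obtain S0 where S0: "S0 \<ge> 0" "touching_caps F S0" using admissible_touching_caps[OF assms(1,2)] by blast
  note inscribed = inscribed_cap[OF n F False S0]
  note circumscribed = circumscribed_cap[OF n F False S0]
  obtain f f' f'' :: "real \<Rightarrow> real \<Rightarrow> real"
    where prof: "\<And>k. 0 < k \<Longrightarrow> semitrough_profile CARD('n) k (f k) (f' k) (f'' k)"
      and less: "\<And>y. f k1 y < f k2 y"
    using semitrough_profiles[OF n] assms(3,4) by metis
  have k1: "0 < k1" using assms(3,4) by simp
  interpret A: semitrough_profile "CARD('n)" k1 "f k1" "f' k1" "f'' k1" by (rule prof[OF k1])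
  interpret B: semitrough_profile "CARD('n)" k2 "f k2" "f' k2" "f'' k2" by (rule prof[OF assms(3)])
  \<comment> \<open>The lower family uses the single parameter \<open>- S0\<close>. The upper one
    needs the whole range, as the complement of a ball that misses \<open>F\<close> has a parameter
    depending on the direction.\<close>
  define \<U>1 where "\<U>1 = {trough (f k1) (- S0) a | a :: real ^ 'n. norm a = 1 \<and> cap (- S0) a \<subseteq> F}"
  define \<U>2 where "\<U>2 = {trough (f k2) S b | S (b :: real ^ 'n). \<bar>S\<bar> \<le> S0 \<and> norm b = 1 \<and> F \<subseteq> cap S b}"
  show ?thesis
  proof (rule barriers_from_families[of \<U>1 \<U>2])
    show "\<U>1 \<noteq> {}" using inscribed F(1) unfolding \<U>1_def by blast
    show "\<U>2 \<noteq> {}" using circumscribed unfolding \<U>2_def by blast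
    show "\<U>1 \<subseteq> curvature_solutions k1" unfolding \<U>1_def using A.trough_solution by auto
    show "\<U>2 \<subseteq> curvature_solutions k2" unfolding \<U>2_def using B.trough_solution by auto
    show "convex_on UNIV u" if "u \<in> \<U>1" for u using that A.trough_convex unfolding \<U>1_def by auto
  next
    fix K :: "(real ^ 'n) set" assume K: "compact K"
    obtain \<delta> where \<delta>: "\<delta> > 0" "\<And>a \<zeta> x. \<lbrakk>norm a = 1; \<zeta> \<in> cap (- S0) a; x \<in> K\<rbrakk> \<Longrightarrow> x \<bullet> \<zeta> + \<delta> \<le> trough (f k1) (- S0) a x"
      using A.trough_cap_gap[OF K] by blast
    have "\<exists>u\<in>\<U>1. support_fun F x + \<delta> \<le> u x" if x: "x \<in> K" for x
    proof -
      \<comment> \<open>The point of \<open>F\<close> that realises the support function at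
        \<open>x\<close> selects the cap, so a gap above \<open>x \<bullet> \<zeta>\<close> is a gap
        above the support function.\<close>
      obtain \<zeta> where \<zeta>: "\<zeta> \<in> F" "support_fun F x = x \<bullet> \<zeta>" using support_fun_attained[OF F] by blast
      obtain a where a: "norm a = 1" "\<zeta> \<in> cap (- S0) a" "cap (- S0) a \<subseteq> F" using inscribed[OF \<zeta>(1)] by blast
      then have "trough (f k1) (- S0) a \<in> \<U>1" unfolding \<U>1_def by blast
      then show ?thesis using \<delta>(2)[OF a(1,2) x] \<zeta>(2) by auto
    qed
    then show "\<exists>\<delta>>0. \<forall>x\<in>K. \<exists>u\<in>\<U>1. support_fun F x + \<delta> \<le> u x" using \<delta>(1) by blast
    obtain \<delta> where \<delta>: "\<delta> > 0" "\<And>SA SB a b x. \<lbrakk>\<bar>SA\<bar> \<le> S0; \<bar>SB\<bar> \<le> S0; norm a = 1; norm b = 1; x \<in> K;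
       norm (sqrt (1 + SA\<^sup>2) *\<^sub>R a - sqrt (1 + SB\<^sup>2) *\<^sub>R b) \<le> SB - SA\<rbrakk>
      \<Longrightarrow> trough (f k1) SA a x + \<delta> \<le> trough (f k2) SB b x"
      using trough_family_gap[OF A.semitrough_profile_axioms B.semitrough_profile_axioms less K, of S0] by blast
    have "u x + \<delta> \<le> v x" if uv: "u \<in> \<U>1" "v \<in> \<U>2" "x \<in> K" for u v x
    proof -
      obtain a where a: "u = trough (f k1) (- S0) a" "norm a = 1" "cap (- S0) a \<subseteq> F" using uv(1) unfolding \<U>1_def by blast
      obtain S b where b: "v = trough (f k2) S b" "\<bar>S\<bar> \<le> S0" "norm b = 1" "F \<subseteq> cap S b" using uv(2) unfolding \<U>2_def by blast
      \<comment> \<open>\<open>F\<close> separates the caps of the two families, so every lower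
        semitrough is comparable with every upper one.\<close>
      have "cap (- S0) a \<subseteq> cap S b" using a b by blast
      then show ?thesis unfolding a(1) b(1)
        using S0(1) cap_subset_causal(2)[OF n a(2) b(3) \<open>cap (- S0) a \<subseteq> cap S b\<close>]
        by (intro \<delta>(2) a b uv(3)) auto
    qed
    then show "\<exists>\<delta>>0. \<forall>u\<in>\<U>1. \<forall>v\<in>\<U>2. \<forall>x\<in>K. u x + \<delta> \<le> v x" using \<delta>(1) by blast
    obtain \<theta>1 where t1: "\<theta>1 > 0" "\<And>S a x y. \<lbrakk>\<bar>S\<bar> \<le> S0; norm a = 1; x \<in> K; y \<in> K\<rbrakk> \<Longrightarrow>
      \<bar>trough (f k1) S a x - trough (f k1) S a y\<bar> \<le> (1 - \<theta>1) * norm (x - y)"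
      using A.trough_uniform_lipschitz[OF K] by blast
    obtain \<theta>2 where t2: "\<theta>2 > 0" "\<And>S a x y. \<lbrakk>\<bar>S\<bar> \<le> S0; norm a = 1; x \<in> K; y \<in> K\<rbrakk> \<Longrightarrow>
      \<bar>trough (f k2) S a x - trough (f k2) S a y\<bar> \<le> (1 - \<theta>2) * norm (x - y)"
      using B.trough_uniform_lipschitz[OF K] by blast
    have min: "(1 - \<theta>1) * norm z \<le> (1 - min \<theta>1 \<theta>2) * norm z" "(1 - \<theta>2) * norm z \<le> (1 - min \<theta>1 \<theta>2) * norm z"
      for z :: "real ^ 'n" by (auto intro!: mult_right_mono)
    have "\<bar>u x - u y\<bar> \<le> (1 - min \<theta>1 \<theta>2) * norm (x - y)" if u: "u \<in> \<U>1 \<union> \<U>2" and xy: "x \<in> K" "y \<in> K" for u x y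
      using u
    proof
      assume "u \<in> \<U>1"
      then obtain a where "u = trough (f k1) (- S0) a" "norm a = 1" unfolding \<U>1_def by blast
      then show ?thesis using t1(2)[of "- S0" a x y] S0(1) xy min(1)[of "x - y"] by simp
    next
      assume "u \<in> \<U>2"
      then obtain S b where "u = trough (f k2) S b" "\<bar>S\<bar> \<le> S0" "norm b = 1" unfolding \<U>2_def by blast
      then show ?thesis using t2(2)[of S b x y] xy min(2)[of "x - y"] by simp
    qed
    then show "\<exists>\<theta>>0. \<forall>u\<in>\<U>1 \<union> \<U>2. \<forall>x\<in>K. \<forall>y\<in>K. \<bar>u x - u y\<bar> \<le> (1 - \<theta>) * norm (x - y)"
      using t1(1) t2(1) by (intro exI[of _ "min \<theta>1 \<theta>2"]) auto
  next
    fix \<epsilon> :: real assume "\<epsilon> > 0"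
    then obtain R where R: "\<And>S (b :: real ^ 'n) x. \<lbrakk>\<bar>S\<bar> \<le> S0; norm b = 1; R \<le> norm x\<rbrakk> \<Longrightarrow>
        \<exists>\<zeta>\<in>cap S b. trough (f k2) S b x \<le> x \<bullet> \<zeta> + \<epsilon>"
      using B.trough_asymptotic[OF n, of \<epsilon> S0] by blast
    have "\<exists>v\<in>\<U>2. v x \<le> support_fun F x + \<epsilon>" if x: "R \<le> norm x" for x
    proof -
      obtain b S where b: "norm b = 1" "\<bar>S\<bar> \<le> S0" "F \<subseteq> cap S b" "\<And>\<mu>. \<mu> \<in> cap S b \<Longrightarrow> x \<bullet> \<mu> \<le> support_fun F x"
        using circumscribed[of x] by blast
      obtain \<zeta> where "\<zeta> \<in> cap S b" "trough (f k2) S b x \<le> x \<bullet> \<zeta> + \<epsilon>" using R[OF b(2,1) x] by blast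
      moreover have "trough (f k2) S b \<in> \<U>2" unfolding \<U>2_def using b by blast
      ultimately show ?thesis using b(4)[of \<zeta>] by (intro bexI[of _ "trough (f k2) S b"]) auto
    qed
    then show "\<exists>R. \<forall>x. R \<le> norm x \<longrightarrow> (\<exists>v\<in>\<U>2. v x \<le> support_fun F x + \<epsilon>)" by blast
  qed
qed

end
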